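(* Let $(Z_n)_{n\ge0}$ be a $d$-type irreducible, aperiodic, sub-critical Galton-Watson process (see the context), and assume that, for some $q_0>1$, $$\mathbb{E}\left[|Z_1|^{q_0}\mid Z_0=(1,\ldots,1)\right]<\infty.$$ Then Condition (E) (defined in the context) holds true with $\varphi_1(z)=|z|^q$ for any $q\in(1,q_0]$. In particular, the domain of attraction of $\nu_{QSD}$ contains all the probability measures $\mu$ on $E=\mathbb{Z}_+^d\setminus\{0\}$ such that $\mu(|\cdot|^q)<\infty$ for some $q>1$.
   Context: A Galton-Watson process with $d$ types is a Markov process $(Z_n)_{n\in\mathbb{Z}_+}$ on $\mathbb{Z}_+^d=E\cup\{\partial\}$ absorbed at $\partial=0$ with, for all $n\ge0$ and $i\in\{1,\ldots,d\}$, $Z_{n+1}^i=\sum_{k=1}^d\sum_{\ell=1}^{Z_n^k}\zeta_{k,i}^{(n,\ell)}$, where the random vectors $(\zeta_{k,1}^{(n,\ell)},\ldots,\zeta_{k,d}^{(n,\ell)})_{n,\ell,k}$ in $\mathbb{Z}_+^d$ are independent and, for each $k\in\{1,\ldots,d\}$, i.i.d. in $(n,\ell)$. The mean offspring matrix is $M=(M_{k,i})_{1\le k,i\le d}$ with $M_{k,i}=\mathbb{E}(\zeta_{k,i}^{(n,\ell)})$; it is assumed that $M_{k,i}<+\infty$ for all $k,i$ and that there is $n\ge1$ with $[M^n]_{k,i}>0$ for all $k,i$. Sub-critical means that the spectral radius of $M$ satisfies $\rho(M)<1$. $|z|=z_1+\cdots+z_d$ for $z\in\mathbb{Z}_+^d$.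 $\mathbb{P}_x$ and $\mathbb{E}_x$ are the law and expectation for the process started from $x$, $\mathbb{P}_\mu=\int\mathbb{P}_x\,\mu(\mathrm dx)$, $\mu(f)=\int f\,\mathrm d\mu$. Irreducible: for all $x,y\in E$ there is $n\ge1$ with $\mathbb{P}_x(Z_n=y)>0$; aperiodic: $\mathbb{P}_x(Z_n=y)>0$ for all $x,y\in E$ and all $n$ large enough. $\tau_\partial=\inf\{n\in\mathbb{Z}_+:Z_n=0\}$; $P_1f(x)=\mathbb{E}_x(f(Z_1)\mathbf{1}_{1<\tau_\partial})$. Condition (E) (for the process $Z$). There exist a positive integer $n_1$, positive real constants $\theta_1,\theta_2,c_1,c_2,c_3$, two functions $\varphi_1,\varphi_2:E\to\mathbb{R}_+$ and a probability measure $\nu$ on a subset $K\subset E$ such that: - (E1) for all $x\in K$, $\mathbb{P}_x(Z_{n_1}\in\cdot)\ge c_1\nu(\cdot\cap K)$. - (E2) $\theta_1<\theta_2$, $\inf_E\varphi_1\ge1$, $\sup_K\varphi_1<\infty$, $\inf_K\varphi_2>0$, $\sup_E\varphi_2\le1$, and for all $x\in E$, $P_1\varphi_1(x)\le\theta_1\varphi_1(x)+c_2\mathbf{1}_K(x)$ and $P_1\varphi_2(x)\ge\theta_2\varphi_2(x)$. - (E3) $\displaystyle\sup_{n\in\mathbb{Z}_+}\frac{\sup_{y\in K}\mathbb{P}_y(n<\tau_\partial)}{\inf_{y\in K}\mathbb{P}_y(n<\tau_\partial)}\le c_3$. - (E4) for all $x\in K$ there exists $n_4(x)$ such that $\mathbb{P}_x(Z_n\in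 K)>0$ for all $n\ge n_4(x)$. Under Condition (E), there is a unique quasi-stationary distribution $\nu_{QSD}$ (probability measure on $E$ with $\mathbb{P}_{\nu_{QSD}}(Z_n\in\cdot\mid n<\tau_\partial)=\nu_{QSD}$ for all $n$) with $\nu_{QSD}(\varphi_1)<\infty$ and $\nu_{QSD}(\varphi_2)>0$. Its domain of attraction is the set of probability measures $\mu$ on $E$ such that $\mathbb{P}_\mu(Z_n\in\cdot\mid n<\tau_\partial)\to\nu_{QSD}$ in total variation as $n\to+\infty$.
   Formalization: With φ1(z)=|z|^q the claim fails if a row sum of M is ≥1 (possible for d≥2); proved instead with φ1(z)=(Σ a_i z_i)^q for every right Perron eigenvector a of M with all a_i≥1, which includes |z|^q when all row sums agree. The domain-of-attraction claim is kept with |·|^q. *)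

theory Defs
  imports "HOL-Probability.Probability"
begin

section \<open>Multitype Galton-Watson processes\<close>

text \<open>
  The set of types is a finite type \<open>'d\<close>, so that the number of types is \<open>CARD('d)\<close>
  and the state space is \<open>nat ^ 'd\<close>.
  The random vector \<open>\<zeta> n l k\<close> is the offspring of the \<open>l\<close>-th individual of type \<open>k\<close> in generation
  \<open>n\<close> (individuals are numbered from 0). All starting points use the same family \<open>\<zeta>\<close>:
  the law of the process started from \<open>x\<close> is that of \<open>gw \<zeta> x\<close>.
\<close>

type_synonym 'd state = "nat ^ 'd"
type_synonym ('a, 'd) offspring = "nat \<Rightarrow> nat \<Rightarrow> 'd \<Rightarrow> 'a \<Rightarrow> nat ^ 'd"

definition living :: "('d::finite) state set" where
  "living = - {0}"

definition total :: "('d::finite) state \<Rightarrow> nat" where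
  "total z = (\<Sum>i\<in>UNIV. z $ i)"

primrec gw :: "('a, 'd::finite) offspring \<Rightarrow> 'd state \<Rightarrow> nat \<Rightarrow> 'a \<Rightarrow> 'd state" where
  "gw \<zeta> x 0 \<omega> = x"
| "gw \<zeta> x (Suc n) \<omega> = (\<Sum>k\<in>UNIV. \<Sum>l<gw \<zeta> x n \<omega> $ k. \<zeta> n l k \<omega>)"

definition extinction_time :: "('a, 'd::finite) offspring \<Rightarrow> 'd state \<Rightarrow> 'a \<Rightarrow> enat" where
  "extinction_time \<zeta> x \<omega> = (INF n\<in>{n. gw \<zeta> x n \<omega> = 0}. enat n)"

text \<open>The index \<open>0 0\<close> is irrelevant when the offspring vectors are identically distributed.\<close>

definition mean_matrix :: "'a measure \<Rightarrow> ('a, 'd::finite) offspring \<Rightarrow> real ^ 'd ^ 'd" where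
  "mean_matrix \<Omega> \<zeta> = (\<chi> k i. \<integral>\<omega>. real (\<zeta> 0 0 k \<omega> $ i) \<partial>\<Omega>)"

text \<open>The operation \<open>^\<close> on \<open>real ^ 'd ^ 'd\<close> is componentwise, hence matrix powers are iterates of \<open>**\<close>.\<close>

definition primitive_matrix :: "real ^ 'd ^ 'd::finite \<Rightarrow> bool" where
  "primitive_matrix M \<longleftrightarrow> (\<exists>n\<ge>1. \<forall>k i. ((\<lambda>A. M ** A) ^^ n) (mat 1) $ k $ i > 0)"

definition spectral_radius :: "real ^ 'd ^ 'd::finite \<Rightarrow> real" where
  "spectral_radius M =
     Sup {cmod l | l. \<exists>v. v \<noteq> 0 \<and> map_matrix complex_of_real M *v v = l *s v}"

locale galton_watson = prob_space \<Omega>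
  for \<Omega> :: "'a measure" and \<zeta> :: "('a, 'd::finite) offspring" +
  assumes indep: "indep_vars (\<lambda>_. count_space UNIV) (\<lambda>(n, l, k). \<zeta> n l k) UNIV"
    and ident: "\<And>n l n' l' k. distr \<Omega> (count_space UNIV) (\<zeta> n l k)
                             = distr \<Omega> (count_space UNIV) (\<zeta> n' l' k)"
    and finite_mean: "\<And>n l k i. integrable \<Omega> (\<lambda>\<omega>. real (\<zeta> n l k \<omega> $ i))"
    and primitive: "primitive_matrix (mean_matrix \<Omega> \<zeta>)"

definition gw_prob :: "'a measure \<Rightarrow> ('a, 'd::finite) offspring \<Rightarrow> 'd state \<Rightarrow> nat \<Rightarrow> 'd state set \<Rightarrow> real"
  where "gw_prob \<Omega> \<zeta> x n A = measure \<Omega> {\<omega> \<in> space \<Omega>. gw \<zeta> x n \<omega> \<in> A}"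

definition gw_prob_alive :: "'a measure \<Rightarrow> ('a, 'd::finite) offspring \<Rightarrow> 'd state \<Rightarrow> nat \<Rightarrow> 'd state set \<Rightarrow> real"
  where "gw_prob_alive \<Omega> \<zeta> x n A =
    measure \<Omega> {\<omega> \<in> space \<Omega>. gw \<zeta> x n \<omega> \<in> A \<and> enat n < extinction_time \<zeta> x \<omega>}"

definition survival :: "'a measure \<Rightarrow> ('a, 'd::finite) offspring \<Rightarrow> 'd state \<Rightarrow> nat \<Rightarrow> real" where
  "survival \<Omega> \<zeta> x n = gw_prob_alive \<Omega> \<zeta> x n UNIV"

definition gw_irreducible :: "'a measure \<Rightarrow> ('a, 'd::finite) offspring \<Rightarrow> bool" where
  "gw_irreducible \<Omega> \<zeta> \<longleftrightarrow> (\<forall>x\<in>living. \<forall>y\<in>living. \<exists>n\<ge>1. gw_prob \<Omega> \<zeta> x n {y} > 0)"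

definition gw_aperiodic :: "'a measure \<Rightarrow> ('a, 'd::finite) offspring \<Rightarrow> bool" where
  "gw_aperiodic \<Omega> \<zeta> \<longleftrightarrow>
     (\<forall>x\<in>living. \<forall>y\<in>living. eventually (\<lambda>n. gw_prob \<Omega> \<zeta> x n {y} > 0) sequentially)"

definition gw_subcritical :: "'a measure \<Rightarrow> ('a, 'd::finite) offspring \<Rightarrow> bool" where
  "gw_subcritical \<Omega> \<zeta> \<longleftrightarrow> spectral_radius (mean_matrix \<Omega> \<zeta>) < 1"

definition P1 :: "'a measure \<Rightarrow> ('a, 'd::finite) offspring \<Rightarrow> ('d state \<Rightarrow> real) \<Rightarrow> 'd state \<Rightarrow> ennreal" where
  "P1 \<Omega> \<zeta> f x = (\<integral>\<^sup>+ \<omega>. ennreal (f (gw \<zeta> x 1 \<omega>)) * indicator {\<omega>. 1 < extinction_time \<zeta> x \<omega>} \<omega> \<partial>\<Omega>)"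

section \<open>Condition (E)\<close>

text \<open>
  The Lyapunov functions are parameters, all other data are existentially quantified. Only the
  values of the functions on \<open>living\<close> matter. Probability measures on the (countable, discrete)
  state space are given as \<open>pmf\<close>s.
  In the quotient of (E3), an infimum \<open>0\<close> yields \<open>\<infinity>\<close> unless the supremum vanishes as well,
  which (E4) excludes.
\<close>

definition condition_E ::
  "'a measure \<Rightarrow> ('a, 'd::finite) offspring \<Rightarrow> ('d state \<Rightarrow> real) \<Rightarrow> ('d state \<Rightarrow> real) \<Rightarrow> bool" where
  "condition_E \<Omega> \<zeta> \<phi>1 \<phi>2 \<longleftrightarrow>
    (\<forall>x\<in>living. 0 \<le> \<phi>1 x) \<and> (\<forall>x\<in>living. 0 \<le> \<phi>2 x) \<and>
    (\<exists>(n1::nat) (\<theta>1::real) (\<theta>2::real) (c1::real) (c2::real) (c3::real) K (\<nu> :: 'd state pmf).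
      n1 > 0 \<and> \<theta>1 > 0 \<and> \<theta>2 > 0 \<and> c1 > 0 \<and> c2 > 0 \<and> c3 > 0 \<and> K \<subseteq> living \<and> set_pmf \<nu> \<subseteq> K \<and>
      \<comment> \<open>(E1)\<close>
      (\<forall>x\<in>K. \<forall>A. gw_prob \<Omega> \<zeta> x n1 A \<ge> c1 * measure \<nu> (A \<inter> K)) \<and>
      \<comment> \<open>(E2)\<close>
      \<theta>1 < \<theta>2 \<and>
      (\<forall>x\<in>living. 1 \<le> \<phi>1 x) \<and> bdd_above (\<phi>1 ` K) \<and>
      (\<exists>\<epsilon>>0. \<forall>x\<in>K. \<epsilon> \<le> \<phi>2 x) \<and> (\<forall>x\<in>living. \<phi>2 x \<le> 1) \<and>
      (\<forall>x\<in>living. P1 \<Omega> \<zeta> \<phi>1 x \<le> ennreal (\<theta>1 * \<phi>1 x + c2 * indicator K x)) \<and>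
      (\<forall>x\<in>living. P1 \<Omega> \<zeta> \<phi>2 x \<ge> ennreal (\<theta>2 * \<phi>2 x)) \<and>
      \<comment> \<open>(E3)\<close>
      (SUP n. (SUP y\<in>K. ennreal (survival \<Omega> \<zeta> y n)) / (INF y\<in>K. ennreal (survival \<Omega> \<zeta> y n)))
        \<le> ennreal c3 \<and>
      \<comment> \<open>(E4)\<close>
      (\<forall>x\<in>K. \<exists>n4. \<forall>n\<ge>n4. gw_prob \<Omega> \<zeta> x n K > 0))"

section \<open>Quasi-stationary distributions\<close>

definition cond_law ::
  "'a measure \<Rightarrow> ('a, 'd::finite) offspring \<Rightarrow> 'd state pmf \<Rightarrow> nat \<Rightarrow> 'd state set \<Rightarrow> real" where
  "cond_law \<Omega> \<zeta> \<mu> n A =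
     (\<integral>x. gw_prob_alive \<Omega> \<zeta> x n A \<partial>\<mu>) / (\<integral>x. survival \<Omega> \<zeta> x n \<partial>\<mu>)"

definition quasi_stationary :: "'a measure \<Rightarrow> ('a, 'd::finite) offspring \<Rightarrow> 'd state pmf \<Rightarrow> bool" where
  "quasi_stationary \<Omega> \<zeta> \<nu> \<longleftrightarrow>
     set_pmf \<nu> \<subseteq> living \<and> (\<forall>n A. cond_law \<Omega> \<zeta> \<nu> n A = measure \<nu> A)"

definition attraction_domain ::
  "'a measure \<Rightarrow> ('a, 'd::finite) offspring \<Rightarrow> 'd state pmf \<Rightarrow> 'd state pmf set" where
  "attraction_domain \<Omega> \<zeta> \<nu> =
     {\<mu>. set_pmf \<mu> \<subseteq> living \<and>
         (\<lambda>n. SUP A. \<bar>cond_law \<Omega> \<zeta> \<mu> n A - measure \<nu> A\<bar>) \<longlonglongrightarrow> 0}"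

text \<open>The equivalence expresses existence and uniqueness at once.\<close>

definition is_nu_QSD ::
  "'a measure \<Rightarrow> ('a, 'd::finite) offspring \<Rightarrow> ('d state \<Rightarrow> real) \<Rightarrow> ('d state \<Rightarrow> real) \<Rightarrow> 'd state pmf \<Rightarrow> bool"
  where
  "is_nu_QSD \<Omega> \<zeta> \<phi>1 \<phi>2 \<nu> \<longleftrightarrow>
     (\<forall>\<nu>'. quasi_stationary \<Omega> \<zeta> \<nu>' \<and> (\<integral>\<^sup>+ x. ennreal (\<phi>1 x) \<partial>\<nu>') < \<infinity> \<and> (\<integral>\<^sup>+ x. ennreal (\<phi>2 x) \<partial>\<nu>') > 0
        \<longleftrightarrow> \<nu>' = \<nu>)"

section \<open>Weighted population size\<close>

text \<open>
  Let \<open>|z| = total z\<close>. As \<open>\<phi>2\<close> is bounded, (E2) forces \<open>\<theta>1 < \<theta>2 \<le> 1\<close>. Its drift inequality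
  for \<open>\<phi>1 z = |z| powr q\<close> therefore fails as soon as a row sum \<open>r\<close> of the mean matrix is at least
  \<open>1\<close>: at \<open>n\<close> individuals of that type, \<open>P1 \<phi>1 \<ge> (r * n) powr q\<close> by Jensen. With several types,
  sub-criticality does not exclude this. The population size is therefore measured in the equivalent
  norm \<open>weighted_size a\<close> with \<open>a\<close> a right Perron eigenvector of the mean matrix. The choice \<open>a = 1\<close>,
  that is \<open>weighted_size a z = |z|\<close>, is allowed exactly when all row sums of the mean matrix agree,
  in particular when there is a single type. The normalisation \<open>1 \<le> a $ i\<close> gives
  \<open>|z| \<le> weighted_size a z\<close> and hence \<open>inf \<phi>1 \<ge> 1\<close>.
\<close>

definition weighted_size :: "real ^ 'd \<Rightarrow> ('d::finite) state \<Rightarrow> real" where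
  "weighted_size a z = (\<Sum>i\<in>UNIV. a $ i * real (z $ i))"

definition perron_weights :: "real ^ 'd ^ 'd::finite \<Rightarrow> (real ^ 'd) set" where
  "perron_weights M = {a. M *v a = spectral_radius M *s a \<and> (\<forall>i. 1 \<le> a $ i)}"

end

theory Submission
  imports Defs
begin

text \<open>
  The proof rests on one change of measure. Let \<open>\<rho> < 1\<close> be the spectral radius of the mean matrix and
  \<open>a\<close> a right Perron eigenvector. The weighted size \<open>w z = \<Sum>i. a $ i * z $ i\<close> satisfies
  \<open>P w = \<rho> * w\<close> for the one-step operator \<open>P\<close>, and it vanishes exactly at the extinct state. Hence
  \<open>Q x y = P x y * w y / (\<rho> * w x)\<close> is a Markov kernel without killing on the living states, and
  \<open>P^n f = \<rho>^n * w * Q^n (f / w)\<close>: everything about the process conditioned on survival can be read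
  off from the ergodic behaviour of \<open>Q\<close>.

  The moment assumption makes \<open>Q\<close> ergodic. A sum of \<open>N\<close> independent offspring
  contributions has \<open>q\<close>-th moment at most \<open>(mean)^q + \<epsilon> * N^q + C\<close> (\<open>sum_moment_bound\<close>), so that
  \<open>P (w^q) \<le> (\<rho>^q + \<epsilon>) * w^q + C\<close>. As \<open>\<rho>^q < \<rho>\<close>, this is at once the drift inequality of (E2), with a
  rate \<open>\<theta>1 < \<rho>\<close>, and, divided by \<open>\<rho> * w\<close>, a drift inequality for \<open>Q\<close> with the Lyapunov function
  \<open>w^(q-1)\<close>, whose sublevel sets are finite. With aperiodicity, the argument of Hairer and Mattingly
  for Harris' theorem gives an invariant law \<open>\<pi>\<close> of \<open>Q\<close> and convergence to it in total variation
  (\<open>ergodic_theorem\<close>).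

  Transforming back, \<open>\<rho>^(-n) * P_x(Z_n \<in> A)\<close> converges to \<open>c * w x * \<nu> A\<close>, where \<open>\<nu>\<close> is
  proportional to \<open>\<pi> / w\<close>; the error is at most \<open>w x * r n x\<close> with \<open>r \<le> 1\<close> and \<open>r n x \<longlonglongrightarrow> 0\<close>, uniformly
  in \<open>A\<close> (\<open>quasi_stationary_limit\<close>). Three consequences finish the proof.

  \<^item> For a finite nonempty set \<open>K\<close> of living states and \<open>0 < \<theta>2 < \<rho>\<close>, the mass \<open>P_x(Z_n \<in> K)\<close> from
    the points \<open>x\<close> of \<open>K\<close> is eventually at least \<open>\<theta>2^n\<close>. A discounted occupation time
    of \<open>K\<close> then serves as \<open>\<phi>2\<close> (\<open>occupation_function\<close>). The remaining parts of Condition (E) hold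
    because \<open>K\<close> is finite and the process is aperiodic (\<open>condition_E_holds\<close>).

  \<^item> The errors are dominated by \<open>w\<close>, so they can be integrated against every initial law with a
    finite mean size, in particular against one with a finite moment of order \<open>q > 1\<close>
    (\<open>conditional_limit\<close>).

  \<^item> A quasi-stationary distribution that integrates \<open>w^q\<close> lies in this domain of attraction, and its
    conditioned laws do not move; so it is \<open>\<nu>\<close>. Conversely \<open>\<nu>\<close> charges all living states and
    integrates \<open>w^q\<close> for all \<open>q \<le> q0\<close>, hence is the distribution singled out by \<open>\<phi>1\<close> and \<open>\<phi>2\<close>.
\<close>

section \<open>Iterated Markov kernels\<close>

primrec kpow :: "('a \<Rightarrow> 'a pmf) \<Rightarrow> nat \<Rightarrow> 'a \<Rightarrow> 'a pmf" where
  "kpow Q 0 x = return_pmf x"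
| "kpow Q (Suc n) x = bind_pmf (kpow Q n x) Q"

lemma kpow_1 [simp]: "kpow Q (Suc 0) x = Q x"
  by (simp add: bind_return_pmf)

lemma kpow_add: "kpow Q (m + n) x = bind_pmf (kpow Q m x) (kpow Q n)"
  by (induction n) (simp_all add: bind_return_pmf' bind_assoc_pmf)

lemma set_kpow_subset:
  assumes "\<And>x. x \<in> S \<Longrightarrow> set_pmf (Q x) \<subseteq> S" and "x \<in> S"
  shows "set_pmf (kpow Q n x) \<subseteq> S"
  using assms by (induction n) fastforce+

lemma integrable_pmf_bounded:
  fixes f :: "'a \<Rightarrow> real"
  assumes "\<And>y. y \<in> set_pmf p \<Longrightarrow> \<bar>f y\<bar> \<le> B"
  shows "integrable (measure_pmf p) f"
  using assms by (intro measure_pmf.integrable_const_bound[where B = B])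
    (auto simp: AE_measure_pmf_iff)

lemma expectation_pmf_unit_interval:
  fixes f :: "'a \<Rightarrow> real"
  assumes "\<And>y. 0 \<le> f y" "\<And>y. f y \<le> 1"
  shows "0 \<le> measure_pmf.expectation p f" "measure_pmf.expectation p f \<le> 1"
  using assms integrable_pmf_bounded[of p f 1] measure_pmf.integral_le_const[of p f 1]
  by (auto intro!: integral_nonneg_AE)

lemma expectation_pmf_mono:
  fixes f g :: "'a \<Rightarrow> real"
  assumes "integrable (measure_pmf p) f" "integrable (measure_pmf p) g"
    and "\<And>y. y \<in> set_pmf p \<Longrightarrow> f y \<le> g y"
  shows "measure_pmf.expectation p f \<le> measure_pmf.expectation p g"
  using assms by (intro integral_mono_AE) (auto simp: AE_measure_pmf_iff)

lemma expectation_bind_pmf: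
  fixes f :: "'b \<Rightarrow> real"
  assumes f: "\<And>y. 0 \<le> f y" "\<And>y. f y \<le> 1"
  shows "measure_pmf.expectation (bind_pmf p Q) f
           = measure_pmf.expectation p (\<lambda>x. measure_pmf.expectation (Q x) f)"
proof -
  have E: "ennreal (measure_pmf.expectation r f) = (\<integral>\<^sup>+y. f y \<partial>measure_pmf r)" for r
    using f integrable_pmf_bounded[of r f 1] by (subst nn_integral_eq_integral) auto
  have "ennreal (measure_pmf.expectation (bind_pmf p Q) f)
      = (\<integral>\<^sup>+x. ennreal (measure_pmf.expectation (Q x) f) \<partial>measure_pmf p)"
    by (simp add: E)
  also have "\<dots> = ennreal (measure_pmf.expectation p (\<lambda>x. measure_pmf.expectation (Q x) f))"
    using expectation_pmf_unit_interval[where f = f, OF f]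
    by (intro nn_integral_eq_integral integrable_pmf_bounded[where B = 1]) auto
  finally show ?thesis
    using expectation_pmf_unit_interval[where f = f, OF f] by (simp add: integral_nonneg_AE)
qed

lemma measure_kpow_add:
  "measure (kpow Q (m + n) x) A = measure_pmf.expectation (kpow Q m x) (\<lambda>z. measure (kpow Q n z) A)"
  using expectation_bind_pmf[of "indicator A" "kpow Q m x" "kpow Q n"] by (simp add: kpow_add)

lemma measure_kpow_add_ge: "pmf (kpow Q m x) y * measure (kpow Q n y) A \<le> measure (kpow Q (m + n) x) A"
proof -
  have "pmf (kpow Q m x) y * measure (kpow Q n y) A
      = measure_pmf.expectation (kpow Q m x) (\<lambda>z. measure (kpow Q n y) A * indicator {y} z)"
    by (simp add: measure_pmf_single mult.commute)
  also have "\<dots> \<le> measure_pmf.expectation (kpow Q m x) (\<lambda>z. measure (kpow Q n z) A)"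
    by (intro expectation_pmf_mono integrable_pmf_bounded[where B = 1])
       (auto simp: indicator_def)
  finally show ?thesis by (simp add: measure_kpow_add)
qed

section \<open>Ergodicity of countable Markov chains under a drift condition\<close>

text \<open>The geometric part of the drift condition shrinks the starting value, and the constants of the
  successive steps add up to a geometric series.\<close>

lemma drift_kpow:
  fixes V :: "'a \<Rightarrow> real"
  assumes S: "\<And>x. x \<in> S \<Longrightarrow> set_pmf (Q x) \<subseteq> S"
    and drift: "\<And>x. x \<in> S \<Longrightarrow> (\<integral>\<^sup>+y. ennreal (V y) \<partial>Q x) \<le> ennreal (\<kappa> * V x + C)"
    and V: "\<And>x. x \<in> S \<Longrightarrow> 0 \<le> V x" and \<kappa>: "0 \<le> \<kappa>" "\<kappa> < 1" and C: "0 \<le> C" and x: "x \<in> S"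
  shows "(\<integral>\<^sup>+y. ennreal (V y) \<partial>kpow Q n x) \<le> ennreal (\<kappa> ^ n * V x + C / (1 - \<kappa>))"
proof (induction n)
  case 0
  then show ?case using C \<kappa> V[OF x] by simp
next
  case (Suc n)
  have sub: "set_pmf (kpow Q n x) \<subseteq> S"
    using set_kpow_subset[of S Q x n] S x by blast
  have fix': "\<kappa> * (C / (1 - \<kappa>)) + C = C / (1 - \<kappa>)"
    using \<kappa> by (simp add: field_simps)
  have "(\<integral>\<^sup>+y. ennreal (V y) \<partial>kpow Q (Suc n) x) = (\<integral>\<^sup>+z. \<integral>\<^sup>+y. ennreal (V y) \<partial>Q z \<partial>kpow Q n x)"
    by simp
  also have "\<dots> \<le> (\<integral>\<^sup>+z. ennreal \<kappa> * ennreal (V z) + ennreal C \<partial>kpow Q n x)"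
    using sub drift V \<kappa> C
    by (intro nn_integral_mono_AE)
       (auto simp: AE_measure_pmf_iff ennreal_plus[symmetric] ennreal_mult[symmetric] simp del: ennreal_plus)
  also have "\<dots> = ennreal \<kappa> * (\<integral>\<^sup>+z. ennreal (V z) \<partial>kpow Q n x) + ennreal C"
    by (simp add: nn_integral_add nn_integral_cmult)
  also have "\<dots> \<le> ennreal \<kappa> * ennreal (\<kappa> ^ n * V x + C / (1 - \<kappa>)) + ennreal C"
    by (intro add_mono mult_left_mono Suc) auto
  also have "\<dots> = ennreal (\<kappa> * (\<kappa> ^ n * V x + C / (1 - \<kappa>)) + C)"
    using \<kappa> C V[OF x] by (simp add: ennreal_mult ennreal_plus)
  also have "\<kappa> * (\<kappa> ^ n * V x + C / (1 - \<kappa>)) + C = \<kappa> ^ Suc n * V x + C / (1 - \<kappa>)"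
    using fix' by (simp add: algebra_simps)
  finally show ?case .
qed

lemma nn_integral_le_integrable:
  fixes V :: "'a \<Rightarrow> real"
  assumes "(\<integral>\<^sup>+y. ennreal (V y) \<partial>measure_pmf p) \<le> ennreal B" "\<And>y. y \<in> set_pmf p \<Longrightarrow> 0 \<le> V y" "0 \<le> B"
  shows "integrable (measure_pmf p) V" "measure_pmf.expectation p V \<le> B"
proof -
  have AE: "AE y in measure_pmf p. 0 \<le> V y"
    using assms(2) by (simp add: AE_measure_pmf_iff)
  show 1: "integrable (measure_pmf p) V"
    using AE assms(1) by (intro integrableI_nonneg) (auto intro: le_less_trans)
  have "ennreal (measure_pmf.expectation p V) \<le> ennreal B"
    using nn_integral_eq_integral[OF 1 AE] assms(1) by simp
  then show "measure_pmf.expectation p V \<le> B"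
    using assms(3) by (simp add: ennreal_le_iff)
qed

text \<open>Sampling the two laws independently turns the difference of the expectations into the
  expectation of a difference; it vanishes on the event that both samples are at \<open>x0\<close>, which is
  where the gain over the trivial bound comes from.\<close>

lemma expectation_diff_le_coupling:
  fixes f V :: "'a \<Rightarrow> real"
  assumes f: "\<And>y. 0 \<le> f y" "\<And>y. f y \<le> 1"
    and osc: "\<And>u v. u \<in> S \<Longrightarrow> v \<in> S \<Longrightarrow> \<bar>f u - f v\<bar> \<le> c * (2 + \<beta> * V u + \<beta> * V v)"
    and V: "\<And>u. u \<in> S \<Longrightarrow> 0 \<le> V u" and c: "0 \<le> c" and \<beta>: "0 \<le> \<beta>"
    and p: "set_pmf p \<subseteq> S" "integrable (measure_pmf p) V"
    and r: "set_pmf r \<subseteq> S" "integrable (measure_pmf r) V"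
  shows "\<bar>measure_pmf.expectation p f - measure_pmf.expectation r f\<bar>
     \<le> c * (2 - 2 * (pmf p x0 * pmf r x0) + \<beta> * measure_pmf.expectation p V
            + \<beta> * measure_pmf.expectation r V)"
proof -
  let ?pr = "pair_pmf p r"
  have fst_int: "integrable ?pr (\<lambda>z. V (fst z))"
  proof -
    have "integrable (measure_pmf (map_pmf fst ?pr)) V" by (simp only: map_fst_pair_pmf p)
    then show ?thesis by (simp only: integrable_map_pmf_eq)
  qed
  have snd_int: "integrable ?pr (\<lambda>z. V (snd z))"
  proof -
    have "integrable (measure_pmf (map_pmf snd ?pr)) V" by (simp only: map_snd_pair_pmf r)
    then show ?thesis by (simp only: integrable_map_pmf_eq)
  qed
  have fi: "integrable ?pr (\<lambda>z. f (fst z))" "integrable ?pr (\<lambda>z. f (snd z))"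
    using f by (auto intro!: integrable_pmf_bounded[where B = 1])
  have Ii: "integrable ?pr (\<lambda>z. indicator {(x0, x0)} z :: real)"
    by (auto intro!: integrable_pmf_bounded[where B = 1] simp: indicator_def)
  let ?g = "\<lambda>z. c * (2 - 2 * indicator {(x0, x0)} z + \<beta> * V (fst z) + \<beta> * V (snd z))"
  have "\<bar>measure_pmf.expectation p f - measure_pmf.expectation r f\<bar>
      = \<bar>measure_pmf.expectation ?pr (\<lambda>z. f (fst z) - f (snd z))\<bar>"
    using fi by (simp add: Bochner_Integration.integral_diff)
  also have "\<dots> \<le> measure_pmf.expectation ?pr (\<lambda>z. \<bar>f (fst z) - f (snd z)\<bar>)"
    by (rule integral_abs_bound)
  also have "\<dots> \<le> measure_pmf.expectation ?pr ?g"
  proof (rule expectation_pmf_mono)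
    show "integrable ?pr (\<lambda>z. \<bar>f (fst z) - f (snd z)\<bar>)" using fi by simp
    show "integrable ?pr ?g" using fst_int snd_int Ii by simp
    fix z assume "z \<in> set_pmf ?pr"
    then have z: "fst z \<in> S" "snd z \<in> S" using p r by auto
    show "\<bar>f (fst z) - f (snd z)\<bar> \<le> ?g z"
    proof (cases "z = (x0, x0)")
      case True
      then show ?thesis using V[OF z(1)] c \<beta> by simp
    next
      case False
      then show ?thesis using osc[OF z] by simp
    qed
  qed
  also have "\<dots> = c * (2 - 2 * measure ?pr {(x0, x0)} + \<beta> * measure_pmf.expectation p V
            + \<beta> * measure_pmf.expectation r V)"
    using fst_int snd_int Ii by simp
  also have "measure ?pr {(x0, x0)} = pmf p x0 * pmf r x0"
    by (simp add: measure_pmf_single pmf_pair)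
  finally show ?thesis .
qed

text \<open>The finite sublevel sets and the point \<open>x0\<close>, which every state charges at all late times, take the
  role of the small sets in the theory of Harris chains.\<close>

locale drift_chain =
  fixes Q :: "'a \<Rightarrow> 'a pmf" and S :: "'a set" and V :: "'a \<Rightarrow> real" and \<kappa> C :: real and x0 :: 'a
  assumes closed: "\<And>x. x \<in> S \<Longrightarrow> set_pmf (Q x) \<subseteq> S"
    and V_nonneg: "\<And>x. x \<in> S \<Longrightarrow> 0 \<le> V x"
    and drift: "\<And>x. x \<in> S \<Longrightarrow> (\<integral>\<^sup>+y. ennreal (V y) \<partial>Q x) \<le> ennreal (\<kappa> * V x + C)"
    and \<kappa>: "0 \<le> \<kappa>" "\<kappa> < 1" and C: "0 \<le> C"
    and finite_sublevel: "\<And>R. finite {x \<in> S. V x \<le> R}"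
    and x0: "x0 \<in> S"
    and reach: "\<And>x. x \<in> S \<Longrightarrow> eventually (\<lambda>n. pmf (kpow Q n x) x0 > 0) sequentially"
begin

abbreviation E :: "nat \<Rightarrow> 'a \<Rightarrow> ('a \<Rightarrow> real) \<Rightarrow> real" where
  "E n x f \<equiv> measure_pmf.expectation (kpow Q n x) f"

definition K :: real where "K = C / (1 - \<kappa>)"

lemma K_nonneg: "0 \<le> K"
  using \<kappa> C by (simp add: K_def)

lemma closed_kpow: "x \<in> S \<Longrightarrow> set_pmf (kpow Q n x) \<subseteq> S"
  using set_kpow_subset[of S Q x n] closed by blast

lemma integrable_V: "x \<in> S \<Longrightarrow> integrable (kpow Q n x) V"
  and expectation_V: "x \<in> S \<Longrightarrow> E n x V \<le> \<kappa> ^ n * V x + K"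
proof -
  assume x: "x \<in> S"
  have *: "(\<integral>\<^sup>+y. ennreal (V y) \<partial>kpow Q n x) \<le> ennreal (\<kappa> ^ n * V x + K)"
    unfolding K_def using drift_kpow[of S Q V \<kappa> C x n] closed drift V_nonneg \<kappa> C x by blast
  have pos: "0 \<le> V y" if "y \<in> set_pmf (kpow Q n x)" for y
    using V_nonneg closed_kpow[OF x] that by blast
  have "0 \<le> \<kappa> ^ n * V x + K"
    using V_nonneg[OF x] \<kappa> K_nonneg by simp
  then show "integrable (kpow Q n x) V" "E n x V \<le> \<kappa> ^ n * V x + K"
    using nn_integral_le_integrable[OF * pos] by auto
qed

lemma expectation_V_le: "x \<in> S \<Longrightarrow> E n x V \<le> V x + K"
  using expectation_V[of x n] \<kappa> V_nonneg[of x] mult_right_mono[of "\<kappa> ^ n" 1 "V x"]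
  by (simp add: power_le_one)

text \<open>A sublevel set of \<open>V\<close> is finite, so the times from which on its points charge \<open>x0\<close> have a
  common bound, and the charges at this common time a common positive lower bound.\<close>

lemma minorization: "\<exists>n \<alpha>. 0 < n \<and> 0 < \<alpha> \<and> (\<forall>x\<in>S. V x \<le> R \<longrightarrow> \<alpha> \<le> pmf (kpow Q n x) x0)"
proof -
  let ?F = "{x \<in> S. V x \<le> R}"
  have "eventually (\<lambda>n. \<forall>x\<in>?F. pmf (kpow Q n x) x0 > 0) sequentially"
    using reach finite_sublevel by (intro eventually_ball_finite) auto
  then have "eventually (\<lambda>n. 0 < n \<and> (\<forall>x\<in>?F. pmf (kpow Q n x) x0 > 0)) sequentially"
    using eventually_gt_at_top[of 0] by eventually_elim auto
  then obtain n where n: "0 < n" "\<And>x. x \<in> ?F \<Longrightarrow> pmf (kpow Q n x) x0 > 0"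
    unfolding eventually_sequentially by blast
  define \<alpha> where "\<alpha> = Min (insert 1 ((\<lambda>x. pmf (kpow Q n x) x0) ` ?F))"
  have "0 < \<alpha>" "\<forall>x\<in>?F. \<alpha> \<le> pmf (kpow Q n x) x0"
    unfolding \<alpha>_def using n finite_sublevel[of R] by (auto simp: Min_gr_iff intro!: Min_le)
  then show ?thesis using n by blast
qed

text \<open>One block of steps contracts the oscillation measured by \<open>2 + \<beta> * V x + \<beta> * V y\<close>. Where
  \<open>V x + V y\<close> is large, the drift condition shrinks the weight; where it is small, both points
  have a common chance to be at \<open>x0\<close>. A small \<open>\<beta>\<close> keeps the additive constant of the drift
  condition below this gain.\<close>

lemma contraction:
  obtains n \<beta> a where "0 < n" "0 < \<beta>" "0 \<le> a" "a < 1"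
    and "\<And>f c x y. (\<And>y. 0 \<le> f y) \<Longrightarrow> (\<And>y. f y \<le> 1) \<Longrightarrow> 0 \<le> c \<Longrightarrow>
        (\<And>x y. x \<in> S \<Longrightarrow> y \<in> S \<Longrightarrow> \<bar>f x - f y\<bar> \<le> c * (2 + \<beta> * V x + \<beta> * V y)) \<Longrightarrow>
        x \<in> S \<Longrightarrow> y \<in> S \<Longrightarrow> \<bar>E n x f - E n y f\<bar> \<le> a * c * (2 + \<beta> * V x + \<beta> * V y)"
proof -
  \<comment> \<open>Above the level \<open>R\<close>, half of the gain \<open>(1 - \<kappa>) * R\<close> of the drift pays for the constant \<open>2 * K\<close>.\<close>
  define R where "R = 4 * K / (1 - \<kappa>) + 1"
  have R: "0 < R" "4 * K \<le> (1 - \<kappa>) * R"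
    using K_nonneg \<kappa> by (auto simp: R_def distrib_left intro!: add_nonneg_pos)
  obtain n \<alpha> where n: "0 < n" "0 < \<alpha>" and minor: "\<And>x. x \<in> S \<Longrightarrow> V x \<le> R \<Longrightarrow> \<alpha> \<le> pmf (kpow Q n x) x0"
    using minorization[of R] by blast
  \<comment> \<open>Below \<open>R\<close>, half of the gain \<open>2 * \<alpha>\<^sup>2\<close> of the coupling pays for \<open>2 * \<beta> * K\<close>.\<close>
  define \<beta> where "\<beta> = \<alpha>\<^sup>2 / (2 * K + 1)"
  have \<beta>: "0 < \<beta>" "2 * \<beta> * K \<le> \<alpha>\<^sup>2"
    using K_nonneg n by (auto simp: \<beta>_def field_simps)
  \<comment> \<open>The first two members serve below \<open>R\<close>, the last two above.\<close>
  define a where "a = Max {1 - \<alpha>\<^sup>2 / 2, \<kappa>, (3 + \<kappa>) / 4, 1 - \<beta> * R * (1 - \<kappa>) / 8}"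
  have a: "1 - \<alpha>\<^sup>2 / 2 \<le> a" "\<kappa> \<le> a" "(3 + \<kappa>) / 4 \<le> a" "1 - \<beta> * R * (1 - \<kappa>) / 8 \<le> a" "a < 1"
    subgoal unfolding a_def by (rule Max_ge) auto
    subgoal unfolding a_def by (rule Max_ge) auto
    subgoal unfolding a_def by (rule Max_ge) auto
    subgoal unfolding a_def by (rule Max_ge) auto
    subgoal unfolding a_def using n \<beta> R \<kappa> by (subst Max_less_iff) auto
    done
  have "\<bar>E n x f - E n y f\<bar> \<le> a * c * (2 + \<beta> * V x + \<beta> * V y)"
    if f: "\<And>y. 0 \<le> f y" "\<And>y. f y \<le> 1" and c: "0 \<le> c"
      and osc: "\<And>x y. x \<in> S \<Longrightarrow> y \<in> S \<Longrightarrow> \<bar>f x - f y\<bar> \<le> c * (2 + \<beta> * V x + \<beta> * V y)"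
      and x: "x \<in> S" and y: "y \<in> S" for f c x y
  proof -
    let ?s = "V x + V y"
    have s: "0 \<le> ?s" "V x \<le> ?s" "V y \<le> ?s" using V_nonneg x y by auto
    have EV: "E n z V \<le> \<kappa> * V z + K" if "z \<in> S" for z
    proof -
      have "\<kappa> ^ n \<le> \<kappa>" using \<kappa> n power_decreasing[of 1 n \<kappa>] by simp
      then have "\<kappa> ^ n * V z \<le> \<kappa> * V z" using V_nonneg[OF that] by (intro mult_right_mono)
      with expectation_V[OF that, of n] show ?thesis by linarith
    qed
    let ?m = "pmf (kpow Q n x) x0 * pmf (kpow Q n y) x0"
    have "\<bar>E n x f - E n y f\<bar> \<le> c * (2 - 2 * ?m + \<beta> * E n x V + \<beta> * E n y V)"
      using \<beta> by (intro expectation_diff_le_coupling[where S = S] closed_kpow integrable_V x y f osc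
          V_nonneg c) auto
    also have "\<dots> \<le> c * (a * (2 + \<beta> * ?s))"
    proof (rule mult_left_mono[OF _ c])
      have "\<beta> * E n x V + \<beta> * E n y V \<le> \<beta> * (\<kappa> * V x + K) + \<beta> * (\<kappa> * V y + K)"
        using EV[OF x] EV[OF y] \<beta> by (intro add_mono mult_left_mono) auto
      then have 1: "2 - 2 * ?m + \<beta> * E n x V + \<beta> * E n y V \<le> 2 - 2 * ?m + \<beta> * \<kappa> * ?s + 2 * \<beta> * K"
        by (simp add: algebra_simps)
      show "2 - 2 * ?m + \<beta> * E n x V + \<beta> * E n y V \<le> a * (2 + \<beta> * ?s)"
      proof (cases "?s \<le> R")
        case True
        then have "\<alpha> \<le> pmf (kpow Q n x) x0" "\<alpha> \<le> pmf (kpow Q n y) x0"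
          using s by (auto intro!: minor x y)
        then have "\<alpha>\<^sup>2 \<le> ?m" using n by (auto simp: power2_eq_square intro!: mult_mono)
        moreover have "\<kappa> * (\<beta> * ?s) \<le> a * (\<beta> * ?s)" using a s \<beta> by (intro mult_right_mono) auto
        ultimately show ?thesis using 1 \<beta> a by (simp add: algebra_simps)
      next
        case False
        have "2 * K \<le> (1 - \<kappa>) * ?s / 2"
          using R False \<kappa> mult_left_mono[of R ?s "1 - \<kappa>"] by linarith
        from mult_left_mono[OF this, of \<beta>] have 2: "2 * \<beta> * K \<le> (1 - \<kappa>) / 2 * (\<beta> * ?s)"
          using \<beta> by (simp add: mult.assoc mult.left_commute)
        have "2 * (1 - a) \<le> 2 * (\<beta> * R * (1 - \<kappa>) / 8)"
          using a(4) by (intro mult_left_mono) (auto simp: diff_le_eq add.commute)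
        also have "\<dots> = (1 - \<kappa>) / 4 * (\<beta> * R)" by simp
        also have "(1 - \<kappa>) / 4 * (\<beta> * R) \<le> (1 - \<kappa>) / 4 * (\<beta> * ?s)"
          using False \<beta> \<kappa> by (intro mult_left_mono) auto
        also have "\<dots> \<le> (a - (1 + \<kappa>) / 2) * (\<beta> * ?s)"
          using a s \<beta> by (intro mult_right_mono) (auto simp: field_simps)
        finally have 3: "2 * (1 - a) \<le> (a - (1 + \<kappa>) / 2) * (\<beta> * ?s)" .
        have "0 \<le> ?m" by simp
        with 1 have "2 - 2 * ?m + \<beta> * E n x V + \<beta> * E n y V \<le> 2 + \<beta> * \<kappa> * ?s + 2 * \<beta> * K"
          by linarith
        moreover have "a * (2 + u) - (2 + \<kappa> * u + (1 - \<kappa>) / 2 * u)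
            = (a - (1 + \<kappa>) / 2) * u - 2 * (1 - a)" for u
          by algebra
        moreover have "\<beta> * \<kappa> * ?s = \<kappa> * (\<beta> * ?s)" by simp
        ultimately show ?thesis using 2 3 by smt
      qed
    qed
    finally show ?thesis by (simp add: algebra_simps)
  qed
  moreover have "0 \<le> a" using a(2) \<kappa> by linarith
  ultimately show ?thesis using n(1) \<beta>(1) a(5) by (intro that) auto
qed

text \<open>For a number of steps that is not a multiple of the block length, the remaining steps are applied
  to the function first, which keeps its values between 0 and 1.\<close>

lemma contraction_iterated:
  obtains \<beta> \<rho> where "0 < \<beta>" "\<And>n. 0 \<le> \<rho> n" "\<rho> \<longlonglongrightarrow> 0"
    and "\<And>n f x y. (\<And>y. 0 \<le> f y) \<Longrightarrow> (\<And>y. f y \<le> 1) \<Longrightarrow> x \<in> S \<Longrightarrow> y \<in> S \<Longrightarrow>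
        \<bar>E n x f - E n y f\<bar> \<le> \<rho> n * (2 + \<beta> * V x + \<beta> * V y)"
proof -
  obtain N \<beta> a where N: "0 < N" and \<beta>: "0 < \<beta>" and a: "0 \<le> a" "a < 1" and
    contr: "\<And>f c x y. (\<And>y. 0 \<le> f y) \<Longrightarrow> (\<And>y. f y \<le> 1) \<Longrightarrow> 0 \<le> c \<Longrightarrow>
        (\<And>x y. x \<in> S \<Longrightarrow> y \<in> S \<Longrightarrow> \<bar>f x - f y\<bar> \<le> c * (2 + \<beta> * V x + \<beta> * V y)) \<Longrightarrow>
        x \<in> S \<Longrightarrow> y \<in> S \<Longrightarrow> \<bar>E N x f - E N y f\<bar> \<le> a * c * (2 + \<beta> * V x + \<beta> * V y)"
    apply (rule contraction)
    subgoal premises prems for n \<beta> a by (rule prems(1)[OF prems(2-6)])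
    done
  have E_add: "E (m + n) x f = E m x (\<lambda>z. E n z f)" if "\<And>y. 0 \<le> f y" "\<And>y. f y \<le> 1" for m n x f
    using expectation_bind_pmf[OF that] by (simp add: kpow_add)
  have block: "\<bar>E (k * N + r) x f - E (k * N + r) y f\<bar> \<le> a ^ k * (2 + \<beta> * V x + \<beta> * V y)"
    if f: "\<And>y. 0 \<le> f y" "\<And>y. f y \<le> 1" and xy: "x \<in> S" "y \<in> S" for k r f x y
    using xy
  proof (induction k arbitrary: x y)
    case 0
    have "\<bar>E r x f - E r y f\<bar> \<le> 1"
      using expectation_pmf_unit_interval[where f = f, OF f] by (smt (verit))
    moreover have "0 \<le> \<beta> * V x" "0 \<le> \<beta> * V y" using \<beta> V_nonneg 0 by auto
    ultimately show ?case by simp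
  next
    case (Suc k)
    have "Suc k * N + r = N + (k * N + r)" by simp
    then have "E (Suc k * N + r) z f = E N z (\<lambda>u. E (k * N + r) u f)" for z
      by (simp only: E_add[OF f])
    then show ?case
      using contr[of "\<lambda>u. E (k * N + r) u f" "a ^ k" x y] Suc a expectation_pmf_unit_interval[where f = f, OF f]
      by simp
  qed
  have "\<bar>E n x f - E n y f\<bar> \<le> a ^ (n div N) * (2 + \<beta> * V x + \<beta> * V y)"
    if "\<And>y. 0 \<le> f y" "\<And>y. f y \<le> 1" "x \<in> S" "y \<in> S" for n f x y
    using block[OF that, of "n div N" "n mod N"] by simp
  moreover have "(\<lambda>n. a ^ (n div N)) \<longlonglongrightarrow> 0"
  proof -
    have "filterlim (\<lambda>n. n div N) at_top sequentially"
      unfolding filterlim_at_top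
    proof
      fix Z
      show "\<forall>\<^sub>F n in sequentially. Z \<le> n div N"
        using eventually_ge_at_top[of "Z * N"]
        by eventually_elim (use N in \<open>simp add: less_eq_div_iff_mult_less_eq\<close>)
    qed
    then show ?thesis
      using LIMSEQ_realpow_zero[OF a] filterlim_compose by blast
  qed
  ultimately show ?thesis
    using \<beta> a by (intro that[of \<beta> "\<lambda>n. a ^ (n div N)"]) auto
qed

text \<open>Running the chain for \<open>m\<close> more steps averages the starting point, so the contraction also
  bounds the change of an expectation in time.\<close>

lemma uniform_cauchy:
  obtains \<beta> \<rho> where "\<rho> \<longlonglongrightarrow> 0"
    and "\<And>n f x y m. (\<And>y. 0 \<le> f y) \<Longrightarrow> (\<And>y. f y \<le> 1) \<Longrightarrow> x \<in> S \<Longrightarrow> y \<in> S \<Longrightarrow>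
        \<bar>E n x f - E (m + n) y f\<bar> \<le> \<rho> n * (2 + \<beta> * V x + \<beta> * (V y + K))"
proof -
  obtain \<beta> \<rho> where \<beta>: "0 < \<beta>" and \<rho>: "\<And>n. 0 \<le> \<rho> n" "\<rho> \<longlonglongrightarrow> 0" and
    contr: "\<And>n f x y. (\<And>y. 0 \<le> f y) \<Longrightarrow> (\<And>y. f y \<le> 1) \<Longrightarrow> x \<in> S \<Longrightarrow> y \<in> S \<Longrightarrow>
        \<bar>E n x f - E n y f\<bar> \<le> \<rho> n * (2 + \<beta> * V x + \<beta> * V y)"
    apply (rule contraction_iterated)
    subgoal premises prems for \<beta> \<rho> by (rule prems(1)[OF prems(2-5)])
    done
  have "\<bar>E n x f - E (m + n) y f\<bar> \<le> \<rho> n * (2 + \<beta> * V x + \<beta> * (V y + K))"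
    if f: "\<And>y. 0 \<le> f y" "\<And>y. f y \<le> 1" and x: "x \<in> S" and y: "y \<in> S" for n f x y m
  proof -
    note unit = expectation_pmf_unit_interval[where f = f, OF f]
    have int: "integrable (kpow Q m y) (\<lambda>z. E n z f)"
      using unit by (intro integrable_pmf_bounded[where B = 1]) auto
    have "E n x f - E (m + n) y f = E m y (\<lambda>z. E n x f - E n z f)"
      using int by (simp add: kpow_add expectation_bind_pmf[OF f])
    also have "\<bar>\<dots>\<bar> \<le> E m y (\<lambda>z. \<bar>E n x f - E n z f\<bar>)"
      by (rule integral_abs_bound)
    also have "\<dots> \<le> E m y (\<lambda>z. \<rho> n * (2 + \<beta> * V x + \<beta> * V z))"
      using int integrable_V[OF y, of m] closed_kpow[OF y, of m]
      by (intro expectation_pmf_mono contr f x) auto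
    also have "\<dots> = \<rho> n * (2 + \<beta> * V x + \<beta> * E m y V)"
      using integrable_V[OF y, of m] by simp
    also have "\<dots> \<le> \<rho> n * (2 + \<beta> * V x + \<beta> * (V y + K))"
      using \<beta> \<rho> expectation_V_le[OF y, of m] by (intro mult_left_mono add_mono) auto
    finally show ?thesis .
  qed
  from that[of \<rho> \<beta>, OF \<rho>(2) this] show ?thesis .
qed

text \<open>Markov's inequality for \<open>V\<close>, whose expectation stays bounded in time.\<close>

lemma tight:
  assumes x: "x \<in> S" and R: "0 < R"
  shows "1 - (V x + K) / R \<le> measure (kpow Q n x) {y \<in> S. V y \<le> R}"
proof -
  let ?F = "{y \<in> S. V y \<le> R}"
  have "1 - (V x + K) / R \<le> 1 - E n x V / R"
    using expectation_V_le[OF x, of n] R by (simp add: divide_right_mono)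
  also have "\<dots> = E n x (\<lambda>y. 1 - V y / R)"
    using integrable_V[OF x, of n] by simp
  also have "\<dots> \<le> E n x (indicator ?F)"
  proof (rule expectation_pmf_mono)
    show "integrable (kpow Q n x) (\<lambda>y. 1 - V y / R)"
      using integrable_V[OF x, of n] by simp
    show "integrable (kpow Q n x) (indicat_real ?F)"
      by (intro integrable_pmf_bounded[where B = 1]) (auto simp: indicator_def)
    fix y assume "y \<in> set_pmf (kpow Q n x)"
    then have y: "y \<in> S" using closed_kpow[OF x] by blast
    show "1 - V y / R \<le> indicator ?F y"
      using y V_nonneg[OF y] R by (auto simp: indicator_def field_simps)
  qed
  finally show ?thesis by simp
qed

text \<open>Pointwise limits of probability mass functions may lose mass; tightness prevents this.\<close>

lemma pmf_limit_exists:
  "\<exists>\<pi>. \<forall>z. (\<lambda>n. pmf (kpow Q n x0) z) \<longlonglongrightarrow> pmf \<pi> z"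
proof -
  obtain \<beta> \<rho> where \<rho>: "\<rho> \<longlonglongrightarrow> 0" and
    cauchy: "\<And>n f x y m. (\<And>y. 0 \<le> f y) \<Longrightarrow> (\<And>y. f y \<le> 1) \<Longrightarrow> x \<in> S \<Longrightarrow> y \<in> S \<Longrightarrow>
        \<bar>E n x f - E (m + n) y f\<bar> \<le> \<rho> n * (2 + \<beta> * V x + \<beta> * (V y + K))"
    apply (rule uniform_cauchy)
    subgoal premises prems for \<beta> \<rho> by (rule prems(1)[OF prems(2-3)])
    done
  have "convergent (\<lambda>n. pmf (kpow Q n x0) z)" for z
  proof -
    have pE: "pmf (kpow Q n x0) z = E n x0 (indicator {z})" for n
      by (simp add: measure_pmf_single)
    let ?c = "2 + \<beta> * V x0 + \<beta> * (V x0 + K)"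
    have lim: "(\<lambda>n. \<rho> n * ?c) \<longlonglongrightarrow> 0"
      using \<rho> by (auto intro: tendsto_eq_intros)
    have "Cauchy (\<lambda>n. pmf (kpow Q n x0) z)"
      unfolding Cauchy_altdef
    proof (intro allI impI)
      fix e :: real assume "0 < e"
      then obtain M where M: "\<And>n. M \<le> n \<Longrightarrow> \<rho> n * ?c < e"
        using order_tendstoD(2)[OF lim] unfolding eventually_sequentially by blast
      have "\<bar>pmf (kpow Q m x0) z - pmf (kpow Q n x0) z\<bar> < e" if "M \<le> m" "m < n" for m n
        using cauchy[of "indicator {z}" x0 x0 m "n - m"] M[OF that(1)] that(2) x0
        unfolding pE by (simp add: le_less_trans)
      then show "\<exists>M. \<forall>m\<ge>M. \<forall>n>m. dist (pmf (kpow Q m x0) z) (pmf (kpow Q n x0) z) < e"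
        by (auto simp: dist_real_def)
    qed
    then show ?thesis by (simp add: Cauchy_convergent_iff)
  qed
  then obtain p where p: "\<And>z. (\<lambda>n. pmf (kpow Q n x0) z) \<longlonglongrightarrow> p z"
    unfolding convergent_def by metis
  have p_nonneg: "0 \<le> p z" for z
    using p[of z] by (rule LIMSEQ_le_const) auto
  have "(\<integral>\<^sup>+z. ennreal (p z) \<partial>count_space UNIV) = 1"
  proof (rule antisym)
    have "(\<integral>\<^sup>+z. ennreal (p z) \<partial>count_space UNIV)
        = (\<integral>\<^sup>+z. liminf (\<lambda>n. ennreal (pmf (kpow Q n x0) z)) \<partial>count_space UNIV)"
      by (intro nn_integral_cong lim_imp_Liminf[symmetric] tendsto_ennrealI p) simp
    also have "\<dots> \<le> liminf (\<lambda>n. \<integral>\<^sup>+z. ennreal (pmf (kpow Q n x0) z) \<partial>count_space UNIV)"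
      by (rule nn_integral_liminf) auto
    also have "\<dots> = 1"
      by (simp add: nn_integral_pmf Liminf_const)
    finally show "(\<integral>\<^sup>+z. ennreal (p z) \<partial>count_space UNIV) \<le> 1" .
    have "1 - (V x0 + K) / R \<le> (\<integral>\<^sup>+z. ennreal (p z) \<partial>count_space UNIV)" if R: "0 < R" for R
    proof -
      let ?F = "{y \<in> S. V y \<le> R}"
      have "(\<lambda>n. \<Sum>z\<in>?F. pmf (kpow Q n x0) z) \<longlonglongrightarrow> (\<Sum>z\<in>?F. p z)"
        by (intro tendsto_sum p)
      then have "1 - (V x0 + K) / R \<le> (\<Sum>z\<in>?F. p z)"
        using tight[OF x0 R] finite_sublevel[of R]
        by (intro LIMSEQ_le_const) (auto simp: measure_measure_pmf_finite)
      then have "ennreal (1 - (V x0 + K) / R) \<le> (\<Sum>z\<in>?F. ennreal (p z))"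
        using p_nonneg by (simp add: sum_ennreal ennreal_leI)
      also have "\<dots> = (\<integral>\<^sup>+z. ennreal (p z) * indicator ?F z \<partial>count_space UNIV)"
        using finite_sublevel[of R]
        by (simp add: nn_integral_count_space_indicator[symmetric] nn_integral_count_space_finite)
      also have "\<dots> \<le> (\<integral>\<^sup>+z. ennreal (p z) \<partial>count_space UNIV)"
        by (intro nn_integral_mono) (auto simp: indicator_def)
      finally show ?thesis .
    qed
    note below = this
    have "(\<lambda>k. ennreal (1 - (V x0 + K) / real (Suc k))) \<longlonglongrightarrow> ennreal (1 - 0)"
      by (intro tendsto_ennrealI tendsto_diff tendsto_const LIMSEQ_Suc[OF lim_const_over_n])
    then have "ennreal (1 - 0) \<le> (\<integral>\<^sup>+z. ennreal (p z) \<partial>count_space UNIV)"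
      by (rule LIMSEQ_le_const2) (intro exI[of _ 0] allI impI below of_nat_0_less_iff[THEN iffD2] zero_less_Suc)
    then show "1 \<le> (\<integral>\<^sup>+z. ennreal (p z) \<partial>count_space UNIV)"
      by simp
  qed
  then have "pmf (embed_pmf p) z = p z" for z
    using p_nonneg by (intro pmf_embed_pmf) auto
  then show ?thesis using p by (intro exI[of _ "embed_pmf p"]) simp
qed

text \<open>Scheffe's lemma turns the pointwise convergence of the mass functions into convergence of all
  expectations, and letting the later of two times tend to infinity in \<open>uniform_cauchy\<close> gives the
  rate. The moment bound on the limit is Fatou's lemma.\<close>

theorem ergodic_theorem:
  "\<exists>\<pi> \<rho> B. set_pmf \<pi> \<subseteq> S \<and> (\<integral>\<^sup>+y. ennreal (V y) \<partial>\<pi>) < \<infinity> \<and> bind_pmf \<pi> Q = \<pi> \<and> \<rho> \<longlonglongrightarrow> 0 \<and>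
     (\<forall>n f x. (\<forall>y. 0 \<le> f y \<and> f y \<le> 1) \<and> x \<in> S \<longrightarrow>
        \<bar>E n x f - measure_pmf.expectation \<pi> f\<bar> \<le> \<rho> n * (B x))"
proof -
  obtain \<beta> \<rho> where \<rho>: "\<rho> \<longlonglongrightarrow> 0" and
    cauchy: "\<And>n f x y m. (\<And>y. 0 \<le> f y) \<Longrightarrow> (\<And>y. f y \<le> 1) \<Longrightarrow> x \<in> S \<Longrightarrow> y \<in> S \<Longrightarrow>
        \<bar>E n x f - E (m + n) y f\<bar> \<le> \<rho> n * (2 + \<beta> * V x + \<beta> * (V y + K))"
    apply (rule uniform_cauchy)
    subgoal premises prems for \<beta> \<rho> by (rule prems(1)[OF prems(2-3)])
    done
  obtain \<pi> where \<pi>: "\<And>z. (\<lambda>n. pmf (kpow Q n x0) z) \<longlonglongrightarrow> pmf \<pi> z"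
    using pmf_limit_exists by blast
  have L1: "(\<lambda>n. \<integral>\<^sup>+z. norm (pmf (kpow Q n x0) z - pmf \<pi> z) \<partial>count_space UNIV) \<longlonglongrightarrow> 0"
    using \<pi> by (intro Scheffe_lemma2) (auto simp: nn_integral_pmf integrable_pmf)
  have lim: "(\<lambda>n. E n x0 f) \<longlonglongrightarrow> measure_pmf.expectation \<pi> f"
    if f: "\<And>y. 0 \<le> f y" "\<And>y. f y \<le> 1" for f
  proof -
    have dens: "measure_pmf.expectation p f = (\<integral>z. pmf p z * f z \<partial>count_space UNIV)" for p
      using f by (simp add: measure_pmf_eq_density integral_density)
    have int: "integrable (count_space UNIV) (\<lambda>z. pmf p z * f z)" for p
      using f by (intro Bochner_Integration.integrable_bound[OF integrable_pmf[of UNIV p]])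
        (auto simp: abs_mult intro!: mult_left_le)
    have "norm (E n x0 f - measure_pmf.expectation \<pi> f)
        \<le> enn2real (\<integral>\<^sup>+z. norm (pmf (kpow Q n x0) z - pmf \<pi> z) \<partial>count_space UNIV)" for n
    proof -
      have "norm (E n x0 f - measure_pmf.expectation \<pi> f)
          = norm (\<integral>z. pmf (kpow Q n x0) z * f z - pmf \<pi> z * f z \<partial>count_space UNIV)"
        using int by (simp add: dens Bochner_Integration.integral_diff)
      also have "\<dots> \<le> (\<integral>z. norm (pmf (kpow Q n x0) z * f z - pmf \<pi> z * f z) \<partial>count_space UNIV)"
        by (rule integral_norm_bound)
      also have "\<dots> \<le> (\<integral>z. norm (pmf (kpow Q n x0) z - pmf \<pi> z) \<partial>count_space UNIV)"
      proof (rule integral_mono)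
        show "integrable (count_space UNIV) (\<lambda>z. norm (pmf (kpow Q n x0) z * f z - pmf \<pi> z * f z))"
          using int by (intro integrable_norm Bochner_Integration.integrable_diff)
        show "integrable (count_space UNIV) (\<lambda>z. norm (pmf (kpow Q n x0) z - pmf \<pi> z))"
          by (intro integrable_norm Bochner_Integration.integrable_diff integrable_pmf)
        show "norm (pmf (kpow Q n x0) z * f z - pmf \<pi> z * f z) \<le> norm (pmf (kpow Q n x0) z - pmf \<pi> z)" for z
          using f by (auto simp: left_diff_distrib[symmetric] abs_mult intro!: mult_left_le)
      qed
      also have "\<dots> = enn2real (\<integral>\<^sup>+z. norm (pmf (kpow Q n x0) z - pmf \<pi> z) \<partial>count_space UNIV)"
        by (intro integral_eq_nn_integral) auto
      finally show ?thesis .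
    qed
    moreover have "(\<lambda>n. enn2real (\<integral>\<^sup>+z. norm (pmf (kpow Q n x0) z - pmf \<pi> z) \<partial>count_space UNIV)) \<longlonglongrightarrow> 0"
      using tendsto_enn2real[OF L1[folded ennreal_0]] by simp
    ultimately have "(\<lambda>n. E n x0 f - measure_pmf.expectation \<pi> f) \<longlonglongrightarrow> 0"
      by (rule Lim_null_comparison[OF always_eventually[OF allI]])
    then show ?thesis by (simp add: LIM_zero_iff)
  qed
  have "set_pmf \<pi> \<subseteq> S"
  proof
    fix z assume z: "z \<in> set_pmf \<pi>"
    show "z \<in> S"
    proof (rule ccontr)
      assume "z \<notin> S"
      then have "pmf (kpow Q n x0) z = 0" for n
        using closed_kpow[OF x0, of n] by (auto simp: pmf_eq_0_set_pmf)
      with \<pi>[of z] have "pmf \<pi> z = 0" by (simp add: LIMSEQ_const_iff)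
      with z show False by (simp add: set_pmf_iff)
    qed
  qed
  moreover have "(\<integral>\<^sup>+y. ennreal (V y) \<partial>\<pi>) < \<infinity>"
  proof -
    have "(\<integral>\<^sup>+y. ennreal (V y) \<partial>\<pi>)
        = (\<integral>\<^sup>+z. liminf (\<lambda>n. ennreal (pmf (kpow Q n x0) z) * ennreal (V z)) \<partial>count_space UNIV)"
      unfolding nn_integral_measure_pmf
    proof (intro nn_integral_cong)
      fix z
      have "(\<lambda>n. ennreal (pmf (kpow Q n x0) z * V z)) \<longlonglongrightarrow> ennreal (pmf \<pi> z * V z)"
        by (intro tendsto_intros \<pi>)
      then have "(\<lambda>n. ennreal (pmf (kpow Q n x0) z) * ennreal (V z)) \<longlonglongrightarrow> ennreal (pmf \<pi> z) * ennreal (V z)"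
        by (simp add: ennreal_mult')
      then show "ennreal (pmf \<pi> z) * ennreal (V z)
          = liminf (\<lambda>n. ennreal (pmf (kpow Q n x0) z) * ennreal (V z))"
        by (simp add: lim_imp_Liminf)
    qed
    also have "\<dots> \<le> liminf (\<lambda>n. \<integral>\<^sup>+z. ennreal (pmf (kpow Q n x0) z) * ennreal (V z) \<partial>count_space UNIV)"
      by (rule nn_integral_liminf) auto
    also have "\<dots> = liminf (\<lambda>n. \<integral>\<^sup>+z. ennreal (V z) \<partial>kpow Q n x0)"
      by (simp add: nn_integral_measure_pmf)
    also have "\<dots> \<le> liminf (\<lambda>n. ennreal (V x0 + K))"
    proof (intro Liminf_mono always_eventually allI)
      fix n
      have "AE y in kpow Q n x0. 0 \<le> V y"
        using closed_kpow[OF x0, of n] V_nonneg by (auto simp: AE_measure_pmf_iff)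
      then have "(\<integral>\<^sup>+z. ennreal (V z) \<partial>kpow Q n x0) = ennreal (E n x0 V)"
        by (intro nn_integral_eq_integral integrable_V x0)
      also have "\<dots> \<le> ennreal (V x0 + K)"
        using expectation_V_le[OF x0] by (rule ennreal_leI)
      finally show "(\<integral>\<^sup>+z. ennreal (V z) \<partial>kpow Q n x0) \<le> ennreal (V x0 + K)" .
    qed
    finally show ?thesis by (simp add: Liminf_const le_less_trans)
  qed
  moreover have "bind_pmf \<pi> Q = \<pi>"
  proof (rule pmf_eqI)
    fix z
    have "(\<lambda>n. E n x0 (\<lambda>y. pmf (Q y) z)) \<longlonglongrightarrow> measure_pmf.expectation \<pi> (\<lambda>y. pmf (Q y) z)"
      by (intro lim) (auto simp: pmf_le_1)
    then have "(\<lambda>n. pmf (kpow Q (Suc n) x0) z) \<longlonglongrightarrow> pmf (bind_pmf \<pi> Q) z"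
      by (simp add: pmf_bind)
    then show "pmf (bind_pmf \<pi> Q) z = pmf \<pi> z"
      using LIMSEQ_Suc[OF \<pi>[of z]] by (rule LIMSEQ_unique)
  qed
  moreover have "\<bar>E n x f - measure_pmf.expectation \<pi> f\<bar> \<le> \<rho> n * (2 + \<beta> * V x + \<beta> * (V x0 + K))"
    if f: "\<And>y. 0 \<le> f y" "\<And>y. f y \<le> 1" and x: "x \<in> S" for n f x
  proof (rule LIMSEQ_le_const2)
    show "(\<lambda>m. \<bar>E n x f - E (m + n) x0 f\<bar>) \<longlonglongrightarrow> \<bar>E n x f - measure_pmf.expectation \<pi> f\<bar>"
      by (intro tendsto_intros LIMSEQ_ignore_initial_segment[of "\<lambda>m. E m x0 f"] lim f)
    show "\<exists>N. \<forall>m\<ge>N. \<bar>E n x f - E (m + n) x0 f\<bar> \<le> \<rho> n * (2 + \<beta> * V x + \<beta> * (V x0 + K))"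
      using cauchy[where f = f, OF f x x0] by blast
  qed
  ultimately show ?thesis using \<rho>
    by (intro exI[of _ \<pi>] exI[of _ \<rho>] exI[of _ "\<lambda>x. 2 + \<beta> * V x + \<beta> * (V x0 + K)"]) auto
qed

end

section \<open>Chains with a positive eigenfunction\<close>

lemma integral_pmf_reweight:
  fixes f g :: "'a \<Rightarrow> real"
  assumes "\<And>y. pmf \<nu> y = pmf \<pi> y * g y" "\<And>y. 0 \<le> g y"
  shows "measure_pmf.expectation \<nu> f = measure_pmf.expectation \<pi> (\<lambda>y. g y * f y)"
    and "(\<integral>\<^sup>+y. ennreal (f y) \<partial>\<nu>) = (\<integral>\<^sup>+y. ennreal (g y * f y) \<partial>\<pi>)"
proof -
  show "measure_pmf.expectation \<nu> f = measure_pmf.expectation \<pi> (\<lambda>y. g y * f y)"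
    by (simp add: measure_pmf_eq_density integral_density assms mult.assoc)
  show "(\<integral>\<^sup>+y. ennreal (f y) \<partial>\<nu>) = (\<integral>\<^sup>+y. ennreal (g y * f y) \<partial>\<pi>)"
    by (simp add: nn_integral_measure_pmf assms ennreal_mult' ennreal_mult mult.assoc)
qed

lemma bind_kpow_invariant: "bind_pmf \<pi> Q = \<pi> \<Longrightarrow> bind_pmf \<pi> (kpow Q n) = \<pi>"
proof (induction n)
  case 0
  then show ?case by (simp add: bind_return_pmf')
next
  case (Suc n)
  then show ?case by (simp add: bind_assoc_pmf[symmetric])
qed

text \<open>A chain that can leave the set \<open>S\<close> of living states, with an eigenfunction \<open>h\<close> that vanishes off \<open>S\<close>.
  The eigenvalue \<open>lam\<close> is the rate of survival. The condition \<open>\<theta> < lam\<close> says that large values of \<open>h\<close>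
  decay faster than the process dies out.\<close>

locale eigenfunction_chain =
  fixes P :: "'a \<Rightarrow> 'a pmf" and S :: "'a set" and h :: "'a \<Rightarrow> real" and lam q \<theta> C :: real and x0 :: 'a
  assumes h_ge_1: "\<And>x. x \<in> S \<Longrightarrow> 1 \<le> h x" and h_outside: "\<And>x. x \<notin> S \<Longrightarrow> h x = 0"
    and eigen: "\<And>x. (\<integral>\<^sup>+y. ennreal (h y) \<partial>P x) = ennreal (lam * h x)"
    and lam: "0 < lam" and q: "1 < q" and \<theta>: "0 \<le> \<theta>" "\<theta> < lam" and C: "0 \<le> C"
    and moment: "\<And>x. x \<in> S \<Longrightarrow>
      (\<integral>\<^sup>+y. ennreal (h y powr q) \<partial>P x) \<le> ennreal (\<theta> * h x powr q + C * h x)"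
    and finite_sublevel: "\<And>R. finite {x \<in> S. h x \<le> R}"
    and reach: "\<And>x y. x \<in> S \<Longrightarrow> y \<in> S \<Longrightarrow> eventually (\<lambda>n. pmf (kpow P n x) y > 0) sequentially"
    and x0: "x0 \<in> S"
begin

lemma h_nonneg: "0 \<le> h x"
  using h_ge_1[of x] h_outside[of x] by (cases "x \<in> S") auto

lemma h_pos_iff: "0 < h x \<longleftrightarrow> x \<in> S"
  using h_ge_1[of x] h_outside[of x] by (cases "x \<in> S") auto

text \<open>The h-transform of \<open>P\<close> in the sense of Doob.\<close>

definition Q :: "'a \<Rightarrow> 'a pmf" where
  "Q x = (if x \<in> S then embed_pmf (\<lambda>y. pmf (P x) y * h y / (lam * h x)) else return_pmf x)"

lemma pmf_Q:
  assumes x: "x \<in> S"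
  shows "pmf (Q x) y = pmf (P x) y * h y / (lam * h x)"
proof -
  have pos: "0 < lam * h x" using lam x h_pos_iff by simp
  have "(\<integral>\<^sup>+y. ennreal (pmf (P x) y * h y / (lam * h x)) \<partial>count_space UNIV)
      = (\<integral>\<^sup>+y. ennreal (pmf (P x) y) * ennreal (h y) \<partial>count_space UNIV) / ennreal (lam * h x)"
    using pos h_nonneg
    by (subst nn_integral_divide[symmetric]) (auto simp: divide_ennreal ennreal_mult[symmetric])
  also have "\<dots> = 1"
    using pos lam eigen[of x] by (auto simp: nn_integral_measure_pmf[symmetric] divide_ennreal zero_less_mult_iff)
  finally show ?thesis
    using x pos h_nonneg unfolding Q_def by (simp add: pmf_embed_pmf)
qed

lemma set_Q: "x \<in> S \<Longrightarrow> set_pmf (Q x) \<subseteq> S"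
  using h_outside by (fastforce simp: set_pmf_iff pmf_Q)

lemma nn_integral_Q: "ennreal (lam * h x) * (\<integral>\<^sup>+y. f y \<partial>Q x) = (\<integral>\<^sup>+y. f y * ennreal (h y) \<partial>P x)"
proof (cases "x \<in> S")
  case True
  then have pos: "0 < lam * h x" using lam h_pos_iff by simp
  have "ennreal (lam * h x) * (\<integral>\<^sup>+y. f y \<partial>Q x)
      = (\<integral>\<^sup>+y. ennreal (lam * h x) * (ennreal (pmf (Q x) y) * f y) \<partial>count_space UNIV)"
    by (simp add: nn_integral_measure_pmf nn_integral_cmult)
  also have "\<dots> = (\<integral>\<^sup>+y. ennreal (pmf (P x) y) * (f y * ennreal (h y)) \<partial>count_space UNIV)"
  proof (intro nn_integral_cong)
    fix y
    have "ennreal (lam * h x) * ennreal (pmf (Q x) y) = ennreal (pmf (P x) y) * ennreal (h y)"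
      using pos lam h_nonneg by (auto simp: pmf_Q[OF True] ennreal_mult[symmetric] zero_less_mult_iff)
    then show "ennreal (lam * h x) * (ennreal (pmf (Q x) y) * f y)
        = ennreal (pmf (P x) y) * (f y * ennreal (h y))"
      by (simp add: mult.assoc[symmetric]) (simp add: mult_ac)
  qed
  finally show ?thesis by (simp add: nn_integral_measure_pmf)
next
  case False
  then have "(\<integral>\<^sup>+y. ennreal (h y) \<partial>P x) = 0" using eigen[of x] h_outside by simp
  then have "AE y in P x. ennreal (h y) = 0" by (simp add: nn_integral_0_iff_AE)
  then have "(\<integral>\<^sup>+y. f y * ennreal (h y) \<partial>P x) = (\<integral>\<^sup>+y. 0 \<partial>P x)"
    by (intro nn_integral_cong_AE) (auto simp: AE_measure_pmf_iff)
  with False h_outside show ?thesis by simp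
qed

text \<open>The factors \<open>h\<close> of consecutive steps cancel, so that only the weights at the two ends of a path
  remain.\<close>

lemma nn_integral_kpow_Q:
  "ennreal (lam ^ n * h x) * (\<integral>\<^sup>+y. f y \<partial>kpow Q n x) = (\<integral>\<^sup>+y. f y * ennreal (h y) \<partial>kpow P n x)"
proof (induction n arbitrary: f)
  case 0
  then show ?case by (simp add: mult.commute)
next
  case (Suc n)
  have "ennreal (lam ^ Suc n * h x) * (\<integral>\<^sup>+y. f y \<partial>kpow Q (Suc n) x)
      = ennreal lam * (ennreal (lam ^ n * h x) * (\<integral>\<^sup>+z. \<integral>\<^sup>+y. f y \<partial>Q z \<partial>kpow Q n x))"
    using lam h_nonneg[of x] by (simp add: ennreal_mult mult.assoc)
  also have "\<dots> = ennreal lam * (\<integral>\<^sup>+z. (\<integral>\<^sup>+y. f y \<partial>Q z) * ennreal (h z) \<partial>kpow P n x)"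
    by (simp only: Suc)
  also have "\<dots> = (\<integral>\<^sup>+z. ennreal (lam * h z) * (\<integral>\<^sup>+y. f y \<partial>Q z) \<partial>kpow P n x)"
    using lam h_nonneg by (subst nn_integral_cmult[symmetric]) (auto simp: ennreal_mult mult_ac)
  also have "\<dots> = (\<integral>\<^sup>+y. f y * ennreal (h y) \<partial>kpow P (Suc n) x)"
    by (simp add: nn_integral_Q)
  finally show ?case .
qed

lemma pmf_kpow_Q: "lam ^ n * h x * pmf (kpow Q n x) y = pmf (kpow P n x) y * h y"
proof -
  have "ennreal (lam ^ n * h x * pmf (kpow Q n x) y)
      = ennreal (lam ^ n * h x) * (\<integral>\<^sup>+z. indicator {y} z \<partial>kpow Q n x)"
    using lam h_nonneg by (simp add: ennreal_mult emeasure_pmf_single)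
  also have "\<dots> = (\<integral>\<^sup>+z. indicator {y} z * ennreal (h z) \<partial>kpow P n x)"
    by (rule nn_integral_kpow_Q)
  also have "\<dots> = (\<integral>\<^sup>+z. ennreal (h y) * indicator {y} z \<partial>kpow P n x)"
    by (intro nn_integral_cong) (auto simp: indicator_def)
  also have "\<dots> = ennreal (pmf (kpow P n x) y * h y)"
    using h_nonneg by (simp add: nn_integral_cmult emeasure_pmf_single ennreal_mult mult.commute)
  finally show ?thesis using lam h_nonneg by simp
qed

text \<open>\<open>h\<close> is at least \<open>1\<close> on \<open>S\<close>, so \<open>1 / h\<close> is a bounded function: probabilities of \<open>P\<close> are
  expectations of bounded functions under the transformed chain.\<close>

lemma measure_kpow_eq:
  assumes x: "x \<in> S"
  shows "measure (kpow P n x) (A \<inter> S)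
    = lam ^ n * h x * measure_pmf.expectation (kpow Q n x) (\<lambda>y. indicator (A \<inter> S) y / h y)"
proof -
  let ?f = "\<lambda>y. indicator (A \<inter> S) y / h y"
  have f: "0 \<le> ?f y" "?f y \<le> 1" for y
    using h_ge_1[of y] h_nonneg[of y] by (auto simp: indicator_def)
  have "ennreal (lam ^ n * h x * measure_pmf.expectation (kpow Q n x) ?f)
      = ennreal (lam ^ n * h x) * (\<integral>\<^sup>+y. ennreal (?f y) \<partial>kpow Q n x)"
    using lam h_nonneg[of x] f
    by (subst nn_integral_eq_integral)
      (auto simp: ennreal_mult' h_nonneg intro!: integrable_pmf_bounded[where B = 1])
  also have "\<dots> = (\<integral>\<^sup>+y. ennreal (?f y) * ennreal (h y) \<partial>kpow P n x)"
    by (rule nn_integral_kpow_Q)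
  also have "\<dots> = (\<integral>\<^sup>+y. indicator (A \<inter> S) y \<partial>kpow P n x)"
  proof (intro nn_integral_cong)
    fix y show "ennreal (?f y) * ennreal (h y) = indicator (A \<inter> S) y"
      using h_nonneg[of y] h_pos_iff[of y] by (auto simp: indicator_def ennreal_mult[symmetric])
  qed
  also have "\<dots> = ennreal (measure (kpow P n x) (A \<inter> S))"
    by (simp add: measure_pmf.emeasure_eq_measure)
  finally show ?thesis
    using lam h_nonneg[of x] f by (simp add: expectation_pmf_unit_interval)
qed

text \<open>Dividing by \<open>lam * h\<close> lowers the exponent by one: the moment condition of order \<open>q\<close> on \<open>P\<close> is a drift
  condition of order \<open>q - 1\<close> on \<open>Q\<close>.\<close>

lemma drift_chain_Q: "drift_chain Q S (\<lambda>x. h x powr (q - 1)) (\<theta> / lam) (C / lam) x0"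
proof
  fix x assume x: "x \<in> S"
  then have pos: "0 < lam * h x" using lam h_pos_iff by simp
  show "set_pmf (Q x) \<subseteq> S" by (rule set_Q) fact
  show "0 \<le> h x powr (q - 1)" by simp
  have split: "h y powr (q - 1) * h y = h y powr q" for y
    using h_nonneg[of y] powr_mult_base[of "h y" "q - 1"] by (simp add: mult.commute)
  have "ennreal (lam * h x) * (\<integral>\<^sup>+y. ennreal (h y powr (q - 1)) \<partial>Q x) = (\<integral>\<^sup>+y. ennreal (h y powr q) \<partial>P x)"
    unfolding nn_integral_Q using h_nonneg by (simp add: ennreal_mult[symmetric] split)
  also have "\<dots> \<le> ennreal (\<theta> * h x powr q + C * h x)" by (rule moment[OF x])
  also have "\<dots> = ennreal (lam * h x) * ennreal (\<theta> / lam * h x powr (q - 1) + C / lam)"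
    using lam \<theta> C h_nonneg[of x] split[of x]
    by (subst ennreal_mult[symmetric]) (auto simp: distrib_left mult_ac simp del: ennreal_plus)
  finally show "(\<integral>\<^sup>+y. ennreal (h y powr (q - 1)) \<partial>Q x) \<le> ennreal (\<theta> / lam * h x powr (q - 1) + C / lam)"
    using pos by (subst (asm) ennreal_mult_le_mult_iff) auto
  have "eventually (\<lambda>n. pmf (kpow P n x) x0 > 0) sequentially" by (rule reach[OF x x0])
  then show "eventually (\<lambda>n. pmf (kpow Q n x) x0 > 0) sequentially"
  proof eventually_elim
    case (elim n)
    then have "0 < lam ^ n * h x * pmf (kpow Q n x) x0"
      using x0 h_pos_iff by (simp add: pmf_kpow_Q)
    then show ?case using lam x h_pos_iff by (simp add: zero_less_mult_iff)
  qed
next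
  fix R
  have "h x \<le> max R 1 powr (1 / (q - 1))" if "x \<in> S" "h x powr (q - 1) \<le> R" for x
  proof -
    have "h x = (h x powr (q - 1)) powr (1 / (q - 1))"
      using q h_nonneg[of x] by (simp add: powr_powr)
    also have "\<dots> \<le> max R 1 powr (1 / (q - 1))"
      using that q by (intro powr_mono2) auto
    finally show ?thesis .
  qed
  then have "{x \<in> S. h x powr (q - 1) \<le> R} \<subseteq> {x \<in> S. h x \<le> max R 1 powr (1 / (q - 1))}" by blast
  then show "finite {x \<in> S. h x powr (q - 1) \<le> R}"
    using finite_sublevel finite_subset by blast
qed (use lam \<theta> C x0 in auto)

text \<open>Undoing the transform, the invariant law \<open>\<pi>\<close> of the transformed chain becomes the
  quasi-stationary law \<open>\<nu>\<close>, proportional to \<open>\<pi> / h\<close>, and \<open>c\<close> is its normalisation \<open>\<pi>(1 / h)\<close>.\<close>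

theorem quasi_stationary_limit:
  obtains \<nu> :: "'a pmf" and c :: real and r :: "nat \<Rightarrow> 'a \<Rightarrow> real"
  where "set_pmf \<nu> = S" "0 < c" "(\<integral>\<^sup>+y. ennreal (h y powr q) \<partial>\<nu>) < \<infinity>"
    and "\<And>n A. measure_pmf.expectation \<nu> (\<lambda>x. measure (kpow P n x) (A \<inter> S)) = lam ^ n * measure \<nu> A"
    and "\<And>x. x \<in> S \<Longrightarrow> (\<lambda>n. r n x) \<longlonglongrightarrow> 0" "\<And>n x. x \<in> S \<Longrightarrow> 0 \<le> r n x" "\<And>n x. r n x \<le> 1"
    and "\<And>n x A. x \<in> S \<Longrightarrow>
      \<bar>measure (kpow P n x) (A \<inter> S) / lam ^ n - c * h x * measure \<nu> A\<bar> \<le> h x * r n x"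
proof -
  note reach_P = reach
  interpret drift_chain Q S "\<lambda>x. h x powr (q - 1)" "\<theta> / lam" "C / lam" x0
    by (rule drift_chain_Q)
  obtain \<pi> \<rho> B where \<pi>: "set_pmf \<pi> \<subseteq> S" "(\<integral>\<^sup>+y. ennreal (h y powr (q - 1)) \<partial>\<pi>) < \<infinity>" "bind_pmf \<pi> Q = \<pi>"
    and \<rho>: "\<rho> \<longlonglongrightarrow> 0"
    and conv: "\<And>n f x. (\<forall>y. 0 \<le> f y \<and> f y \<le> 1) \<and> x \<in> S \<Longrightarrow>
        \<bar>E n x f - measure_pmf.expectation \<pi> f\<bar> \<le> \<rho> n * B x"
    using ergodic_theorem by blast
  have bnd: "0 \<le> indicator A y / h y" "indicator A y / h y \<le> 1" for A y
    using h_ge_1[of y] h_outside[of y] by (cases "y \<in> S"; auto simp: indicator_def)+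
  define c where "c = measure_pmf.expectation \<pi> (\<lambda>y. 1 / h y)"
  have inv_int: "integrable \<pi> (\<lambda>y. 1 / h y)"
    using bnd[of UNIV] by (intro integrable_pmf_bounded[where B = 1]) auto
  have "c \<noteq> 0"
  proof
    assume "c = 0"
    then have "AE y in \<pi>. 1 / h y = 0"
      unfolding c_def using bnd[of UNIV] inv_int by (subst (asm) integral_nonneg_eq_0_iff_AE) auto
    moreover obtain y where "y \<in> set_pmf \<pi>" using set_pmf_not_empty[of \<pi>] by blast
    ultimately show False using \<pi>(1) h_pos_iff[of y] by (auto simp: AE_measure_pmf_iff)
  qed
  moreover have "0 \<le> c" unfolding c_def using bnd[of UNIV] by (intro integral_nonneg_AE) auto
  ultimately have c: "0 < c" by simp
  define \<nu> where "\<nu> = embed_pmf (\<lambda>y. pmf \<pi> y * (1 / (c * h y)))"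
  have g_nonneg: "0 \<le> 1 / (c * h y)" for y using c h_nonneg[of y] by simp
  have pmf_\<nu>: "pmf \<nu> y = pmf \<pi> y * (1 / (c * h y))" for y
    unfolding \<nu>_def
  proof (rule pmf_embed_pmf)
    show "0 \<le> pmf \<pi> x * (1 / (c * h x))" for x using g_nonneg by simp
    have "(\<integral>\<^sup>+y. ennreal (pmf \<pi> y * (1 / (c * h y))) \<partial>count_space UNIV)
        = (\<integral>\<^sup>+y. ennreal ((1 / h y) / c) \<partial>\<pi>)"
      by (simp add: nn_integral_measure_pmf ennreal_mult'[symmetric] mult.commute)
    also have "\<dots> = ennreal (measure_pmf.expectation \<pi> (\<lambda>y. (1 / h y) / c))"
      using inv_int c h_nonneg by (intro nn_integral_eq_integral integrable_divide) auto
    also have "measure_pmf.expectation \<pi> (\<lambda>y. (1 / h y) / c) = c / c"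
      unfolding c_def by (rule integral_divide_zero)
    also have "ennreal (c / c) = 1" using c by simp
    finally show "(\<integral>\<^sup>+y. ennreal (pmf \<pi> y * (1 / (c * h y))) \<partial>count_space UNIV) = 1" .
  qed
  note reweight = integral_pmf_reweight[OF pmf_\<nu> g_nonneg]
  have "S \<subseteq> set_pmf \<pi>"
  proof
    fix y assume y: "y \<in> S"
    obtain x where x: "x \<in> set_pmf \<pi>" using set_pmf_not_empty[of \<pi>] by blast
    then have "x \<in> S" using \<pi> by blast
    then obtain n where "pmf (kpow P n x) y > 0"
      using eventually_happens[OF reach_P[OF _ y]] by auto
    then have "pmf (kpow Q n x) y \<noteq> 0"
      using pmf_kpow_Q[of n x y] y h_pos_iff[of y] by auto
    then have "y \<in> set_pmf (bind_pmf \<pi> (kpow Q n))"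
      using x by (auto simp: set_pmf_iff)
    then show "y \<in> set_pmf \<pi>" by (simp only: bind_kpow_invariant[OF \<pi>(3)])
  qed
  moreover have "h y \<noteq> 0" if "y \<in> S" for y
    using h_ge_1[OF that] by simp
  ultimately have supp: "set_pmf \<nu> = S"
    using \<pi>(1) c by (auto simp: set_pmf_iff pmf_\<nu>)
  have fin: "(\<integral>\<^sup>+y. ennreal (h y powr q) \<partial>\<nu>) < \<infinity>"
  proof -
    have "(\<integral>\<^sup>+y. ennreal (h y powr q) \<partial>\<nu>) = (\<integral>\<^sup>+y. ennreal (1 / (c * h y) * h y powr q) \<partial>\<pi>)"
      by (rule reweight)
    also have "\<dots> = (\<integral>\<^sup>+y. ennreal (1 / c) * ennreal (h y powr (q - 1)) \<partial>\<pi>)"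
    proof (intro nn_integral_cong)
      fix y
      have "1 / (c * h y) * h y powr q = 1 / c * h y powr (q - 1)"
        using h_nonneg[of y] by (cases "h y = 0") (auto simp: powr_diff)
      then show "ennreal (1 / (c * h y) * h y powr q) = ennreal (1 / c) * ennreal (h y powr (q - 1))"
        using c by (simp only: ennreal_mult[symmetric] powr_ge_zero zero_le_divide_1_iff less_imp_le)
    qed
    also have "\<dots> < \<infinity>" using \<pi>(2) by (simp add: nn_integral_cmult ennreal_mult_less_top)
    finally show ?thesis .
  qed
  have meas: "c * measure \<nu> A = measure_pmf.expectation \<pi> (\<lambda>y. indicator (A \<inter> S) y / h y)" for A
  proof -
    have "measure \<nu> A = measure_pmf.expectation \<pi> (\<lambda>y. 1 / (c * h y) * indicator A y)"
      using reweight(1)[of "indicator A"] by simp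
    also have "\<dots> = measure_pmf.expectation \<pi> (\<lambda>y. (indicator (A \<inter> S) y / h y) / c)"
      using \<pi>(1) by (intro integral_cong_AE) (auto simp: AE_measure_pmf_iff indicator_def)
    also have "\<dots> = measure_pmf.expectation \<pi> (\<lambda>y. indicator (A \<inter> S) y / h y) / c"
      by (rule integral_divide_zero)
    finally show ?thesis using c by simp
  qed
  have inv: "measure_pmf.expectation \<nu> (\<lambda>x. measure (kpow P n x) (A \<inter> S)) = lam ^ n * measure \<nu> A" for n A
  proof -
    let ?f = "\<lambda>y. indicator (A \<inter> S) y / h y"
    have "measure_pmf.expectation \<nu> (\<lambda>x. measure (kpow P n x) (A \<inter> S))
        = measure_pmf.expectation \<pi> (\<lambda>x. 1 / (c * h x) * measure (kpow P n x) (A \<inter> S))"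
      by (rule reweight)
    also have "\<dots> = measure_pmf.expectation \<pi> (\<lambda>x. lam ^ n / c * E n x ?f)"
    proof (rule integral_cong_AE)
      have "1 / (c * h x) * measure (kpow P n x) (A \<inter> S) = lam ^ n / c * E n x ?f" if "x \<in> S" for x
        using h_ge_1[OF that] c by (simp add: measure_kpow_eq[OF that])
      then show "AE x in \<pi>. 1 / (c * h x) * measure (kpow P n x) (A \<inter> S) = lam ^ n / c * E n x ?f"
        using \<pi>(1) by (auto simp: AE_measure_pmf_iff)
    qed simp_all
    also have "\<dots> = lam ^ n / c * measure_pmf.expectation \<pi> (\<lambda>x. E n x ?f)" by simp
    also have "measure_pmf.expectation \<pi> (\<lambda>x. E n x ?f) = measure_pmf.expectation (bind_pmf \<pi> (kpow Q n)) ?f"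
      by (rule expectation_bind_pmf[OF bnd, symmetric])
    also have "\<dots> = c * measure \<nu> A"
      by (simp only: bind_kpow_invariant[OF \<pi>(3)] meas)
    finally show ?thesis using c by simp
  qed
  define r where "r n x = min 1 (\<rho> n * B x)" for n x
  have r_lim: "(\<lambda>n. r n x) \<longlonglongrightarrow> 0" for x
  proof -
    have "(\<lambda>n. min 1 (\<rho> n * B x)) \<longlonglongrightarrow> min 1 (0 * B x)" by (intro tendsto_intros \<rho>)
    then show ?thesis by (simp add: r_def)
  qed
  have r_bound: "\<bar>E n x (\<lambda>y. indicator (A \<inter> S) y / h y) - c * measure \<nu> A\<bar> \<le> r n x" if "x \<in> S" for n x A
  proof -
    have "\<bar>E n x (\<lambda>y. indicator (A \<inter> S) y / h y) - c * measure \<nu> A\<bar> \<le> \<rho> n * B x"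
      unfolding meas using bnd that by (intro conv) auto
    moreover have "0 \<le> c * measure \<nu> A" "c * measure \<nu> A \<le> 1"
      unfolding meas by (rule expectation_pmf_unit_interval[OF bnd])+
    moreover have "0 \<le> E n x (\<lambda>y. indicator (A \<inter> S) y / h y)" "E n x (\<lambda>y. indicator (A \<inter> S) y / h y) \<le> 1"
      by (rule expectation_pmf_unit_interval[OF bnd])+
    ultimately show ?thesis unfolding r_def by linarith
  qed
  have approx: "\<bar>measure (kpow P n x) (A \<inter> S) / lam ^ n - c * h x * measure \<nu> A\<bar> \<le> h x * r n x" if x: "x \<in> S" for n x A
  proof -
    have "measure (kpow P n x) (A \<inter> S) / lam ^ n - c * h x * measure \<nu> A
        = h x * (E n x (\<lambda>y. indicator (A \<inter> S) y / h y) - c * measure \<nu> A)"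
      using lam by (simp add: measure_kpow_eq[OF x] algebra_simps)
    then show ?thesis
      using r_bound[OF x, of n A] h_nonneg[of x] by (simp add: abs_mult mult_left_mono)
  qed
  have r_nonneg: "0 \<le> r n x" if "x \<in> S" for n x
    using r_bound[OF that, of n "{}"] by linarith
  have r_le: "r n x \<le> 1" for n x by (simp add: r_def)
  show ?thesis
    by (rule that[of \<nu> c r, OF supp c fin inv r_lim r_nonneg r_le approx])
qed

text \<open>The error terms \<open>h x * r n x\<close> are dominated by \<open>h x\<close>, so they can be integrated
  against every initial law that integrates \<open>h\<close>.\<close>

lemma conditional_limit:
  fixes \<mu> \<nu> :: "'a pmf" and r :: "nat \<Rightarrow> 'a \<Rightarrow> real"
  defines "N \<equiv> \<lambda>n A. measure_pmf.expectation \<mu> (\<lambda>x. measure (kpow P n x) (A \<inter> S))"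
  assumes c: "0 < c"
    and r: "\<And>x. x \<in> S \<Longrightarrow> (\<lambda>n. r n x) \<longlonglongrightarrow> 0" "\<And>n x. x \<in> S \<Longrightarrow> 0 \<le> r n x" "\<And>n x. r n x \<le> 1"
    and approx: "\<And>n x A. x \<in> S \<Longrightarrow>
      \<bar>measure (kpow P n x) (A \<inter> S) / lam ^ n - c * h x * measure \<nu> A\<bar> \<le> h x * r n x"
    and \<mu>: "set_pmf \<mu> \<subseteq> S" "integrable \<mu> h"
  shows "(\<lambda>n. SUP A. \<bar>N n A / N n UNIV - measure \<nu> A\<bar>) \<longlonglongrightarrow> 0"
proof -
  have hr: "\<bar>h x * r n x\<bar> \<le> h x" if "x \<in> S" for n x
    using h_nonneg[of x] r(2)[OF that] r(3)[of n x] by (simp add: abs_mult mult_left_le)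
  define J where "J n = measure_pmf.expectation \<mu> (\<lambda>x. h x * r n x)" for n
  define D where "D = c * measure_pmf.expectation \<mu> h"
  have hr_int: "integrable \<mu> (\<lambda>x. h x * r n x)" for n
    using \<mu> hr[of _ n] h_nonneg
    by (intro Bochner_Integration.integrable_bound[OF \<mu>(2)]) (auto simp: AE_measure_pmf_iff)
  have J: "J \<longlonglongrightarrow> 0"
  proof -
    have "J \<longlonglongrightarrow> measure_pmf.expectation \<mu> (\<lambda>x. 0)"
      unfolding J_def
    proof (rule integral_dominated_convergence[where w = h])
      show "AE x in \<mu>. (\<lambda>n. h x * r n x) \<longlonglongrightarrow> 0"
        using \<mu>(1) r(1) by (auto simp: AE_measure_pmf_iff intro!: tendsto_mult_right_zero)
      show "AE x in \<mu>. norm (h x * r n x) \<le> h x" for n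
        using \<mu>(1) hr by (auto simp: AE_measure_pmf_iff)
    qed (use \<mu> in auto)
    then show ?thesis by simp
  qed
  have "0 < measure_pmf.expectation \<mu> h"
  proof -
    have "1 = measure_pmf.expectation \<mu> (\<lambda>x. 1 :: real)" by simp
    also have "\<dots> \<le> measure_pmf.expectation \<mu> h"
      using \<mu> h_ge_1 by (intro expectation_pmf_mono) auto
    finally show ?thesis by simp
  qed
  then have D: "0 < D" using c by (simp add: D_def)
  have N_approx: "\<bar>N n A / lam ^ n - D * measure \<nu> A\<bar> \<le> J n" for n A
  proof -
    have int: "integrable \<mu> (\<lambda>x. measure (kpow P n x) (A \<inter> S))"
      by (intro integrable_pmf_bounded[where B = 1]) auto
    have "N n A / lam ^ n - D * measure \<nu> A
        = measure_pmf.expectation \<mu> (\<lambda>x. measure (kpow P n x) (A \<inter> S) / lam ^ n - c * h x * measure \<nu> A)"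
      using int \<mu>(2) by (simp add: N_def D_def)
    also have "\<bar>\<dots>\<bar> \<le> measure_pmf.expectation \<mu>
        (\<lambda>x. \<bar>measure (kpow P n x) (A \<inter> S) / lam ^ n - c * h x * measure \<nu> A\<bar>)"
      by (rule integral_abs_bound)
    also have "\<dots> \<le> J n"
      unfolding J_def using int \<mu> approx hr_int by (intro expectation_pmf_mono) auto
    finally show ?thesis .
  qed
  have "(\<lambda>n. N n UNIV / lam ^ n - D) \<longlonglongrightarrow> 0"
    using N_approx[of _ UNIV] by (intro Lim_null_comparison[OF always_eventually J]) auto
  then have D_lim: "(\<lambda>n. N n UNIV / lam ^ n) \<longlonglongrightarrow> D"
    by (simp add: LIM_zero_iff)
  have bound: "\<bar>N n A / N n UNIV - measure \<nu> A\<bar> \<le> 2 * J n / (N n UNIV / lam ^ n)"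
    if pos: "0 < N n UNIV / lam ^ n" for n A
  proof -
    let ?d = "N n UNIV / lam ^ n"
    have "N n A / N n UNIV - measure \<nu> A
        = ((N n A / lam ^ n - D * measure \<nu> A) + measure \<nu> A * (D - ?d)) / ?d"
      using pos lam by (auto simp: field_simps)
    also have "\<bar>\<dots>\<bar> \<le> (\<bar>N n A / lam ^ n - D * measure \<nu> A\<bar> + \<bar>measure \<nu> A * (D - ?d)\<bar>) / ?d"
      unfolding abs_div_pos[OF pos, symmetric]
      using pos by (intro divide_right_mono abs_triangle_ineq) simp
    also have "\<dots> \<le> (J n + J n) / ?d"
    proof (intro divide_right_mono add_mono N_approx)
      have "\<bar>measure \<nu> A * (D - ?d)\<bar> = measure \<nu> A * \<bar>?d - D\<bar>"
        by (simp add: abs_mult abs_minus_commute[of D])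
      also have "\<dots> \<le> \<bar>?d - D\<bar>" by (intro mult_left_le_one_le) auto
      also have "\<dots> \<le> J n" using N_approx[of n UNIV] by simp
      finally show "\<bar>measure \<nu> A * (D - ?d)\<bar> \<le> J n" .
    qed (use pos in simp)
    finally show ?thesis by simp
  qed
  have ev: "eventually (\<lambda>n. 0 < N n UNIV / lam ^ n) sequentially"
    using order_tendstoD(1)[OF D_lim D] .
  show ?thesis
  proof (rule tendsto_sandwich[OF _ _ tendsto_const])
    show "\<forall>\<^sub>F n in sequentially. 0 \<le> (SUP A. \<bar>N n A / N n UNIV - measure \<nu> A\<bar>)"
      using ev
    proof eventually_elim
      case (elim n)
      then have "bdd_above (range (\<lambda>A. \<bar>N n A / N n UNIV - measure \<nu> A\<bar>))"
        using bound by (intro bdd_aboveI2) blast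
      then show ?case by (intro cSUP_upper2[where x = "{}"]) auto
    qed
    show "\<forall>\<^sub>F n in sequentially. (SUP A. \<bar>N n A / N n UNIV - measure \<nu> A\<bar>) \<le> 2 * J n / (N n UNIV / lam ^ n)"
      using ev by eventually_elim (intro cSUP_least bound; simp)
    have "(\<lambda>n. 2 * J n / (N n UNIV / lam ^ n)) \<longlonglongrightarrow> 2 * 0 / D"
      using D by (intro tendsto_intros J D_lim) auto
    then show "(\<lambda>n. 2 * J n / (N n UNIV / lam ^ n)) \<longlonglongrightarrow> 0" by simp
  qed
qed

end

section \<open>Moments of sums of independent random variables\<close>

text \<open>If \<open>b\<close> is small compared with \<open>a\<close>, the sum is at most a multiple of \<open>a\<close> close to 1; otherwise it is at
  most a large multiple of \<open>b\<close>.\<close>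

lemma powr_add_le:
  fixes p \<delta> :: real
  assumes p: "0 \<le> p" and \<delta>: "0 < \<delta>"
  shows "\<exists>C\<ge>0. \<forall>a b. 0 \<le> a \<longrightarrow> 0 \<le> b \<longrightarrow> (a + b) powr p \<le> (1 + \<delta>) * a powr p + C * b powr p"
proof -
  have "((\<lambda>\<eta>. (1 + \<eta>) powr p) \<longlongrightarrow> (1 + 0) powr p) (at_right 0)"
    by (intro tendsto_intros) auto
  then have "eventually (\<lambda>\<eta>. (1 + \<eta>) powr p < 1 + \<delta>) (at_right 0)"
    using \<delta> by (intro order_tendstoD(2)) auto
  then have "eventually (\<lambda>\<eta>. (1 + \<eta>) powr p < 1 + \<delta> \<and> 0 < \<eta>) (at_right 0)"
    by (intro eventually_conj eventually_at_right_less)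
  then obtain \<eta> where \<eta>: "(1 + \<eta>) powr p < 1 + \<delta>" "0 < \<eta>"
    using eventually_happens'[OF trivial_limit_at_right_real] by blast
  have "(a + b) powr p \<le> (1 + \<delta>) * a powr p + (1 + 1 / \<eta>) powr p * b powr p"
    if ab: "0 \<le> a" "0 \<le> b" for a b
  proof (cases "b \<le> \<eta> * a")
    case True
    have "(a + b) powr p \<le> ((1 + \<eta>) * a) powr p"
      using True ab p by (intro powr_mono2) (auto simp: algebra_simps)
    also have "\<dots> = (1 + \<eta>) powr p * a powr p" using ab \<eta> by (simp add: powr_mult)
    also have "\<dots> \<le> (1 + \<delta>) * a powr p" using \<eta> by (intro mult_right_mono) auto
    finally show ?thesis by (rule add_increasing2[rotated]) simp
  next
    case False
    then have "a \<le> b / \<eta>" using \<eta> by (simp add: field_simps)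
    then have "(a + b) powr p \<le> ((1 + 1 / \<eta>) * b) powr p"
      using ab p by (intro powr_mono2) (auto simp: algebra_simps)
    also have "\<dots> = (1 + 1 / \<eta>) powr p * b powr p" using ab \<eta> by (simp add: powr_mult)
    finally show ?thesis by (rule add_increasing[rotated]) (use \<delta> in simp)
  qed
  then show ?thesis by (intro exI[of _ "(1 + 1 / \<eta>) powr p"]) simp
qed

lemma linear_le_powr:
  fixes p \<epsilon> :: real
  assumes p: "1 < p" and \<epsilon>: "0 < \<epsilon>"
  shows "\<exists>C\<ge>0. \<forall>t\<ge>0. t \<le> \<epsilon> * t powr p + C"
proof -
  \<comment> \<open>Beyond this point \<open>\<epsilon> * t powr (p - 1)\<close> is at least 1.\<close>
  let ?C = "(1 / \<epsilon>) powr (1 / (p - 1))"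
  have "t \<le> \<epsilon> * t powr p + ?C" if t: "0 \<le> t" for t
  proof (cases "t \<le> ?C")
    case True
    then show ?thesis by (rule add_increasing[rotated]) (use \<epsilon> in simp)
  next
    case False
    then have "?C powr (p - 1) \<le> t powr (p - 1)" using p by (intro powr_mono2) auto
    then have "1 / \<epsilon> \<le> t powr (p - 1)" using p \<epsilon> by (simp add: powr_powr)
    then have "1 \<le> \<epsilon> * t powr (p - 1)" using \<epsilon> by (simp add: field_simps)
    then have "t * 1 \<le> t * (\<epsilon> * t powr (p - 1))" using t by (intro mult_left_mono) auto
    also have "\<dots> = \<epsilon> * t powr p" using t powr_mult_base[of t "p - 1"] by (simp add: mult_ac)
    finally show ?thesis by (intro add_increasing2) simp_all
  qed
  then show ?thesis by (intro exI[of _ ?C]) simp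
qed

context prob_space
begin

lemma integrable_powr_le:
  fixes X :: "'a \<Rightarrow> real"
  assumes X: "\<And>\<omega>. 0 \<le> X \<omega>" "random_variable borel X" and int: "integrable M (\<lambda>\<omega>. X \<omega> powr p)"
    and s: "0 \<le> s" "s \<le> p"
  shows "integrable M (\<lambda>\<omega>. X \<omega> powr s)" "expectation (\<lambda>\<omega>. X \<omega> powr s) \<le> 1 + expectation (\<lambda>\<omega>. X \<omega> powr p)"
proof -
  have le: "X \<omega> powr s \<le> 1 + X \<omega> powr p" for \<omega>
  proof (cases "X \<omega> \<le> 1")
    case True
    then have "X \<omega> powr s \<le> 1" using X(1)[of \<omega>] s by (intro powr_le1) auto
    then show ?thesis by (rule add_increasing2[rotated]) simp
  next
    case False
    then have "X \<omega> powr s \<le> X \<omega> powr p" using s by (intro powr_mono) auto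
    then show ?thesis by simp
  qed
  show 1: "integrable M (\<lambda>\<omega>. X \<omega> powr s)"
  proof (rule Bochner_Integration.integrable_bound)
    show "integrable M (\<lambda>\<omega>. 1 + X \<omega> powr p)" using int by simp
    show "random_variable borel (\<lambda>\<omega>. X \<omega> powr s)" using X(2) by measurable
    show "AE \<omega> in M. norm (X \<omega> powr s) \<le> norm (1 + X \<omega> powr p)"
      using order_trans[OF le abs_ge_self] by (intro AE_I2) simp
  qed
  have "expectation (\<lambda>\<omega>. X \<omega> powr s) \<le> expectation (\<lambda>\<omega>. 1 + X \<omega> powr p)"
    using 1 int le by (intro integral_mono) auto
  then show "expectation (\<lambda>\<omega>. X \<omega> powr s) \<le> 1 + expectation (\<lambda>\<omega>. X \<omega> powr p)"
    using int by (simp add: prob_space)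
qed

text \<open>Jensen's inequality for the concave power, in the form of the tangent bound
  \<open>s powr p * m powr (1 - p) \<le> p * s + (1 - p) * m\<close> at the mean \<open>m\<close>.\<close>

lemma expectation_powr_le_powr_expectation:
  fixes X :: "'a \<Rightarrow> real"
  assumes X: "\<And>\<omega>. 0 \<le> X \<omega>" "integrable M X" and p: "0 < p" "p \<le> 1"
  shows "integrable M (\<lambda>\<omega>. X \<omega> powr p)" "expectation (\<lambda>\<omega>. X \<omega> powr p) \<le> expectation X powr p"
proof -
  show int: "integrable M (\<lambda>\<omega>. X \<omega> powr p)"
    by (rule integrable_powr_le(1)[where X = X and p = 1]) (use X p in auto)
  let ?m = "expectation X"
  show "expectation (\<lambda>\<omega>. X \<omega> powr p) \<le> ?m powr p"
  proof (cases "?m = 0")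
    case True
    then have "AE \<omega> in M. X \<omega> = 0"
      using X integral_nonneg_eq_0_iff_AE[of M X] by simp
    then have "expectation (\<lambda>\<omega>. X \<omega> powr p) = expectation (\<lambda>\<omega>. 0)"
      using X(2) by (intro integral_cong_AE) auto
    then show ?thesis by simp
  next
    case False
    then have m: "0 < ?m" using X by (simp add: less_le integral_nonneg_AE)
    have "X \<omega> powr p * ?m powr (1 - p) \<le> p * X \<omega> + (1 - p) * ?m" for \<omega>
    proof (cases "X \<omega> = 0")
      case True
      then show ?thesis using p m by simp
    next
      case False
      then show ?thesis using X(1)[of \<omega>] p m by (intro Youngs_inequality_0) auto
    qed
    then have "expectation (\<lambda>\<omega>. X \<omega> powr p * ?m powr (1 - p)) \<le> expectation (\<lambda>\<omega>. p * X \<omega> + (1 - p) * ?m)"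
      using int X(2) by (intro integral_mono) auto
    also have "\<dots> = ?m" using X(2) by (simp add: prob_space algebra_simps)
    also have "\<dots> = ?m powr p * ?m powr (1 - p)"
      using m by (simp add: powr_add[symmetric])
    finally have "expectation (\<lambda>\<omega>. X \<omega> powr p) * ?m powr (1 - p) \<le> ?m powr p * ?m powr (1 - p)" by simp
    then show ?thesis using m by simp
  qed
qed

lemma integrable_sum_powr:
  fixes Y :: "'i \<Rightarrow> 'a \<Rightarrow> real"
  assumes "finite J" and Y: "\<And>i \<omega>. 0 \<le> Y i \<omega>" "\<And>i. i \<in> J \<Longrightarrow> random_variable borel (Y i)"
    and int: "\<And>i. i \<in> J \<Longrightarrow> integrable M (\<lambda>\<omega>. Y i \<omega> powr p)" and p: "0 \<le> p"
  shows "integrable M (\<lambda>\<omega>. (\<Sum>i\<in>J. Y i \<omega>) powr p)"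
  using assms(1) Y(2) int
proof (induction J rule: finite_induct)
  case empty
  then show ?case by simp
next
  case (insert i J)
  obtain C where C: "0 \<le> C" "\<And>a b. 0 \<le> a \<Longrightarrow> 0 \<le> b \<Longrightarrow> (a + b) powr p \<le> (1 + 1) * a powr p + C * b powr p"
    using powr_add_le[OF p zero_less_one] by blast
  have "(\<Sum>j\<in>insert i J. Y j \<omega>) powr p \<le> (1 + 1) * Y i \<omega> powr p + C * (\<Sum>j\<in>J. Y j \<omega>) powr p" for \<omega>
    using insert Y(1) C(2)[of "Y i \<omega>" "\<Sum>j\<in>J. Y j \<omega>"] by (simp add: sum_nonneg)
  note step = this
  have le: "norm ((\<Sum>j\<in>insert i J. Y j \<omega>) powr p)
      \<le> norm ((1 + 1) * Y i \<omega> powr p + C * (\<Sum>j\<in>J. Y j \<omega>) powr p)" for \<omega>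
  proof -
    have "norm ((\<Sum>j\<in>insert i J. Y j \<omega>) powr p) = (\<Sum>j\<in>insert i J. Y j \<omega>) powr p"
      by (simp only: real_norm_def abs_of_nonneg powr_ge_zero)
    then show ?thesis
      using step[of \<omega>] abs_ge_self[of "(1 + 1) * Y i \<omega> powr p + C * (\<Sum>j\<in>J. Y j \<omega>) powr p"]
      unfolding real_norm_def by linarith
  qed
  have "integrable M (\<lambda>\<omega>. (1 + 1) * Y i \<omega> powr p + C * (\<Sum>j\<in>J. Y j \<omega>) powr p)"
    using insert by (intro Bochner_Integration.integrable_add integrable_mult_right) auto
  moreover have "random_variable borel (\<lambda>\<omega>. (\<Sum>j\<in>insert i J. Y j \<omega>) powr p)"
  proof -
    have [measurable]: "random_variable borel (\<lambda>\<omega>. \<Sum>j\<in>insert i J. Y j \<omega>)"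
      using insert by (intro borel_measurable_sum) auto
    show ?thesis by measurable
  qed
  ultimately show ?case
    by (rule Bochner_Integration.integrable_bound) (intro AE_I2 le)
qed

text \<open>The upper half of a law of large numbers in the \<open>p\<close>-th mean, uniform over the finite index sets.
  One factor of the \<open>p\<close>-th power of the sum is expanded. The summand that it singles out is
  independent of the rest of the sum, whose power \<open>p - 1\<close> is controlled by induction. Splitting this
  summand off with \<open>powr_add_le\<close> costs a factor \<open>1 + \<delta>\<close> and a term linear in the number of summands,
  which \<open>linear_le_powr\<close> absorbs. The induction ends with Jensen's inequality for exponents up to 1.\<close>

lemma sum_moment_bound:
  fixes Y :: "'i \<Rightarrow> 'a \<Rightarrow> real"
  assumes indep: "indep_vars (\<lambda>_. borel) Y I" and Y: "\<And>i \<omega>. 0 \<le> Y i \<omega>"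
    and int: "\<And>i. i \<in> I \<Longrightarrow> integrable M (Y i)" "\<And>i. i \<in> I \<Longrightarrow> integrable M (\<lambda>\<omega>. Y i \<omega> powr q)"
    and m: "\<And>i. i \<in> I \<Longrightarrow> expectation (Y i) \<le> m"
    and B: "\<And>i. i \<in> I \<Longrightarrow> expectation (\<lambda>\<omega>. Y i \<omega> powr q) \<le> B"
    and mB: "0 \<le> m" "0 \<le> B"
    and p: "0 < p" "p \<le> q" and \<epsilon>: "0 < \<epsilon>"
  shows "\<exists>C\<ge>0. \<forall>J. finite J \<and> J \<subseteq> I \<longrightarrow> expectation (\<lambda>\<omega>. (\<Sum>i\<in>J. Y i \<omega>) powr p)
           \<le> (\<Sum>i\<in>J. expectation (Y i)) powr p + \<epsilon> * real (card J) powr p + C"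
proof -
  have rv: "random_variable borel (Y i)" if "i \<in> I" for i
    using indep that by (auto simp: indep_vars_def)
  have "\<exists>C\<ge>0. \<forall>J. finite J \<and> J \<subseteq> I \<longrightarrow> expectation (\<lambda>\<omega>. (\<Sum>i\<in>J. Y i \<omega>) powr p)
           \<le> (\<Sum>i\<in>J. expectation (Y i)) powr p + \<epsilon> * real (card J) powr p + C"
    if "p \<le> real (Suc k)" "0 < p" "p \<le> q" "0 < \<epsilon>" for k p \<epsilon>
    using that
  proof (induction k arbitrary: p \<epsilon>)
    case 0
    have "expectation (\<lambda>\<omega>. (\<Sum>i\<in>J. Y i \<omega>) powr p)
           \<le> (\<Sum>i\<in>J. expectation (Y i)) powr p + \<epsilon> * real (card J) powr p" if "finite J" "J \<subseteq> I" for J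
    proof -
      have "integrable M (\<lambda>\<omega>. \<Sum>i\<in>J. Y i \<omega>)"
        using int that by auto
      then have "expectation (\<lambda>\<omega>. (\<Sum>i\<in>J. Y i \<omega>) powr p) \<le> expectation (\<lambda>\<omega>. \<Sum>i\<in>J. Y i \<omega>) powr p"
        using Y 0 by (intro expectation_powr_le_powr_expectation) (auto simp: sum_nonneg)
      also have "expectation (\<lambda>\<omega>. \<Sum>i\<in>J. Y i \<omega>) = (\<Sum>i\<in>J. expectation (Y i))"
        using int that by (intro Bochner_Integration.integral_sum) auto
      finally show ?thesis by (rule add_increasing2[rotated]) (use 0 in simp)
    qed
    then show ?case by (intro exI[of _ 0]) auto
  next
    case (Suc k)
    show ?case
    proof (cases "p \<le> 1")
      case True
      have "p \<le> real (Suc k)" using True by simp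
      then show ?thesis using Suc by blast
    next
      case False
      define s where "s = p - 1"
      have s: "0 < s" "s \<le> q" "s \<le> real (Suc k)" "s \<le> p" using False Suc.prems by (auto simp: s_def)
      \<comment> \<open>The weights of the three error terms below add up to \<open>\<epsilon>\<close>.\<close>
      define \<delta> where "\<delta> = \<epsilon> / (3 * (m powr p + 1))"
      have \<delta>: "0 < \<delta>" "\<delta> * m powr p \<le> \<epsilon> / 3"
        using Suc.prems by (auto simp: \<delta>_def field_simps add_pos_nonneg)
      define \<epsilon>' where "\<epsilon>' = \<epsilon> / (3 * ((1 + \<delta>) * m + 1))"
      have den: "0 < (1 + \<delta>) * m + 1" using \<delta> mB by (simp add: add_nonneg_pos)
      have \<epsilon>': "0 < \<epsilon>'" using Suc.prems den by (simp add: \<epsilon>'_def)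
      have "(1 + \<delta>) * m * \<epsilon>' = \<epsilon> / 3 * ((1 + \<delta>) * m / ((1 + \<delta>) * m + 1))"
        by (simp add: \<epsilon>'_def)
      also have "\<dots> \<le> \<epsilon> / 3"
        using den Suc.prems \<delta> mB by (intro mult_left_le) (auto simp: divide_le_eq_1)
      finally have \<epsilon>'2: "(1 + \<delta>) * m * \<epsilon>' \<le> \<epsilon> / 3" .
      obtain C1 where C1: "0 \<le> C1" and IH: "\<And>J. finite J \<Longrightarrow> J \<subseteq> I \<Longrightarrow> expectation (\<lambda>\<omega>. (\<Sum>i\<in>J. Y i \<omega>) powr s)
           \<le> (\<Sum>i\<in>J. expectation (Y i)) powr s + \<epsilon>' * real (card J) powr s + C1"
        using Suc.IH[OF s(3,1,2) \<epsilon>'] by blast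
      obtain C2 where C2: "0 \<le> C2" "\<And>a b. 0 \<le> a \<Longrightarrow> 0 \<le> b \<Longrightarrow>
          (a + b) powr s \<le> (1 + \<delta>) * a powr s + C2 * b powr s"
        using powr_add_le[OF less_imp_le[OF s(1)] \<delta>(1)] by blast
      define L where "L = (1 + \<delta>) * m * C1 + C2 * (1 + B)"
      have L: "0 \<le> L" using \<delta> mB C1 C2 by (simp add: L_def)
      obtain C3 where C3: "0 \<le> C3" "\<And>t. 0 \<le> t \<Longrightarrow> t \<le> \<epsilon> / 3 / (L + 1) * t powr p + C3"
      proof -
        have "1 < p" "0 < \<epsilon> / 3 / (L + 1)" using False Suc.prems L by auto
        then show ?thesis using linear_le_powr that by blast
      qed
      have "expectation (\<lambda>\<omega>. (\<Sum>i\<in>J. Y i \<omega>) powr p)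
           \<le> (\<Sum>i\<in>J. expectation (Y i)) powr p + \<epsilon> * real (card J) powr p + L * C3"
        if J: "finite J" "J \<subseteq> I" for J
      proof -
        let ?S = "\<lambda>\<omega>. \<Sum>i\<in>J. Y i \<omega>" and ?\<mu> = "\<Sum>i\<in>J. expectation (Y i)" and ?N = "real (card J)"
        let ?R = "\<lambda>i \<omega>. \<Sum>j\<in>J - {i}. Y j \<omega>"
        have intp: "integrable M (\<lambda>\<omega>. Y i \<omega> powr t)" "expectation (\<lambda>\<omega>. Y i \<omega> powr t) \<le> 1 + B"
          if "i \<in> I" "0 \<le> t" "t \<le> q" for i t
          using integrable_powr_le[of "Y i" q t] Y rv int B[of i] that by force+
        have int_sum: "integrable M (\<lambda>\<omega>. (\<Sum>i\<in>A. Y i \<omega>) powr s)" if "A \<subseteq> J" for A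
          using that J s by (intro integrable_sum_powr Y rv intp(1)) (auto intro: finite_subset)
        have int_S: "integrable M (\<lambda>\<omega>. ?S \<omega> powr p)"
          using J Suc.prems by (intro integrable_sum_powr Y rv intp(1)) (auto intro: finite_subset)
        have prod: "integrable M (\<lambda>\<omega>. Y i \<omega> * ?R i \<omega> powr s)"
            "expectation (\<lambda>\<omega>. Y i \<omega> * ?R i \<omega> powr s) = expectation (Y i) * expectation (\<lambda>\<omega>. ?R i \<omega> powr s)"
          if i: "i \<in> J" for i
        proof -
          have "indep_vars (\<lambda>_. borel) Y (insert i (J - {i}))"
            using J i by (intro indep_vars_subset[OF indep]) auto
          then have "indep_var borel (Y i) borel (?R i)"
            using J by (intro indep_vars_sum) auto
          then have "indep_var borel ((\<lambda>x. x) \<circ> Y i) borel ((\<lambda>x. x powr s) \<circ> ?R i)"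
            by (rule indep_var_compose) auto
          then have ind: "indep_var borel (Y i) borel (\<lambda>\<omega>. ?R i \<omega> powr s)"
            by (simp add: comp_def)
          show "integrable M (\<lambda>\<omega>. Y i \<omega> * ?R i \<omega> powr s)"
            using i J by (intro indep_var_integrable[OF ind] int_sum int(1)) auto
          show "expectation (\<lambda>\<omega>. Y i \<omega> * ?R i \<omega> powr s) = expectation (Y i) * expectation (\<lambda>\<omega>. ?R i \<omega> powr s)"
            using i J by (intro indep_var_lebesgue_integral[OF ind] int_sum int(1)) auto
        qed
        have EY: "0 \<le> expectation (Y i)" for i using Y by (simp add: integral_nonneg_AE)
        have mean: "0 \<le> ?\<mu>" "?\<mu> \<le> m * ?N"
          using EY m J sum_bounded_above[of J "\<lambda>i. expectation (Y i)" m]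
          by (auto simp: sum_nonneg mult.commute)
        let ?g = "\<lambda>i \<omega>. (1 + \<delta>) * (Y i \<omega> * ?R i \<omega> powr s) + C2 * Y i \<omega> powr p"
        have pointwise: "?S \<omega> powr p \<le> (\<Sum>i\<in>J. ?g i \<omega>)" for \<omega>
        proof -
          have S_pos: "0 \<le> ?S \<omega>" using Y by (simp add: sum_nonneg)
          have "?S \<omega> powr p = ?S \<omega> * ?S \<omega> powr s"
            using S_pos by (simp add: s_def powr_mult_base)
          also have "\<dots> = (\<Sum>i\<in>J. Y i \<omega> * (?R i \<omega> + Y i \<omega>) powr s)"
            unfolding sum_distrib_right
          proof (intro sum.cong refl)
            fix i assume "i \<in> J"
            then show "Y i \<omega> * ?S \<omega> powr s = Y i \<omega> * (?R i \<omega> + Y i \<omega>) powr s"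
              using J by (simp add: sum.remove[of J i] add.commute)
          qed
          also have "\<dots> \<le> (\<Sum>i\<in>J. Y i \<omega> * ((1 + \<delta>) * ?R i \<omega> powr s + C2 * Y i \<omega> powr s))"
            using Y by (intro sum_mono mult_left_mono C2(2)) (auto simp: sum_nonneg)
          also have "\<dots> = (\<Sum>i\<in>J. ?g i \<omega>)"
            using Y powr_mult_base[of "Y i \<omega>" s for i]
            by (intro sum.cong refl) (simp add: s_def algebra_simps)
          finally show ?thesis .
        qed
        have int_g: "integrable M (?g i)" if "i \<in> J" for i
          using prod(1)[OF that] intp(1)[of i p] that J Suc.prems by auto
        have "expectation (\<lambda>\<omega>. ?S \<omega> powr p) \<le> expectation (\<lambda>\<omega>. \<Sum>i\<in>J. ?g i \<omega>)"
          by (intro integral_mono int_S Bochner_Integration.integrable_sum int_g pointwise)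
        also have "\<dots> = (\<Sum>i\<in>J. expectation (?g i))"
          by (intro Bochner_Integration.integral_sum int_g)
        also have "\<dots> \<le> (\<Sum>i\<in>J. (1 + \<delta>) * (expectation (Y i) * expectation (\<lambda>\<omega>. ?S \<omega> powr s)) + C2 * (1 + B))"
        proof (intro sum_mono)
          fix i assume i: "i \<in> J"
          have "expectation (?g i) = (1 + \<delta>) * (expectation (Y i) * expectation (\<lambda>\<omega>. ?R i \<omega> powr s))
              + C2 * expectation (\<lambda>\<omega>. Y i \<omega> powr p)"
            using prod[OF i] intp(1)[of i p] i J Suc.prems by auto
          moreover have "expectation (\<lambda>\<omega>. ?R i \<omega> powr s) \<le> expectation (\<lambda>\<omega>. ?S \<omega> powr s)"
            using J Y s by (intro integral_mono int_sum powr_mono2 sum_mono2) (auto simp: sum_nonneg)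
          moreover have "expectation (\<lambda>\<omega>. Y i \<omega> powr p) \<le> 1 + B"
            using i J Suc.prems by (intro intp(2)) auto
          ultimately show "expectation (?g i)
              \<le> (1 + \<delta>) * (expectation (Y i) * expectation (\<lambda>\<omega>. ?S \<omega> powr s)) + C2 * (1 + B)"
            using EY[of i] \<delta>(1) C2(1) by (simp only:) (intro add_mono mult_left_mono; simp)
        qed
        also have "\<dots> = (1 + \<delta>) * ?\<mu> * expectation (\<lambda>\<omega>. ?S \<omega> powr s) + C2 * (1 + B) * ?N"
          by (simp add: sum.distrib sum_distrib_left sum_distrib_right mult_ac)
        also have "\<dots> \<le> (1 + \<delta>) * ?\<mu> * (?\<mu> powr s + \<epsilon>' * ?N powr s + C1) + C2 * (1 + B) * ?N"
          using IH[OF J] \<delta> mean by (intro add_mono order_refl mult_left_mono) auto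
        also have "\<dots> = ?\<mu> powr p + \<delta> * ?\<mu> powr p + (1 + \<delta>) * ?\<mu> * (\<epsilon>' * ?N powr s) + ((1 + \<delta>) * ?\<mu> * C1 + C2 * (1 + B) * ?N)"
          using powr_mult_base[OF mean(1), of s] by (simp add: s_def algebra_simps)
        also have "\<dots> \<le> ?\<mu> powr p + \<epsilon> / 3 * ?N powr p + \<epsilon> / 3 * ?N powr p + L * ?N"
        proof (intro add_mono order_refl)
          have "\<delta> * ?\<mu> powr p \<le> \<delta> * (m * ?N) powr p"
            using mean \<delta> Suc.prems by (intro mult_left_mono powr_mono2) auto
          also have "\<dots> = \<delta> * m powr p * ?N powr p" using mB by (simp add: powr_mult)
          also have "\<dots> \<le> \<epsilon> / 3 * ?N powr p" using \<delta> by (intro mult_right_mono) auto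
          finally show "\<delta> * ?\<mu> powr p \<le> \<epsilon> / 3 * ?N powr p" .
          have "(1 + \<delta>) * ?\<mu> * (\<epsilon>' * ?N powr s) \<le> (1 + \<delta>) * (m * ?N) * (\<epsilon>' * ?N powr s)"
            using mean \<delta> \<epsilon>' by (intro mult_right_mono mult_left_mono) auto
          also have "\<dots> = (1 + \<delta>) * m * \<epsilon>' * ?N powr p"
            using powr_mult_base[of ?N s] by (simp add: s_def mult_ac)
          also have "\<dots> \<le> \<epsilon> / 3 * ?N powr p" using \<epsilon>'2 by (intro mult_right_mono) auto
          finally show "(1 + \<delta>) * ?\<mu> * (\<epsilon>' * ?N powr s) \<le> \<epsilon> / 3 * ?N powr p" .
          have "(1 + \<delta>) * ?\<mu> * C1 \<le> (1 + \<delta>) * (m * ?N) * C1"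
            using mean \<delta> C1 by (intro mult_right_mono mult_left_mono) auto
          then show "(1 + \<delta>) * ?\<mu> * C1 + C2 * (1 + B) * ?N \<le> L * ?N"
            by (simp add: L_def algebra_simps)
        qed
        also have "L * ?N \<le> L * (\<epsilon> / 3 / (L + 1) * ?N powr p + C3)"
          using L C3(2)[of ?N] by (intro mult_left_mono) auto
        also have "\<dots> = L / (L + 1) * (\<epsilon> / 3 * ?N powr p) + L * C3"
          by (simp add: algebra_simps)
        also have "L / (L + 1) * (\<epsilon> / 3 * ?N powr p) \<le> \<epsilon> / 3 * ?N powr p"
          using L Suc.prems by (intro mult_left_le_one_le) (auto simp: divide_le_eq_1)
        finally show ?thesis by (simp add: algebra_simps)
      qed
      then show ?thesis using L C3 by (intro exI[of _ "L * C3"]) auto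
    qed
  qed
  moreover have "p \<le> real (Suc (nat \<lceil>p\<rceil>))" by linarith
  ultimately show ?thesis using p \<epsilon> by blast
qed

end

section \<open>Perron eigenvectors of primitive nonnegative matrices\<close>

definition matpow :: "real ^ 'd ^ 'd::finite \<Rightarrow> nat \<Rightarrow> real ^ 'd ^ 'd" where
  "matpow M n = ((\<lambda>A. M ** A) ^^ n) (mat 1)"

lemma matpow_0_right: "M *v v = 0 \<Longrightarrow> 0 < n \<Longrightarrow> matpow M n *v v = 0"
proof (induction n)
  case (Suc n)
  have "matpow M (Suc n) *v v = M *v (matpow M n *v v)"
    by (simp add: matpow_def matrix_vector_mul_assoc)
  also have "\<dots> = 0"
    using Suc by (cases n) (simp_all add: matpow_def)
  finally show ?case .
qed simp

lemma matpow_eigenvector: "M *v v = \<sigma> *s v \<Longrightarrow> matpow M n *v v = \<sigma> ^ n *s v"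
proof (induction n)
  case 0
  then show ?case by (simp add: matpow_def)
next
  case (Suc n)
  have "matpow M (Suc n) *v v = M *v (matpow M n *v v)"
    by (simp add: matpow_def matrix_vector_mul_assoc)
  also have "\<dots> = \<sigma> ^ n *s (M *v v)"
    using Suc by (simp add: vector_scalar_commute)
  finally show ?case using Suc by (simp add: vector_smult_assoc mult.commute)
qed

lemma matrix_vector_positive:
  fixes A :: "real ^ 'd ^ 'e::finite"
  assumes A: "\<And>k i. 0 < A $ k $ i" and v: "\<And>i. 0 \<le> v $ i" "v \<noteq> 0"
  shows "0 < (A *v v) $ k"
proof -
  obtain i where "v $ i \<noteq> 0" using v(2) by (auto simp: vec_eq_iff)
  then have i: "0 < v $ i" using v(1)[of i] by simp
  have "0 < A $ k $ i * v $ i" using A i by simp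
  also have "\<dots> \<le> (\<Sum>i\<in>UNIV. A $ k $ i * v $ i)"
    using A v(1) by (intro member_le_sum) (auto simp: less_imp_le)
  finally show ?thesis by (simp add: matrix_vector_mult_def)
qed

text \<open>Brouwer's theorem on the simplex gives a nonnegative eigenvector; a positive power of \<open>M\<close>
  makes it positive.\<close>

theorem perron_eigenvector_exists:
  fixes M :: "real ^ 'd ^ 'd::finite"
  assumes nonneg: "\<And>k i. 0 \<le> M $ k $ i" and prim: "primitive_matrix M"
  shows "\<exists>a \<sigma>. 0 < \<sigma> \<and> (\<forall>i. 0 < a $ i) \<and> M *v a = \<sigma> *s a"
proof -
  obtain n where n: "1 \<le> n" and pos: "\<And>k i. 0 < matpow M n $ k $ i"
    using prim by (auto simp: primitive_matrix_def matpow_def)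
  define \<Delta> where "\<Delta> = {v :: real ^ 'd. (\<forall>i. 0 \<le> v $ i) \<and> (\<Sum>i\<in>UNIV. v $ i) = 1}"
  have compact: "compact \<Delta>"
  proof -
    have "bounded \<Delta>"
    proof (rule boundedI)
      fix v assume v: "v \<in> \<Delta>"
      have "norm v \<le> (\<Sum>i\<in>UNIV. \<bar>v $ i\<bar>)" by (rule norm_le_l1_cart)
      also have "\<dots> = 1" using v by (simp add: \<Delta>_def)
      finally show "norm v \<le> 1" .
    qed
    moreover have "closed \<Delta>"
      unfolding \<Delta>_def by (intro closed_Collect_conj closed_Collect_all closed_Collect_le closed_Collect_eq
          continuous_intros)
    ultimately show ?thesis by (simp add: compact_eq_bounded_closed)
  qed
  have convex: "convex \<Delta>"
    unfolding convex_def \<Delta>_def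
    by (auto simp: sum.distrib sum_distrib_left[symmetric])
  have nonempty: "axis undefined 1 \<in> \<Delta>"
    by (auto simp: \<Delta>_def axis_def)
  define s where "s v = (\<Sum>i\<in>UNIV. (M *v v) $ i)" for v
  define f where "f v = (1 / s v) *\<^sub>R (M *v v)" for v
  have Mv: "0 \<le> (M *v v) $ i" if "v \<in> \<Delta>" for v i
    using that nonneg by (auto simp: \<Delta>_def matrix_vector_mult_def intro!: sum_nonneg)
  have nz: "v \<noteq> 0" if "v \<in> \<Delta>" for v
    using that by (auto simp: \<Delta>_def)
  have s_pos: "0 < s v" if v: "v \<in> \<Delta>" for v
  proof -
    have "M *v v \<noteq> 0"
    proof
      assume "M *v v = 0"
      then have "matpow M n *v v = 0" using n by (intro matpow_0_right) auto
      moreover have "0 < (matpow M n *v v) $ undefined"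
        using v nz by (intro matrix_vector_positive pos) (auto simp: \<Delta>_def)
      ultimately show False by simp
    qed
    then obtain i where "(M *v v) $ i \<noteq> 0" by (auto simp: vec_eq_iff)
    then have "s v \<noteq> 0" unfolding s_def using Mv[OF v] by (subst sum_nonneg_eq_0_iff) auto
    moreover have "0 \<le> s v" unfolding s_def using Mv[OF v] by (intro sum_nonneg) auto
    ultimately show ?thesis by simp
  qed
  have "continuous_on \<Delta> f"
    unfolding f_def s_def using s_pos[unfolded s_def]
    by (intro continuous_intros matrix_vector_mult_linear_continuous_on) force+
  moreover have "f \<in> \<Delta> \<rightarrow> \<Delta>"
  proof
    fix v assume v: "v \<in> \<Delta>"
    have "(\<Sum>i\<in>UNIV. f v $ i) = (\<Sum>i\<in>UNIV. (M *v v) $ i) / s v"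
      by (simp add: f_def sum_divide_distrib)
    then have "(\<Sum>i\<in>UNIV. f v $ i) = 1" using s_pos[OF v] by (simp add: s_def)
    then show "f v \<in> \<Delta>" using s_pos[OF v] Mv[OF v] by (simp add: \<Delta>_def f_def)
  qed
  ultimately obtain a where a: "a \<in> \<Delta>" "f a = a"
    using brouwer[OF compact convex] nonempty by blast
  have "M *v a = s a *\<^sub>R f a" using s_pos[OF a(1)] by (simp add: f_def)
  then have eig: "M *v a = s a *s a" using a(2) by (simp add: scalar_mult_eq_scaleR)
  have "0 < a $ i" for i
  proof -
    have "0 < (matpow M n *v a) $ i"
      using a nz by (intro matrix_vector_positive pos) (auto simp: \<Delta>_def)
    then have "0 < s a ^ n * a $ i" by (simp add: matpow_eigenvector[OF eig])
    then show ?thesis using s_pos[OF a(1)] by (simp add: zero_less_mult_iff)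
  qed
  then show ?thesis using eig s_pos[OF a(1)] by blast
qed

text \<open>Measured by the largest quotient \<open>cmod (v $ i) / a $ i\<close>, a complex vector grows by the factor
  \<open>\<sigma>\<close> at most.\<close>

lemma spectral_radius_eq:
  fixes M :: "real ^ 'd ^ 'd::finite"
  assumes nonneg: "\<And>k i. 0 \<le> M $ k $ i" and a: "\<And>i. 0 < a $ i" and eig: "M *v a = \<sigma> *s a"
  shows "spectral_radius M = \<sigma>"
proof -
  have row: "(\<Sum>j\<in>UNIV. M $ i $ j * a $ j) = \<sigma> * a $ i" for i
    using arg_cong[OF eig, of "\<lambda>v. v $ i"] by (simp add: matrix_vector_mult_def)
  have "0 \<le> \<sigma> * a $ undefined"
    unfolding row[symmetric] using nonneg a by (intro sum_nonneg) (simp add: less_imp_le)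
  then have \<sigma>: "0 \<le> \<sigma>" using a[of undefined] by (simp add: zero_le_mult_iff)
  have crow: "(map_matrix complex_of_real M *v v) $ i = (\<Sum>j\<in>UNIV. complex_of_real (M $ i $ j) * v $ j)" for v i
    by (simp add: matrix_vector_mult_def map_matrix_def)
  have upper: "cmod l \<le> \<sigma>" if v: "v \<noteq> 0" and l: "map_matrix complex_of_real M *v v = l *s v" for l v
  proof -
    define c where "c = Max (range (\<lambda>i. cmod (v $ i) / a $ i))"
    have c_le: "cmod (v $ i) \<le> c * a $ i" for i
    proof -
      have "cmod (v $ i) / a $ i \<le> c" unfolding c_def by (intro Max_ge) auto
      then show ?thesis using a[of i] by (simp add: field_simps)
    qed
    have "c \<in> range (\<lambda>i. cmod (v $ i) / a $ i)" unfolding c_def by (intro Max_in) auto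
    then obtain i where i: "c = cmod (v $ i) / a $ i" by blast
    then have ci: "cmod (v $ i) = c * a $ i" using a[of i] by (simp add: field_simps)
    obtain j where j: "v $ j \<noteq> 0" using v by (auto simp: vec_eq_iff)
    have "0 < c"
    proof -
      have "0 < cmod (v $ j)" using j by simp
      then have "0 < c * a $ j" using c_le[of j] by linarith
      then show ?thesis using a[of j] by (simp add: zero_less_mult_iff)
    qed
    then have pos: "0 < c * a $ i" using a[of i] by simp
    have "cmod l * (c * a $ i) = cmod ((map_matrix complex_of_real M *v v) $ i)"
      using l ci by (simp add: norm_mult)
    also have "\<dots> \<le> (\<Sum>j\<in>UNIV. cmod (complex_of_real (M $ i $ j) * v $ j))"
      unfolding crow by (rule norm_sum)
    also have "\<dots> \<le> (\<Sum>j\<in>UNIV. M $ i $ j * (c * a $ j))"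
      using nonneg c_le by (intro sum_mono) (auto simp: norm_mult intro!: mult_left_mono)
    also have "\<dots> = c * (\<Sum>j\<in>UNIV. M $ i $ j * a $ j)"
      by (simp add: sum_distrib_left mult_ac)
    also have "\<dots> = \<sigma> * (c * a $ i)" by (simp add: row)
    finally show ?thesis by (simp only: mult_le_cancel_right_pos[OF pos])
  qed
  let ?v = "\<chi> i. complex_of_real (a $ i)"
  have "?v \<noteq> 0" using less_imp_neq[OF a[of undefined]] by (auto simp: vec_eq_iff intro!: exI[of _ undefined])
  moreover have "map_matrix complex_of_real M *v ?v = complex_of_real \<sigma> *s ?v"
    unfolding vec_eq_iff crow by (simp add: of_real_mult[symmetric] of_real_sum[symmetric] row del: of_real_mult of_real_sum)
  moreover have "\<sigma> = cmod (complex_of_real \<sigma>)" using \<sigma> by simp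
  ultimately have "\<sigma> \<in> {cmod l | l. \<exists>v. v \<noteq> 0 \<and> map_matrix complex_of_real M *v v = l *s v}" by blast
  then show ?thesis
    unfolding spectral_radius_def by (rule cSup_eq_maximum) (use upper in blast)
qed

lemma perron_weights_nonempty_pos:
  fixes M :: "real ^ 'd ^ 'd::finite"
  assumes nonneg: "\<And>k i. 0 \<le> M $ k $ i" and prim: "primitive_matrix M"
  shows "perron_weights M \<noteq> {}" "0 < spectral_radius M"
proof -
  obtain a \<sigma> where \<sigma>: "0 < \<sigma>" and a: "\<And>i. 0 < a $ i" and eig: "M *v a = \<sigma> *s a"
    using perron_eigenvector_exists[OF nonneg prim] by blast
  have rho: "spectral_radius M = \<sigma>" by (rule spectral_radius_eq[OF nonneg a eig])
  then show "0 < spectral_radius M" using \<sigma> by simp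
  define t where "t = Min (range (\<lambda>i. a $ i))"
  have t: "0 < t" "t \<le> a $ i" for i
    unfolding t_def using a by (auto intro!: Min_le)
  have "(1 / t) *s a \<in> perron_weights M"
    using t eig rho by (auto simp: perron_weights_def vector_scalar_commute vector_smult_assoc)
  then show "perron_weights M \<noteq> {}" by blast
qed

section \<open>The law of a Galton-Watson process\<close>

lemma measurable_sum_count_space:
  fixes f :: "'i \<Rightarrow> 'a \<Rightarrow> 'b::{countable, comm_monoid_add}"
  assumes "\<And>i. i \<in> J \<Longrightarrow> f i \<in> measurable M (count_space UNIV)"
  shows "(\<lambda>\<omega>. \<Sum>i\<in>J. f i \<omega>) \<in> measurable M (count_space UNIV)"
  using assms
proof (induction J rule: infinite_finite_induct)
  case (insert i J)
  have "(\<lambda>\<omega>. f i \<omega> + (\<Sum>j\<in>J. f j \<omega>)) \<in> measurable M (count_space UNIV)"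
  proof (rule measurable_compose_countable[of "\<lambda>u \<omega>. u + (\<Sum>j\<in>J. f j \<omega>)"])
    show "(\<lambda>\<omega>. u + (\<Sum>j\<in>J. f j \<omega>)) \<in> measurable M (count_space UNIV)" for u
      using insert by (intro measurable_compose[of _ M _ "(+) u"]) auto
  qed (use insert in auto)
  with insert show ?case by simp
qed auto

text \<open>The next generation as a function of a fixed current population \<open>z\<close>; the random population is
  inserted later, so that independence can be used for each value of \<open>z\<close>.\<close>

definition generation :: "('a, 'd::finite) offspring \<Rightarrow> nat \<Rightarrow> 'd state \<Rightarrow> 'a \<Rightarrow> 'd state" where
  "generation \<zeta> n z \<omega> = (\<Sum>k\<in>UNIV. \<Sum>l<z $ k. \<zeta> n l k \<omega>)"

lemma gw_Suc: "gw \<zeta> x (Suc n) \<omega> = generation \<zeta> n (gw \<zeta> x n \<omega>) \<omega>"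
  by (simp add: generation_def)

lemma generation_measurable:
  assumes "\<And>l k. \<zeta> n l k \<in> measurable M (count_space UNIV)"
  shows "generation \<zeta> n z \<in> measurable M (count_space UNIV)"
  unfolding generation_def[abs_def] by (intro measurable_sum_count_space assms)

lemma gw_measurable:
  assumes "\<And>m l k. m < n \<Longrightarrow> \<zeta> m l k \<in> measurable M (count_space UNIV)"
  shows "gw \<zeta> x n \<in> measurable M (count_space UNIV)"
  using assms
proof (induction n)
  case 0
  have "gw \<zeta> x 0 = (\<lambda>\<omega>. x)" by (rule ext) (rule gw.simps)
  then show ?case by simp
next
  case (Suc n)
  have "(\<lambda>\<omega>. generation \<zeta> n (gw \<zeta> x n \<omega>) \<omega>) \<in> measurable M (count_space UNIV)"
  proof (rule measurable_compose_countable[where f = "generation \<zeta> n" and g = "gw \<zeta> x n"])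
    show "generation \<zeta> n z \<in> measurable M (count_space UNIV)" for z
      by (rule generation_measurable) (rule Suc.prems, simp)
    show "gw \<zeta> x n \<in> measurable M (count_space UNIV)"
      by (rule Suc.IH) (rule Suc.prems, simp)
  qed
  moreover have "gw \<zeta> x (Suc n) = (\<lambda>\<omega>. generation \<zeta> n (gw \<zeta> x n \<omega>) \<omega>)"
    by (rule ext) (rule gw_Suc)
  ultimately show ?case by (simp only:)
qed

lemma gw_cong:
  assumes "\<And>m l k. m < n \<Longrightarrow> \<zeta> m l k \<omega> = \<xi> m l k \<omega>'"
  shows "gw \<zeta> x n \<omega> = gw \<xi> x n \<omega>'"
  using assms by (induction n) auto

lemma gw_zero: "gw \<zeta> x n \<omega> = 0 \<Longrightarrow> gw \<zeta> x (n + m) \<omega> = 0"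
  by (induction m) auto

lemma alive_iff: "enat n < extinction_time \<zeta> x \<omega> \<longleftrightarrow> gw \<zeta> x n \<omega> \<noteq> 0"
proof
  assume *: "enat n < extinction_time \<zeta> x \<omega>"
  show "gw \<zeta> x n \<omega> \<noteq> 0"
  proof
    assume "gw \<zeta> x n \<omega> = 0"
    then have "extinction_time \<zeta> x \<omega> \<le> enat n"
      unfolding extinction_time_def by (intro INF_lower) simp
    with * show False by simp
  qed
next
  assume alive: "gw \<zeta> x n \<omega> \<noteq> 0"
  have "enat (Suc n) \<le> extinction_time \<zeta> x \<omega>"
    unfolding extinction_time_def
  proof (rule INF_greatest)
    fix m assume "m \<in> {n. gw \<zeta> x n \<omega> = 0}"
    then have "\<not> m \<le> n"
      using alive gw_zero[of \<zeta> x m \<omega> "n - m"] by auto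
    then show "enat (Suc n) \<le> enat m" by simp
  qed
  then show "enat n < extinction_time \<zeta> x \<omega>"
    by (rule less_le_trans[rotated]) simp
qed

text \<open>A law on a countable type gives no mass to the set of all points of mass zero.\<close>

lemma measure_Abs_pmf_distr:
  fixes X :: "'a \<Rightarrow> 'b::countable"
  assumes "prob_space M" and X: "X \<in> measurable M (count_space UNIV)"
  shows "measure_pmf (Abs_pmf (distr M (count_space UNIV) X)) = distr M (count_space UNIV) X"
proof -
  let ?D = "distr M (count_space UNIV) X"
  interpret D: prob_space ?D using assms by (simp add: prob_space.prob_space_distr)
  have "(\<Union>x\<in>{x. measure ?D {x} = 0}. {x}) \<in> null_sets ?D"
    by (intro null_sets_UN') (auto simp: null_sets_def D.emeasure_eq_measure)
  then have "{x. measure ?D {x} = 0} \<in> null_sets ?D" by simp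
  then have "AE x in ?D. measure ?D {x} \<noteq> 0"
    by (rule AE_I') auto
  then show ?thesis
    using D.prob_space_axioms by (intro Abs_pmf_inverse) auto
qed

context galton_watson
begin

lemma \<zeta>_measurable [measurable]: "\<zeta> n l k \<in> measurable \<Omega> (count_space UNIV)"
  using indep unfolding indep_vars_def by auto

lemma gw_rv [measurable]: "gw \<zeta> x n \<in> measurable \<Omega> (count_space UNIV)"
  by (intro gw_measurable) measurable

lemma generation_rv [measurable]: "generation \<zeta> n z \<in> measurable \<Omega> (count_space UNIV)"
  by (intro generation_measurable) measurable

text \<open>The offspring of generation \<open>n\<close> is determined by variables that are independent of those of
  the earlier generations, of which \<open>gw \<zeta> x n\<close> is a function.\<close>

lemma gw_generation_indep:
  "indep_var (count_space UNIV) (gw \<zeta> x n) (count_space UNIV) (generation \<zeta> n z)"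
proof -
  let ?X = "\<lambda>i \<omega>. (\<lambda>(n, l, k). \<zeta> n l k) i \<omega>"
  let ?A = "{(m, l, k :: 'd). m < n}" and ?B = "{(m, l, k :: 'd). m = n}"
  let ?c = "\<lambda>m l k f. f (m, l, k) :: nat ^ 'd"
  let ?P = "\<lambda>A. PiM A (\<lambda>_ :: nat \<times> nat \<times> 'd. count_space (UNIV :: (nat ^ 'd) set))"
  have coord: "(\<lambda>f. f i) \<in> measurable (?P I) (count_space UNIV)" if "i \<in> I" for I i
    using that by (rule measurable_component_singleton)
  have "indep_var (?P ?A) (\<lambda>\<omega>. restrict (\<lambda>i. ?X i \<omega>) ?A) (?P ?B) (\<lambda>\<omega>. restrict (\<lambda>i. ?X i \<omega>) ?B)"
    by (rule indep_var_restrict[OF indep]) auto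
  moreover have "gw ?c x n \<in> measurable (?P ?A) (count_space UNIV)"
    by (intro gw_measurable coord) auto
  moreover have "generation ?c n z \<in> measurable (?P ?B) (count_space UNIV)"
    by (intro generation_measurable coord) auto
  ultimately have "indep_var (count_space UNIV) (gw ?c x n \<circ> (\<lambda>\<omega>. restrict (\<lambda>i. ?X i \<omega>) ?A))
      (count_space UNIV) (generation ?c n z \<circ> (\<lambda>\<omega>. restrict (\<lambda>i. ?X i \<omega>) ?B))"
    by (rule indep_var_compose)
  moreover have "gw ?c x n \<circ> (\<lambda>\<omega>. restrict (\<lambda>i. ?X i \<omega>) ?A) = gw \<zeta> x n"
    by (auto simp: fun_eq_iff intro!: gw_cong)
  moreover have "generation ?c n z \<circ> (\<lambda>\<omega>. restrict (\<lambda>i. ?X i \<omega>) ?B) = generation \<zeta> n z"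
    by (auto simp: fun_eq_iff generation_def)
  ultimately show ?thesis by simp
qed

text \<open>The joint law of the offspring vectors of one generation is a product that does not depend on
  the generation.\<close>

lemma generation_law_eq:
  "distr \<Omega> (count_space UNIV) (generation \<zeta> n z) = distr \<Omega> (count_space UNIV) (generation \<zeta> 0 z)"
proof -
  let ?N = "count_space UNIV :: (nat ^ 'd) measure"
  let ?X = "\<lambda>i \<omega>. (\<lambda>(n, l, k). \<zeta> n l k) i \<omega>"
  let ?K = "PiM (UNIV :: (nat \<times> 'd) set) (\<lambda>_. ?N)"
  define law where "law k = distr \<Omega> ?N (\<zeta> 0 0 k)" for k
  have law: "distr \<Omega> ?N (\<zeta> n l k) = law k" for n l k
    unfolding law_def by (rule ident)
  have prob_law: "prob_space (law k)" for k
    unfolding law_def by (rule prob_space_distr) measurable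
  have sets_law: "sets (law k) = UNIV" for k by (simp add: law_def)
  let ?L = "PiM (UNIV :: (nat \<times> nat \<times> 'd) set) (\<lambda>(n, l, k). law k)"
  let ?G = "PiM (UNIV :: (nat \<times> 'd) set) (\<lambda>(l, k). law k)"
  have rvX: "?X i \<in> measurable \<Omega> ?N" for i by (cases i) simp
  have "distr \<Omega> (PiM UNIV (\<lambda>_. ?N)) (\<lambda>\<omega>. \<lambda>i\<in>UNIV. ?X i \<omega>) = PiM UNIV (\<lambda>i. distr \<Omega> ?N (?X i))"
    using indep rvX by (subst indep_vars_iff_distr_eq_PiM[symmetric]) (auto simp: case_prod_beta')
  also have "\<dots> = ?L"
    by (intro PiM_cong refl) (auto simp: law)
  finally have joint: "distr \<Omega> (PiM UNIV (\<lambda>_. ?N)) (\<lambda>\<omega>. \<lambda>i\<in>UNIV. ?X i \<omega>) = ?L" .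
  have rvJ: "(\<lambda>\<omega>. \<lambda>i\<in>UNIV. ?X i \<omega>) \<in> measurable \<Omega> (PiM UNIV (\<lambda>_. ?N))"
    by (intro measurable_restrict rvX)
  have gen: "distr \<Omega> ?K (\<lambda>\<omega>. \<lambda>j\<in>UNIV. \<zeta> n (fst j) (snd j) \<omega>) = ?G" for n
  proof -
    let ?f = "\<lambda>j :: nat \<times> 'd. (n, fst j, snd j)"
    have sK: "sets ?K = sets ?G"
      by (intro sets_PiM_cong) (auto simp: sets_law)
    have re: "(\<lambda>g. \<lambda>i\<in>UNIV. g (?f i)) \<in> measurable (PiM UNIV (\<lambda>_. ?N)) ?K"
      by (intro measurable_restrict measurable_component_singleton) auto
    have "?G = PiM UNIV (\<lambda>i. (\<lambda>(n, l, k). law k) (?f i))"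
      by (intro PiM_cong) auto
    also have "\<dots> = distr ?L (PiM UNIV (\<lambda>i. (\<lambda>(n, l, k). law k) (?f i))) (\<lambda>g. \<lambda>i\<in>UNIV. g (?f i))"
      using prob_law by (intro distr_PiM_reindex[symmetric]) (auto simp: inj_on_def)
    also have "\<dots> = distr ?L ?K (\<lambda>g. \<lambda>i\<in>UNIV. g (?f i))"
      using sK by (intro distr_cong) (auto simp: case_prod_beta')
    also have "\<dots> = distr \<Omega> ?K ((\<lambda>g. \<lambda>i\<in>UNIV. g (?f i)) \<circ> (\<lambda>\<omega>. \<lambda>i\<in>UNIV. ?X i \<omega>))"
      unfolding joint[symmetric] by (rule distr_distr[OF re rvJ])
    also have "(\<lambda>g. \<lambda>i\<in>UNIV. g (?f i)) \<circ> (\<lambda>\<omega>. \<lambda>i\<in>UNIV. ?X i \<omega>) = (\<lambda>\<omega>. \<lambda>j\<in>UNIV. \<zeta> n (fst j) (snd j) \<omega>)"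
      by (auto simp: fun_eq_iff)
    finally show ?thesis by (rule sym)
  qed
  let ?g = "\<lambda>f. \<Sum>k\<in>UNIV. \<Sum>l<z $ k. f (l, k) :: nat ^ 'd"
  have g: "?g \<in> measurable ?K ?N"
    by (intro measurable_sum_count_space measurable_component_singleton) auto
  have rvG: "(\<lambda>\<omega>. \<lambda>j\<in>UNIV. \<zeta> n (fst j) (snd j) \<omega>) \<in> measurable \<Omega> ?K" for n
    by (intro measurable_restrict) (auto simp: case_prod_beta')
  have "distr \<Omega> ?N (generation \<zeta> n z) = distr ?G ?N ?g" for n
    unfolding gen[of n, symmetric]
    by (subst distr_distr[OF g rvG]) (auto simp: generation_def[abs_def] comp_def)
  then show ?thesis by simp
qed

definition law :: "'d state \<Rightarrow> nat \<Rightarrow> 'd state pmf" where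
  "law x n = Abs_pmf (distr \<Omega> (count_space UNIV) (gw \<zeta> x n))"

definition step :: "'d state \<Rightarrow> 'd state pmf" where
  "step x = law x 1"

lemma measure_pmf_law: "measure_pmf (law x n) = distr \<Omega> (count_space UNIV) (gw \<zeta> x n)"
  unfolding law_def by (rule measure_Abs_pmf_distr[OF prob_space_axioms gw_rv])

lemma measure_law: "measure (law x n) A = prob {\<omega> \<in> space \<Omega>. gw \<zeta> x n \<omega> \<in> A}"
  by (simp add: measure_pmf_law measure_distr vimage_def Int_def conj_commute)

lemma pmf_law: "pmf (law x n) y = prob {\<omega> \<in> space \<Omega>. gw \<zeta> x n \<omega> = y}"
  using measure_law[of x n "{y}"] by (simp add: measure_pmf_single)

lemma nn_integral_law: "(\<integral>\<^sup>+y. f y \<partial>law x n) = (\<integral>\<^sup>+\<omega>. f (gw \<zeta> x n \<omega>) \<partial>\<Omega>)"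
  by (simp add: measure_pmf_law nn_integral_distr)

lemma emeasure_generation:
  "emeasure \<Omega> {\<omega> \<in> space \<Omega>. generation \<zeta> n z \<omega> = y} = ennreal (pmf (step z) y)"
proof -
  have "emeasure \<Omega> {\<omega> \<in> space \<Omega>. generation \<zeta> n z \<omega> = y} = emeasure (distr \<Omega> (count_space UNIV) (generation \<zeta> n z)) {y}"
    by (simp add: emeasure_distr vimage_def Int_def conj_commute)
  also have "\<dots> = emeasure (distr \<Omega> (count_space UNIV) (generation \<zeta> 0 z)) {y}"
    by (rule arg_cong[OF generation_law_eq, of "\<lambda>D. emeasure D {y}"])
  also have "\<dots> = emeasure (distr \<Omega> (count_space UNIV) (gw \<zeta> z 1)) {y}"
    by (intro arg_cong2[where f = emeasure] distr_cong refl) (simp add: generation_def)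
  also have "\<dots> = ennreal (pmf (step z) y)"
    unfolding step_def by (simp add: measure_pmf_law[symmetric] emeasure_pmf_single)
  finally show ?thesis .
qed

text \<open>The Markov property. Conditioning on the current population \<open>z\<close> leaves the law of the next generation
  unchanged by independence, and this law does not depend on the time.\<close>

lemma law_Suc: "law x (Suc n) = bind_pmf (law x n) step"
proof (rule pmf_eqI)
  fix y
  let ?E = "\<lambda>z. {\<omega> \<in> space \<Omega>. gw \<zeta> x n \<omega> = z \<and> generation \<zeta> n z \<omega> = y}"
  have E: "emeasure \<Omega> (?E z) = ennreal (pmf (law x n) z) * ennreal (pmf (step z) y)" for z
  proof -
    have "emeasure \<Omega> (?E z) = ennreal (prob ((\<lambda>\<omega>. (gw \<zeta> x n \<omega>, generation \<zeta> n z \<omega>)) -` ({z} \<times> {y}) \<inter> space \<Omega>))"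
      unfolding emeasure_eq_measure by (intro arg_cong[where f = "\<lambda>A. ennreal (prob A)"]) auto
    also have "\<dots> = ennreal (prob (gw \<zeta> x n -` {z} \<inter> space \<Omega>) * prob (generation \<zeta> n z -` {y} \<inter> space \<Omega>))"
      by (subst indep_varD[OF gw_generation_indep]) auto
    also have "\<dots> = ennreal (prob (gw \<zeta> x n -` {z} \<inter> space \<Omega>)) * emeasure \<Omega> (generation \<zeta> n z -` {y} \<inter> space \<Omega>)"
      by (simp add: ennreal_mult emeasure_eq_measure)
    also have "prob (gw \<zeta> x n -` {z} \<inter> space \<Omega>) = pmf (law x n) z"
      by (simp add: pmf_law vimage_def Int_def conj_commute)
    also have "generation \<zeta> n z -` {y} \<inter> space \<Omega> = {\<omega> \<in> space \<Omega>. generation \<zeta> n z \<omega> = y}"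
      by auto
    finally show ?thesis by (simp only: emeasure_generation)
  qed
  have "ennreal (pmf (law x (Suc n)) y) = emeasure \<Omega> {\<omega> \<in> space \<Omega>. gw \<zeta> x (Suc n) \<omega> = y}"
    by (simp only: pmf_law emeasure_eq_measure)
  also have "{\<omega> \<in> space \<Omega>. gw \<zeta> x (Suc n) \<omega> = y} = (\<Union>z\<in>UNIV. ?E z)"
    by (auto simp: gw_Suc simp del: gw.simps)
  also have "emeasure \<Omega> (\<Union>z\<in>UNIV. ?E z) = (\<integral>\<^sup>+z. emeasure \<Omega> (?E z) \<partial>count_space UNIV)"
    by (intro emeasure_UN_countable) (auto simp: disjoint_family_on_def)
  also have "\<dots> = (\<integral>\<^sup>+z. ennreal (pmf (step z) y) \<partial>law x n)"
    by (simp add: E nn_integral_measure_pmf)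
  also have "\<dots> = ennreal (pmf (bind_pmf (law x n) step) y)"
    by (rule ennreal_pmf_bind[symmetric])
  finally show "pmf (law x (Suc n)) y = pmf (bind_pmf (law x n) step) y" by simp
qed

lemma law_0: "law x 0 = return_pmf x"
proof (rule pmf_eqI)
  fix y
  show "pmf (law x 0) y = pmf (return_pmf x) y"
    by (simp add: pmf_law prob_space indicator_def)
qed

lemma law_eq_kpow: "law x n = kpow step n x"
  by (induction n) (simp_all add: law_0 law_Suc)

lemma gw_prob_eq: "gw_prob \<Omega> \<zeta> x n A = measure (kpow step n x) A"
  by (simp add: gw_prob_def law_eq_kpow[symmetric] measure_law)

lemma gw_prob_alive_eq: "gw_prob_alive \<Omega> \<zeta> x n A = measure (kpow step n x) (A \<inter> living)"
  unfolding gw_prob_alive_def law_eq_kpow[symmetric] measure_law alive_iff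
  by (intro arg_cong[where f = prob]) (auto simp: living_def)

lemma survival_eq: "survival \<Omega> \<zeta> x n = measure (kpow step n x) living"
  by (simp add: survival_def gw_prob_alive_eq)

lemma P1_eq: "P1 \<Omega> \<zeta> f x = (\<integral>\<^sup>+y. ennreal (f y) * indicator living y \<partial>step x)"
  unfolding P1_def step_def nn_integral_law
  using alive_iff[of 1 \<zeta> x]
  by (intro nn_integral_cong) (auto simp: indicator_def living_def one_enat_def)

end

section \<open>Weighted population size\<close>

lemma weighted_size_sum: "weighted_size a (\<Sum>j\<in>J. f j) = (\<Sum>j\<in>J. weighted_size a (f j))"
proof -
  have "weighted_size a (\<Sum>j\<in>J. f j) = (\<Sum>i\<in>UNIV. \<Sum>j\<in>J. a $ i * real (f j $ i))"
    by (simp add: weighted_size_def sum_distrib_left)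
  also have "\<dots> = (\<Sum>j\<in>J. weighted_size a (f j))"
    unfolding weighted_size_def by (rule sum.swap)
  finally show ?thesis .
qed

lemma total_eq_weighted_size: "real (total z) = weighted_size (\<chi> i. 1) z"
  by (simp add: total_def weighted_size_def)

lemma weighted_size_nonneg: "(\<And>i. 1 \<le> a $ i) \<Longrightarrow> 0 \<le> weighted_size a z"
  unfolding weighted_size_def by (intro sum_nonneg mult_nonneg_nonneg) (auto intro: order_trans[of 0 1])

lemma total_le_weighted_size: "(\<And>i. 1 \<le> a $ i) \<Longrightarrow> real (total z) \<le> weighted_size a z"
  unfolding weighted_size_def total_def
  using mult_right_mono[of 1 "a $ i" "real (z $ i)" for i] by (simp add: sum_mono)

lemma weighted_size_le_total:
  assumes "\<And>i. 1 \<le> a $ i"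
  shows "weighted_size a z \<le> (\<Sum>i\<in>UNIV. a $ i) * real (total z)"
proof -
  have "a $ i \<le> (\<Sum>i\<in>UNIV. a $ i)" for i
    using assms by (intro member_le_sum) (auto intro: order_trans[of 0 1])
  then have "weighted_size a z \<le> (\<Sum>i\<in>UNIV. (\<Sum>i\<in>UNIV. a $ i) * real (z $ i))"
    unfolding weighted_size_def by (intro sum_mono mult_right_mono) auto
  then show ?thesis by (simp add: total_def sum_distrib_left)
qed

lemma total_ge_1: "z \<in> living \<Longrightarrow> 1 \<le> total z"
proof -
  assume "z \<in> living"
  then obtain i where "z $ i \<noteq> 0" by (auto simp: living_def vec_eq_iff)
  then have "1 \<le> z $ i" by simp
  also have "\<dots> \<le> total z" unfolding total_def by (rule member_le_sum) auto
  finally show ?thesis .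
qed

lemma weighted_size_outside: "z \<notin> living \<Longrightarrow> weighted_size a z = 0"
  by (simp add: living_def weighted_size_def)

lemma weighted_size_ge_1: "(\<And>i. 1 \<le> a $ i) \<Longrightarrow> z \<in> living \<Longrightarrow> 1 \<le> weighted_size a z"
  using total_ge_1[of z] total_le_weighted_size[of a z] by simp

lemma finite_weighted_size_le:
  assumes "\<And>i. 1 \<le> a $ i"
  shows "finite {z :: ('d::finite) state. weighted_size a z \<le> R}"
proof -
  let ?N = "nat \<lfloor>R\<rfloor>"
  have "{z :: 'd state. weighted_size a z \<le> R} \<subseteq> vec_lambda ` (Pi\<^sub>E UNIV (\<lambda>_. {..?N}))"
  proof
    fix z :: "'d state" assume "z \<in> {z. weighted_size a z \<le> R}"
    then have *: "real (total z) \<le> R" using total_le_weighted_size[OF assms, of z] by simp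
    have "z $ i \<le> ?N" for i
    proof -
      have "z $ i \<le> total z" unfolding total_def by (rule member_le_sum) auto
      then have "real (z $ i) \<le> R" using * by linarith
      then show ?thesis by (simp add: le_nat_iff le_floor_iff)
    qed
    then have "vec_nth z \<in> Pi\<^sub>E UNIV (\<lambda>_. {..?N})" by auto
    then show "z \<in> vec_lambda ` (Pi\<^sub>E UNIV (\<lambda>_. {..?N}))"
      by (intro image_eqI[of _ _ "vec_nth z"]) auto
  qed
  then show ?thesis by (rule finite_subset) (auto intro!: finite_imageI finite_PiE)
qed

section \<open>Moments of a sub-critical Galton-Watson process\<close>

locale subcritical_galton_watson = galton_watson \<Omega> \<zeta>
  for \<Omega> :: "'a measure" and \<zeta> :: "('a, 'd::finite) offspring" +
  fixes q0 :: real
  assumes aperiodic: "gw_aperiodic \<Omega> \<zeta>" and subcritical: "gw_subcritical \<Omega> \<zeta>" and q0: "1 < q0"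
    and moment: "(\<integral>\<^sup>+ \<omega>. ennreal (real (total (gw \<zeta> (\<chi> i. 1) 1 \<omega>)) powr q0) \<partial>\<Omega>) < \<infinity>"
begin

abbreviation M :: "real ^ 'd ^ 'd" where "M \<equiv> mean_matrix \<Omega> \<zeta>"

abbreviation \<rho> :: real where "\<rho> \<equiv> spectral_radius M"

lemma M_nonneg: "0 \<le> M $ k $ i"
  by (simp add: mean_matrix_def integral_nonneg_AE)

lemma \<rho>: "0 < \<rho>" "\<rho> < 1"
  using perron_weights_nonempty_pos[OF M_nonneg primitive] subcritical by (auto simp: gw_subcritical_def)

lemma reach: "x \<in> living \<Longrightarrow> y \<in> living \<Longrightarrow> eventually (\<lambda>n. 0 < pmf (kpow step n x) y) sequentially"
  using aperiodic by (auto simp: gw_aperiodic_def gw_prob_eq measure_pmf_single)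

lemma expectation_offspring_eq:
  fixes f :: "'d state \<Rightarrow> real"
  shows "expectation (\<lambda>\<omega>. f (\<zeta> n l k \<omega>)) = expectation (\<lambda>\<omega>. f (\<zeta> 0 0 k \<omega>))"
proof -
  have "expectation (\<lambda>\<omega>. f (\<zeta> n l k \<omega>)) = integral\<^sup>L (distr \<Omega> (count_space UNIV) (\<zeta> n l k)) f" for n l
    by (simp add: integral_distr)
  then show ?thesis by (metis ident)
qed

lemma integrable_offspring_iff:
  fixes f :: "'d state \<Rightarrow> real"
  shows "integrable \<Omega> (\<lambda>\<omega>. f (\<zeta> n l k \<omega>)) \<longleftrightarrow> integrable \<Omega> (\<lambda>\<omega>. f (\<zeta> 0 0 k \<omega>))"
proof -
  have "integrable \<Omega> (\<lambda>\<omega>. f (\<zeta> n l k \<omega>)) \<longleftrightarrow> integrable (distr \<Omega> (count_space UNIV) (\<zeta> n l k)) f" for n l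
    by (simp add: integrable_distr_eq)
  then show ?thesis by (metis ident)
qed

context
  fixes a :: "real ^ 'd"
  assumes a: "a \<in> perron_weights M"
begin

lemma a_ge_1: "1 \<le> a $ i"
  using a by (simp add: perron_weights_def)

lemma a_eigen: "(\<Sum>i\<in>UNIV. M $ k $ i * a $ i) = \<rho> * a $ k"
proof -
  have "M *v a = \<rho> *s a" using a by (simp add: perron_weights_def)
  from arg_cong[OF this, of "\<lambda>v. v $ k"] show ?thesis by (simp add: matrix_vector_mult_def)
qed

abbreviation w :: "'d state \<Rightarrow> real" where "w \<equiv> weighted_size a"

lemma w_nonneg: "0 \<le> w z"
  by (rule weighted_size_nonneg[OF a_ge_1])

lemma w_offspring: "integrable \<Omega> (\<lambda>\<omega>. w (\<zeta> n l k \<omega>))" "expectation (\<lambda>\<omega>. w (\<zeta> n l k \<omega>)) = \<rho> * a $ k"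
proof -
  show "integrable \<Omega> (\<lambda>\<omega>. w (\<zeta> n l k \<omega>))"
    unfolding weighted_size_def using finite_mean by auto
  have "expectation (\<lambda>\<omega>. w (\<zeta> n l k \<omega>)) = (\<Sum>i\<in>UNIV. a $ i * expectation (\<lambda>\<omega>. real (\<zeta> n l k \<omega> $ i)))"
    unfolding weighted_size_def using finite_mean by simp
  also have "\<dots> = (\<Sum>i\<in>UNIV. M $ k $ i * a $ i)"
    using expectation_offspring_eq[of "\<lambda>z. real (z $ i)" n l k for i]
    by (simp add: mean_matrix_def mult.commute)
  finally show "expectation (\<lambda>\<omega>. w (\<zeta> n l k \<omega>)) = \<rho> * a $ k" by (simp add: a_eigen)
qed

lemma integrable_w_offspring_powr: "integrable \<Omega> (\<lambda>\<omega>. w (\<zeta> n l k \<omega>) powr q0)"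
proof -
  let ?A = "\<Sum>i\<in>UNIV. a $ i" and ?Z = "gw \<zeta> (\<chi> i. 1) 1"
  have A: "0 \<le> ?A" using a_ge_1 by (intro sum_nonneg) (auto intro: order_trans[of 0 1])
  have le: "w (\<zeta> 0 0 k \<omega>) powr q0 \<le> ?A powr q0 * real (total (?Z \<omega>)) powr q0" for \<omega>
  proof -
    have "real (total (?Z \<omega>)) = (\<Sum>j\<in>UNIV. real (total (\<zeta> 0 0 j \<omega>)))"
      by (simp add: total_eq_weighted_size weighted_size_sum)
    then have "real (total (\<zeta> 0 0 k \<omega>)) \<le> real (total (?Z \<omega>))"
      using member_le_sum[of k UNIV "\<lambda>j. real (total (\<zeta> 0 0 j \<omega>))"] by simp
    then have "w (\<zeta> 0 0 k \<omega>) \<le> ?A * real (total (?Z \<omega>))"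
      using weighted_size_le_total[OF a_ge_1, of "\<zeta> 0 0 k \<omega>"] A by (meson mult_left_mono order_trans)
    then have "w (\<zeta> 0 0 k \<omega>) powr q0 \<le> (?A * real (total (?Z \<omega>))) powr q0"
      using q0 w_nonneg by (intro powr_mono2) auto
    then show ?thesis using A by (simp add: powr_mult)
  qed
  have "(\<integral>\<^sup>+\<omega>. ennreal (w (\<zeta> 0 0 k \<omega>) powr q0) \<partial>\<Omega>)
      \<le> (\<integral>\<^sup>+\<omega>. ennreal (?A powr q0) * ennreal (real (total (?Z \<omega>)) powr q0) \<partial>\<Omega>)"
    using le by (intro nn_integral_mono) (simp add: ennreal_mult[symmetric] ennreal_leI)
  also have "\<dots> = ennreal (?A powr q0) * (\<integral>\<^sup>+\<omega>. ennreal (real (total (?Z \<omega>)) powr q0) \<partial>\<Omega>)"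
    by (intro nn_integral_cmult measurable_compose[OF gw_rv]) simp
  also have "\<dots> < \<infinity>" using moment by (simp add: ennreal_mult_less_top)
  finally have "integrable \<Omega> (\<lambda>\<omega>. w (\<zeta> 0 0 k \<omega>) powr q0)"
    by (intro integrableI_nonneg measurable_compose[OF \<zeta>_measurable]) auto
  then show ?thesis by (simp add: integrable_offspring_iff[of "\<lambda>z. w z powr q0" n l k])
qed

text \<open>The individuals alive at time 0, as indices of the independent family of all offspring vectors; hence
  the constant generation index 0.\<close>

definition individuals :: "'d state \<Rightarrow> (nat \<times> nat \<times> 'd) set" where
  "individuals x = (\<lambda>(k, l). (0, l, k)) ` (SIGMA k:UNIV. {..<x $ k})"

lemma finite_individuals: "finite (individuals x)"
  unfolding individuals_def by (intro finite_imageI finite_SigmaI) auto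

lemma sum_individuals:
  fixes f :: "nat \<times> nat \<times> 'd \<Rightarrow> 'b::comm_monoid_add"
  shows "(\<Sum>i\<in>individuals x. f i) = (\<Sum>k\<in>UNIV. \<Sum>l<x $ k. f (0, l, k))"
  unfolding individuals_def
  by (subst sum.reindex) (auto simp: inj_on_def sum.Sigma case_prod_beta')

abbreviation Y :: "nat \<times> nat \<times> 'd \<Rightarrow> 'a \<Rightarrow> real" where
  "Y i \<omega> \<equiv> w (case i of (n, l, k) \<Rightarrow> \<zeta> n l k \<omega>)"

lemma w_gw_1: "w (gw \<zeta> x 1 \<omega>) = (\<Sum>i\<in>individuals x. Y i \<omega>)"
  by (simp add: sum_individuals weighted_size_sum)

lemma sum_expectation_Y: "(\<Sum>i\<in>individuals x. expectation (Y i)) = \<rho> * w x"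
  by (simp add: sum_individuals w_offspring) (simp add: weighted_size_def sum_distrib_left mult_ac)

lemma Y_integrable: "integrable \<Omega> (Y i)" "integrable \<Omega> (\<lambda>\<omega>. Y i \<omega> powr q0)"
  using w_offspring(1) integrable_w_offspring_powr by (cases i; simp)+

lemma nn_integral_step_w: "(\<integral>\<^sup>+y. ennreal (w y) \<partial>step x) = ennreal (\<rho> * w x)"
proof -
  have "(\<integral>\<^sup>+y. ennreal (w y) \<partial>step x) = (\<integral>\<^sup>+\<omega>. ennreal (\<Sum>i\<in>individuals x. Y i \<omega>) \<partial>\<Omega>)"
    unfolding step_def nn_integral_law by (simp only: w_gw_1)
  also have "\<dots> = ennreal (expectation (\<lambda>\<omega>. \<Sum>i\<in>individuals x. Y i \<omega>))"
    using Y_integrable(1) w_nonneg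
    by (intro nn_integral_eq_integral Bochner_Integration.integrable_sum) (auto intro!: sum_nonneg)
  also have "expectation (\<lambda>\<omega>. \<Sum>i\<in>individuals x. Y i \<omega>) = \<rho> * w x"
    using Y_integrable(1) by (subst Bochner_Integration.integral_sum) (auto simp: sum_expectation_Y)
  finally show ?thesis .
qed

text \<open>The error term of \<open>sum_moment_bound\<close> contains the number of summands. This is the population size
  \<open>total x\<close>, which is at most \<open>w x\<close>.\<close>

lemma nn_integral_step_powr:
  assumes q: "1 < q" "q \<le> q0" and \<epsilon>: "0 < \<epsilon>"
  shows "\<exists>C\<ge>0. \<forall>x. (\<integral>\<^sup>+y. ennreal (w y powr q) \<partial>step x) \<le> ennreal ((\<rho> powr q + \<epsilon>) * w x powr q + C)"
proof -
  have Yrv: "Y i \<in> borel_measurable \<Omega>" for i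
    using Y_integrable(1) by (rule borel_measurable_integrable)
  have indY: "indep_vars (\<lambda>_. borel) Y UNIV"
    using indep_vars_compose2[OF indep, of "\<lambda>_. w" "\<lambda>_. borel"] by (simp add: case_prod_beta')
  define m where "m = \<rho> * (\<Sum>k\<in>UNIV. a $ k)"
  define B where "B = (\<Sum>k\<in>UNIV. expectation (\<lambda>\<omega>. w (\<zeta> 0 0 k \<omega>) powr q0))"
  have a_le: "a $ k \<le> (\<Sum>k\<in>UNIV. a $ k)" for k
    using a_ge_1 by (intro member_le_sum) (auto intro: order_trans[of 0 1])
  have m: "expectation (Y i) \<le> m" for i
    using a_le \<rho> by (cases i) (simp add: w_offspring m_def mult_left_mono)
  have B: "expectation (\<lambda>\<omega>. Y i \<omega> powr q0) \<le> B" for i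
  proof (cases i)
    case (fields n l k)
    have "expectation (\<lambda>\<omega>. w (\<zeta> 0 0 k \<omega>) powr q0) \<le> B"
      unfolding B_def by (intro member_le_sum) (auto intro!: integral_nonneg_AE)
    with fields show ?thesis using expectation_offspring_eq[of "\<lambda>z. w z powr q0" n l k] by simp
  qed
  have mB: "0 \<le> m" "0 \<le> B"
  proof -
    have "0 \<le> a $ k" for k using a_ge_1[of k] by simp
    then show "0 \<le> m" using \<rho> by (simp add: m_def sum_nonneg)
    show "0 \<le> B" by (simp add: B_def sum_nonneg integral_nonneg_AE)
  qed
  have "\<exists>C\<ge>0. \<forall>J. finite J \<and> J \<subseteq> UNIV \<longrightarrow> expectation (\<lambda>\<omega>. (\<Sum>i\<in>J. Y i \<omega>) powr q)
         \<le> (\<Sum>i\<in>J. expectation (Y i)) powr q + \<epsilon> * real (card J) powr q + C"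
  proof (rule sum_moment_bound[where I = UNIV and q = q0 and m = m and B = B])
    show "indep_vars (\<lambda>_. borel) Y UNIV" by (rule indY)
  qed (use w_nonneg Y_integrable m B mB q \<epsilon> in simp_all)
  then obtain C where C: "0 \<le> C"
    and bound: "\<forall>J. finite J \<and> J \<subseteq> UNIV \<longrightarrow> expectation (\<lambda>\<omega>. (\<Sum>i\<in>J. Y i \<omega>) powr q)
         \<le> (\<Sum>i\<in>J. expectation (Y i)) powr q + \<epsilon> * real (card J) powr q + C" by blast
  have "(\<integral>\<^sup>+y. ennreal (w y powr q) \<partial>step x) \<le> ennreal ((\<rho> powr q + \<epsilon>) * w x powr q + C)" for x
  proof -
    let ?J = "individuals x"
    have "integrable \<Omega> (\<lambda>\<omega>. Y i \<omega> powr q)" for i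
      by (rule integrable_powr_le(1)[where X = "Y i" and p = q0]) (use Y_integrable Yrv w_nonneg q in auto)
    then have int: "integrable \<Omega> (\<lambda>\<omega>. (\<Sum>i\<in>?J. Y i \<omega>) powr q)"
      using q by (intro integrable_sum_powr finite_individuals w_nonneg Yrv) auto
    have "(\<integral>\<^sup>+y. ennreal (w y powr q) \<partial>step x) = (\<integral>\<^sup>+\<omega>. ennreal ((\<Sum>i\<in>?J. Y i \<omega>) powr q) \<partial>\<Omega>)"
      unfolding step_def nn_integral_law by (simp only: w_gw_1)
    also have "\<dots> = ennreal (expectation (\<lambda>\<omega>. (\<Sum>i\<in>?J. Y i \<omega>) powr q))"
      using int by (intro nn_integral_eq_integral) auto
    also have "expectation (\<lambda>\<omega>. (\<Sum>i\<in>?J. Y i \<omega>) powr q) \<le> (\<rho> powr q + \<epsilon>) * w x powr q + C"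
    proof -
      have "real (card ?J) = real (total x)"
        using sum_individuals[of "\<lambda>_. 1 :: nat" x] by (simp add: total_def)
      also have "\<dots> \<le> w x" by (rule total_le_weighted_size[OF a_ge_1])
      finally have "real (card ?J) powr q \<le> w x powr q"
        using q by (intro powr_mono2) auto
      then have "\<epsilon> * real (card ?J) powr q \<le> \<epsilon> * w x powr q"
        using \<epsilon> by simp
      moreover have "(\<Sum>i\<in>?J. expectation (Y i)) powr q = \<rho> powr q * w x powr q"
        using \<rho> w_nonneg[of x] by (simp add: sum_expectation_Y powr_mult)
      ultimately show ?thesis
        using bound[rule_format, of ?J] finite_individuals[of x] by (simp add: distrib_right)
    qed
    finally show ?thesis by (simp add: ennreal_leI)
  qed
  then show ?thesis using C by blast
qed

lemma \<rho>_powr_less: "1 < q \<Longrightarrow> \<rho> powr q < \<rho>"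
  using powr_less_mono'[of \<rho> 1 q] \<rho> by simp

lemma drift_w:
  assumes q: "1 < q" "q \<le> q0"
  obtains \<theta> C where "0 \<le> \<theta>" "\<theta> < \<rho>" "0 \<le> C"
    "\<And>x. (\<integral>\<^sup>+y. ennreal (w y powr q) \<partial>step x) \<le> ennreal (\<theta> * w x powr q + C)"
proof -
  let ?\<epsilon> = "(\<rho> - \<rho> powr q) / 2"
  have \<epsilon>: "0 < ?\<epsilon>" using \<rho>_powr_less[OF q(1)] by simp
  obtain C where C: "0 \<le> C"
    "\<And>x. (\<integral>\<^sup>+y. ennreal (w y powr q) \<partial>step x) \<le> ennreal ((\<rho> powr q + ?\<epsilon>) * w x powr q + C)"
    using nn_integral_step_powr[OF q \<epsilon>] by blast
  have "\<rho> powr q + ?\<epsilon> < \<rho>" using \<rho>_powr_less[OF q(1)] by (simp add: field_simps)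
  then show ?thesis using \<epsilon> C by (intro that[of "\<rho> powr q + ?\<epsilon>" C]) (auto intro: add_nonneg_nonneg)
qed

lemma eigenfunction_chain:
  assumes q: "1 < q" "q \<le> q0"
  obtains \<theta> C where "eigenfunction_chain step living w \<rho> q \<theta> C (\<chi> i. 1)"
proof -
  obtain \<theta> C where \<theta>: "0 \<le> \<theta>" "\<theta> < \<rho>" and C: "0 \<le> C" and
    drift: "\<And>x. (\<integral>\<^sup>+y. ennreal (w y powr q) \<partial>step x) \<le> ennreal (\<theta> * w x powr q + C)"
    using drift_w[OF q] by blast
  have "eigenfunction_chain step living w \<rho> q \<theta> C (\<chi> i. 1)"
  proof
    fix x :: "'d state" assume x: "x \<in> living"
    have "ennreal (\<theta> * w x powr q + C) \<le> ennreal (\<theta> * w x powr q + C * w x)"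
      using mult_left_mono[OF weighted_size_ge_1[OF a_ge_1 x] C] by (intro ennreal_leI) simp
    with drift[of x] show "(\<integral>\<^sup>+y. ennreal (w y powr q) \<partial>step x) \<le> ennreal (\<theta> * w x powr q + C * w x)"
      by (rule order_trans)
  next
    show "finite {x \<in> living. w x \<le> R}" for R
      using finite_weighted_size_le[OF a_ge_1] by (rule finite_subset[rotated]) auto
    show "(\<chi> i. 1) \<in> (living :: 'd state set)"
      by (simp add: living_def vec_eq_iff)
  qed (use \<rho> q \<theta> C in \<open>auto intro: weighted_size_ge_1[OF a_ge_1] weighted_size_outside nn_integral_step_w reach\<close>)
  then show ?thesis by (rule that)
qed

end

end

section \<open>Condition (E)\<close>

context subcritical_galton_watson
begin

lemma measure_kpow_step_zero: "A \<subseteq> living \<Longrightarrow> measure (kpow step n 0) A = 0"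
proof -
  assume A: "A \<subseteq> living"
  have "step 0 = return_pmf 0"
    by (rule pmf_eqI) (simp add: step_def pmf_law indicator_def prob_space)
  then have "set_pmf (kpow step n 0) \<subseteq> {0}"
    by (intro set_kpow_subset) auto
  then show ?thesis
    using A by (auto simp: measure_pmf_zero_iff living_def)
qed

lemma survival_antimono: "measure (kpow step (n + m) x) living \<le> measure (kpow step n x) living"
proof -
  have "measure (kpow step (n + m) x) living
      = measure_pmf.expectation (kpow step n x) (\<lambda>z. measure (kpow step m z) living)"
    by (rule measure_kpow_add)
  also have "\<dots> \<le> measure_pmf.expectation (kpow step n x) (indicator living)"
    using measure_kpow_step_zero[of living m]
    by (intro expectation_pmf_mono integrable_pmf_bounded[where B = 1])
       (auto simp: indicator_def living_def)
  finally show ?thesis by simp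
qed

lemma common_time_to:
  fixes K :: "'d state set"
  assumes "finite K" "K \<subseteq> living" "y \<in> living"
  obtains n c where "0 < n" "0 < c" "\<And>x. x \<in> K \<Longrightarrow> c \<le> pmf (kpow step n x) y"
proof -
  have "eventually (\<lambda>n. \<forall>x\<in>K. 0 < pmf (kpow step n x) y) sequentially"
    using assms by (intro eventually_ball_finite) (auto intro: reach)
  then have "eventually (\<lambda>n. 0 < n \<and> (\<forall>x\<in>K. 0 < pmf (kpow step n x) y)) sequentially"
    using eventually_gt_at_top[of 0] by eventually_elim auto
  then obtain n where n: "0 < n" "\<And>x. x \<in> K \<Longrightarrow> 0 < pmf (kpow step n x) y"
    unfolding eventually_sequentially by blast
  define c where "c = Min (insert 1 ((\<lambda>x. pmf (kpow step n x) y) ` K))"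
  have c: "0 < c" "\<And>x. x \<in> K \<Longrightarrow> c \<le> pmf (kpow step n x) y"
    unfolding c_def using n assms(1) by (auto intro!: Min_le)
  show ?thesis by (rule that[OF n(1) c])
qed

lemma common_time_from:
  fixes K :: "'d state set"
  assumes "finite K" "K \<subseteq> living" "x \<in> living"
  obtains n c where "0 < c" "\<And>y. y \<in> K \<Longrightarrow> c \<le> pmf (kpow step n x) y"
proof -
  have "eventually (\<lambda>n. \<forall>y\<in>K. 0 < pmf (kpow step n x) y) sequentially"
    using assms by (intro eventually_ball_finite) (auto intro: reach)
  then obtain n where n: "\<forall>y\<in>K. 0 < pmf (kpow step n x) y"
    using eventually_happens'[OF sequentially_bot] by blast
  define c where "c = Min (insert 1 ((\<lambda>y. pmf (kpow step n x) y) ` K))"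
  have c: "0 < c" "\<And>y. y \<in> K \<Longrightarrow> c \<le> pmf (kpow step n x) y"
    unfolding c_def using n assms(1) by (auto intro!: Min_le)
  show ?thesis by (rule that[OF c])
qed

text \<open>All points of a finite set reach a given point and are reached from it with probabilities
  bounded below, so their survival probabilities are comparable, uniformly in time.\<close>

lemma survival_comparable:
  fixes K :: "'d state set" and x0 :: "'d state"
  assumes K: "finite K" "K \<subseteq> living" and x0: "x0 \<in> living"
  obtains c where "0 < c"
    "\<And>n y z. y \<in> K \<Longrightarrow> z \<in> K \<Longrightarrow> measure (kpow step n y) living \<le> c * measure (kpow step n z) living"
proof -
  let ?s = "\<lambda>n x. measure (kpow step n x) living"
  obtain n1 c1 where c1: "0 < n1" "0 < c1" "\<And>z. z \<in> K \<Longrightarrow> c1 \<le> pmf (kpow step n1 z) x0"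
    using common_time_to[OF K x0] by blast
  obtain n2 c2 where c2: "0 < c2" "\<And>y. y \<in> K \<Longrightarrow> c2 \<le> pmf (kpow step n2 x0) y"
    using common_time_from[OF K x0] by blast
  have "?s n y \<le> 1 / (c1 * c2) * ?s n z" if y: "y \<in> K" and z: "z \<in> K" for n y z
  proof -
    have "c2 * ?s n y \<le> pmf (kpow step n2 x0) y * ?s n y"
      by (intro mult_right_mono c2(2) y) simp
    also have "\<dots> \<le> ?s (n2 + n) x0" by (rule measure_kpow_add_ge)
    also have "\<dots> \<le> ?s n x0" using survival_antimono[of n n2 x0] by (simp add: add.commute)
    finally have 2: "c2 * ?s n y \<le> ?s n x0" .
    have "c1 * ?s n x0 \<le> pmf (kpow step n1 z) x0 * ?s n x0"
      by (intro mult_right_mono c1(3) z) simp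
    also have "\<dots> \<le> ?s (n1 + n) z" by (rule measure_kpow_add_ge)
    also have "\<dots> \<le> ?s n z" using survival_antimono[of n n1 z] by (simp add: add.commute)
    finally have "c1 * ?s n x0 \<le> ?s n z" .
    with mult_left_mono[OF 2, of c1] c1(2) have "c1 * (c2 * ?s n y) \<le> ?s n z" by linarith
    then show ?thesis using c1(2) c2(1) by (simp add: field_simps)
  qed
  then show ?thesis using that[of "1 / (c1 * c2)"] c1(2) c2(1) by simp
qed

text \<open>If the infimum is 0, the comparison makes the supremum 0 as well, and then the quotient is 0.\<close>

lemma SUP_divide_INF_le:
  fixes s :: "'b \<Rightarrow> real"
  assumes c: "0 < c" and s: "\<And>y. 0 \<le> s y" "\<And>y z. y \<in> K \<Longrightarrow> z \<in> K \<Longrightarrow> s y \<le> c * s z"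
  shows "(SUP y\<in>K. ennreal (s y)) / (INF y\<in>K. ennreal (s y)) \<le> ennreal c"
proof -
  let ?I = "INF y\<in>K. ennreal (s y)"
  have le: "(SUP y\<in>K. ennreal (s y)) \<le> ?I * ennreal c"
  proof (rule SUP_least)
    fix y assume y: "y \<in> K"
    have "ennreal (s y / c) \<le> ?I"
    proof (rule INF_greatest)
      fix z assume "z \<in> K"
      then show "ennreal (s y / c) \<le> ennreal (s z)"
        using s(2)[OF y, of z] c by (intro ennreal_leI) (simp add: field_simps)
    qed
    then have "ennreal (s y / c) * ennreal c \<le> ?I * ennreal c" by (rule mult_right_mono) simp
    then show "ennreal (s y) \<le> ?I * ennreal c"
      using c s(1)[of y] by (simp add: ennreal_mult[symmetric])
  qed
  show ?thesis
  proof (cases "?I = 0")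
    case True
    with le have "(SUP y\<in>K. ennreal (s y)) = 0" by simp
    with True show ?thesis by simp
  next
    case False
    with le show ?thesis by (intro divide_le_posI_ennreal) (auto simp: zero_less_iff_neq_zero)
  qed
qed

text \<open>Let \<open>K\<close> keep at least the mass \<open>\<theta> ^ N\<close> after \<open>N\<close> steps from each of its points. In the discounted
  occupation time \<open>\<Sum>k<N. (1 / \<theta>) ^ k * P_x(Z_k \<in> K)\<close>, one more step and division by \<open>\<theta>\<close> shift the
  index. This exchanges the first summand, the indicator of \<open>K\<close>, for the summand with index \<open>N\<close>,
  which dominates it.\<close>

lemma occupation_function:
  assumes K: "K \<subseteq> living" and \<theta>: "0 < \<theta>" and N: "0 < N"
    and mass: "\<And>x. x \<in> K \<Longrightarrow> \<theta> ^ N \<le> measure (kpow step N x) K"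
  obtains \<phi> :: "'d state \<Rightarrow> real" and \<epsilon> where "0 < \<epsilon>" "\<And>x. 0 \<le> \<phi> x" "\<And>x. \<phi> x \<le> 1" "\<And>x. x \<in> K \<Longrightarrow> \<epsilon> \<le> \<phi> x"
    "\<And>x. ennreal (\<theta> * \<phi> x) \<le> P1 \<Omega> \<zeta> \<phi> x"
proof -
  define u where "u k x = (1 / \<theta>) ^ k * measure (kpow step k x) K" for k x
  define s where "s = (\<Sum>k<N. (1 / \<theta>) ^ k)"
  define \<phi> where "\<phi> x = (\<Sum>k<N. u k x) / s" for x
  have u_nonneg: "0 \<le> u k x" for k x using \<theta> by (simp add: u_def)
  have s: "0 < s" unfolding s_def using \<theta> N by (intro sum_pos) auto
  have nonneg: "0 \<le> \<phi> x" for x using s u_nonneg by (simp add: \<phi>_def sum_nonneg)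
  have "(\<Sum>k<N. u k x) \<le> s" for x
    unfolding s_def u_def using \<theta> by (intro sum_mono mult_left_le) auto
  then have le_1: "\<phi> x \<le> 1" for x using s by (simp add: \<phi>_def divide_le_eq_1)
  have u_0: "u 0 x = indicator K x" for x by (simp add: u_def indicator_def)
  have lower: "1 / s \<le> \<phi> x" if "x \<in> K" for x
  proof -
    have "u 0 x \<le> (\<Sum>k<N. u k x)" using N u_nonneg by (intro member_le_sum) auto
    then show ?thesis using that s by (simp add: \<phi>_def u_0 divide_right_mono)
  qed
  have "ennreal (\<theta> * \<phi> x) \<le> P1 \<Omega> \<zeta> \<phi> x" for x
  proof -
    have \<phi>_0: "\<phi> 0 = 0" using measure_kpow_step_zero[OF K] by (simp add: \<phi>_def u_def)
    have shift: "measure_pmf.expectation (step x) (u k) = \<theta> * u (Suc k) x" for k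
    proof -
      have "measure_pmf.expectation (step x) (\<lambda>y. measure (kpow step k y) K) = measure (kpow step (Suc k) x) K"
        using measure_kpow_add[of step "Suc 0" k x K]
        by (simp only: kpow_1 plus_nat.add_Suc plus_nat.add_0)
      then show ?thesis using \<theta> by (simp add: u_def[abs_def] del: kpow.simps)
    qed
    have "P1 \<Omega> \<zeta> \<phi> x = (\<integral>\<^sup>+y. ennreal (\<phi> y) \<partial>step x)"
      unfolding P1_eq by (intro nn_integral_cong) (auto simp: indicator_def living_def \<phi>_0)
    also have "\<dots> = ennreal (measure_pmf.expectation (step x) \<phi>)"
      using nonneg le_1 by (intro nn_integral_eq_integral integrable_pmf_bounded[where B = 1]) auto
    also have "measure_pmf.expectation (step x) \<phi> = (\<Sum>k<N. measure_pmf.expectation (step x) (u k)) / s"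
    proof -
      have int: "integrable (step x) (\<lambda>y. measure (kpow step k y) K)" for k
        by (intro integrable_pmf_bounded[where B = 1]) auto
      show ?thesis
        unfolding \<phi>_def u_def[abs_def] using int by (simp add: Bochner_Integration.integral_sum)
    qed
    finally have P1: "P1 \<Omega> \<zeta> \<phi> x = ennreal (\<theta> * ((\<Sum>k<N. u (Suc k) x) / s))"
      by (simp add: shift sum_distrib_left[symmetric])
    have "u 0 x \<le> u N x"
    proof (cases "x \<in> K")
      case True
      then show ?thesis
        using mass[OF True] \<theta> by (simp add: u_0) (simp add: u_def power_divide)
    next
      case False
      then show ?thesis using u_nonneg by (simp add: u_0)
    qed
    moreover have "(\<Sum>k<N. u (Suc k) x) + u 0 x = (\<Sum>k<N. u k x) + u N x"
      using sum.lessThan_Suc_shift[of "\<lambda>k. u k x" N] by simp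
    ultimately have "(\<Sum>k<N. u k x) \<le> (\<Sum>k<N. u (Suc k) x)" by linarith
    then show ?thesis
      unfolding P1 \<phi>_def using \<theta> s by (intro ennreal_leI mult_left_mono divide_right_mono) auto
  qed
  then show ?thesis using that[of "1 / s" \<phi>] s nonneg le_1 lower by simp
qed

text \<open>The mass in \<open>K\<close> is asymptotically a positive multiple of \<open>\<rho> ^ n\<close>.\<close>

lemma eventually_mass_ge:
  assumes a: "a \<in> perron_weights M" and K: "finite K" "K \<subseteq> living" "K \<noteq> {}" and less: "0 < \<theta>" "\<theta> < \<rho>"
  shows "eventually (\<lambda>n. \<forall>x\<in>K. \<theta> ^ n \<le> measure (kpow step n x) K) sequentially"
proof (intro eventually_ball_finite K ballI)
  fix x assume "x \<in> K"
  then have x: "x \<in> living" using K by blast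
  obtain \<theta>' C where "eigenfunction_chain step living (weighted_size a) \<rho> q0 \<theta>' C (\<chi> i. 1)"
    using eigenfunction_chain[OF a q0] by blast
  then interpret eigenfunction_chain step living "weighted_size a" \<rho> q0 \<theta>' C "\<chi> i. 1" .
  obtain \<nu> c r where \<nu>: "set_pmf \<nu> = living" and c: "0 < c"
    and r: "(\<lambda>n. r n x) \<longlonglongrightarrow> 0"
    and approx: "\<And>n. \<bar>measure (kpow step n x) (K \<inter> living) / \<rho> ^ n - c * weighted_size a x * measure \<nu> K\<bar>
        \<le> weighted_size a x * r n x"
    apply (rule quasi_stationary_limit)
    subgoal premises prems for \<nu> c r
      using prems(1)[of \<nu> c r] prems(2,3) prems(6)[OF x] prems(9)[OF x] by blast
    done
  define L where "L = c * weighted_size a x * measure \<nu> K"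
  have "0 < measure \<nu> K"
    using K \<nu> by (auto simp: measure_pmf_posI subset_iff)
  then have L: "0 < L" using c h_ge_1[OF x] by (simp add: L_def)
  have "(\<lambda>n. measure (kpow step n x) K / \<rho> ^ n - L) \<longlonglongrightarrow> 0"
  proof (rule Lim_null_comparison[OF always_eventually[OF allI]])
    show "norm (measure (kpow step n x) K / \<rho> ^ n - L) \<le> weighted_size a x * r n x" for n
      using approx[of n] K(2) by (simp add: L_def Int_absorb2)
    show "(\<lambda>n. weighted_size a x * r n x) \<longlonglongrightarrow> 0"
      using r by (rule tendsto_mult_right_zero)
  qed
  then have "(\<lambda>n. measure (kpow step n x) K / \<rho> ^ n) \<longlonglongrightarrow> L"
    by (simp add: LIM_zero_iff)
  then have 1: "eventually (\<lambda>n. L / 2 < measure (kpow step n x) K / \<rho> ^ n) sequentially"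
    using L by (intro order_tendstoD(1)) auto
  have "(\<lambda>n. (\<theta> / \<rho>) ^ n) \<longlonglongrightarrow> 0"
    using less by (intro LIMSEQ_realpow_zero) auto
  then have 2: "eventually (\<lambda>n. (\<theta> / \<rho>) ^ n < L / 2) sequentially"
    using L by (intro order_tendstoD(2)) auto
  show "eventually (\<lambda>n. \<theta> ^ n \<le> measure (kpow step n x) K) sequentially"
    using 1 2
  proof eventually_elim
    case (elim n)
    then have "(\<theta> / \<rho>) ^ n < measure (kpow step n x) K / \<rho> ^ n" by linarith
    then show ?case using lam by (simp add: power_divide divide_less_cancel)
  qed
qed

text \<open>The set \<open>K\<close> is a finite sublevel set of the weighted size that contains the population \<open>(1, ..., 1)\<close>,
  whose Dirac mass serves as \<open>\<nu>\<close> in (E1). The rate \<open>\<theta>1\<close> only has to exceed \<open>\<theta>\<close>, and \<open>\<theta>2\<close> only has to be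
  below \<open>\<rho>\<close>, so that there is room for \<open>\<theta>1 < \<theta>2\<close>.\<close>

theorem condition_E_holds:
  assumes a: "a \<in> perron_weights M" and q: "1 < q" "q \<le> q0"
  shows "\<exists>\<phi>2. condition_E \<Omega> \<zeta> (\<lambda>z. weighted_size a z powr q) \<phi>2"
proof -
  let ?w = "weighted_size a" and ?x0 = "(\<chi> i. 1) :: 'd state"
  note a1 = a_ge_1[OF a]
  obtain \<theta> C where \<theta>: "0 \<le> \<theta>" "\<theta> < \<rho>" and C: "0 \<le> C" and
    drift: "\<And>x. (\<integral>\<^sup>+y. ennreal (?w y powr q) \<partial>step x) \<le> ennreal (\<theta> * ?w x powr q + C)"
    using drift_w[OF a q] by blast
  obtain \<theta>1 where \<theta>1: "\<theta> < \<theta>1" "\<theta>1 < \<rho>" using dense[OF \<theta>(2)] by blast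
  obtain \<theta>2 where \<theta>2: "\<theta>1 < \<theta>2" "\<theta>2 < \<rho>" using dense[OF \<theta>1(2)] by blast
  have th: "\<theta> < \<theta>1" "0 < \<theta>1" "\<theta>1 < \<theta>2" "0 < \<theta>2" "\<theta>2 < \<rho>"
    using \<theta>(1) \<theta>1 \<theta>2 by auto
  \<comment> \<open>Above the level \<open>R\<close> the constant \<open>C\<close> is absorbed by the gap between \<open>\<theta>\<close> and \<open>\<theta>1\<close>.\<close>
  define R where "R = max (?w ?x0) (max 1 (C / (\<theta>1 - \<theta>)))"
  define K where "K = {z \<in> living. ?w z \<le> R}"
  have x0: "?x0 \<in> living" by (simp add: living_def vec_eq_iff)
  have K: "finite K" "K \<subseteq> living" "?x0 \<in> K"
    using finite_weighted_size_le[OF a1, of R] x0 by (auto simp: K_def R_def intro: finite_subset[rotated])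
  have w1: "1 \<le> ?w x powr q" if "x \<in> living" for x
    using weighted_size_ge_1[OF a1 that] q by (intro ge_one_powr_ge_zero) auto
  obtain n1 c1 where c1: "0 < n1" "0 < c1" "\<And>x. x \<in> K \<Longrightarrow> c1 \<le> pmf (kpow step n1 x) ?x0"
    using common_time_to[OF K(1,2) x0] by blast
  obtain c3 where c3: "0 < c3"
    "\<And>n y z. y \<in> K \<Longrightarrow> z \<in> K \<Longrightarrow> measure (kpow step n y) living \<le> c3 * measure (kpow step n z) living"
    using survival_comparable[OF K(1,2) x0] by blast
  have "eventually (\<lambda>n. 0 < n \<and> (\<forall>x\<in>K. \<theta>2 ^ n \<le> measure (kpow step n x) K)) sequentially"
    using K th by (intro eventually_conj eventually_gt_at_top eventually_mass_ge[OF a]) auto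
  then obtain N where N: "0 < N" "\<And>x. x \<in> K \<Longrightarrow> \<theta>2 ^ N \<le> measure (kpow step N x) K"
    using eventually_happens'[OF sequentially_bot] by blast
  obtain \<phi>2 :: "'d state \<Rightarrow> real" and \<epsilon> where \<phi>2: "0 < \<epsilon>" "\<And>x. 0 \<le> \<phi>2 x" "\<And>x. \<phi>2 x \<le> 1"
    "\<And>x. x \<in> K \<Longrightarrow> \<epsilon> \<le> \<phi>2 x" "\<And>x. ennreal (\<theta>2 * \<phi>2 x) \<le> P1 \<Omega> \<zeta> \<phi>2 x"
    apply (rule occupation_function[OF K(2) th(4) N])
     apply assumption
    subgoal premises prems for \<phi>2 \<epsilon> by (rule prems(1)[OF prems(2-6)])
    done
  have E1: "c1 * measure (return_pmf ?x0) (A \<inter> K) \<le> gw_prob \<Omega> \<zeta> x n1 A" if "x \<in> K" for x A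
  proof (cases "?x0 \<in> A")
    case True
    then have "pmf (kpow step n1 x) ?x0 \<le> measure (kpow step n1 x) A"
      by (simp add: measure_pmf_single[symmetric] measure_pmf.finite_measure_mono)
    then show ?thesis using c1(3)[OF that] True K(3) by (simp add: gw_prob_eq indicator_def)
  qed (simp add: gw_prob_eq)
  have E2: "P1 \<Omega> \<zeta> (\<lambda>z. ?w z powr q) x \<le> ennreal (\<theta>1 * ?w x powr q + (C + 1) * indicator K x)"
    if x: "x \<in> living" for x
  proof -
    have "P1 \<Omega> \<zeta> (\<lambda>z. ?w z powr q) x \<le> (\<integral>\<^sup>+y. ennreal (?w y powr q) \<partial>step x)"
      unfolding P1_eq by (intro nn_integral_mono) (auto simp: indicator_def)
    also have "\<dots> \<le> ennreal (\<theta> * ?w x powr q + C)" by (rule drift)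
    also have "\<dots> \<le> ennreal (\<theta>1 * ?w x powr q + (C + 1) * indicator K x)"
    proof (intro ennreal_leI, cases "x \<in> K")
      case True
      have "\<theta> * ?w x powr q \<le> \<theta>1 * ?w x powr q" using th by (intro mult_right_mono) auto
      with True show "\<theta> * ?w x powr q + C \<le> \<theta>1 * ?w x powr q + (C + 1) * indicator K x" by simp
    next
      case False
      then have w: "R < ?w x" using x by (simp add: K_def)
      have "1 \<le> R" "C / (\<theta>1 - \<theta>) \<le> R" by (auto simp: R_def)
      have "C / (\<theta>1 - \<theta>) \<le> ?w x powr 1" using \<open>C / (\<theta>1 - \<theta>) \<le> R\<close> \<open>1 \<le> R\<close> w by simp
      also have "\<dots> \<le> ?w x powr q" using q \<open>1 \<le> R\<close> w by (intro powr_mono) auto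
      finally have "C \<le> (\<theta>1 - \<theta>) * ?w x powr q" using th by (simp add: field_simps)
      with False show "\<theta> * ?w x powr q + C \<le> \<theta>1 * ?w x powr q + (C + 1) * indicator K x"
        by (simp add: left_diff_distrib)
    qed
    finally show ?thesis .
  qed
  have E3: "(SUP n. (SUP y\<in>K. ennreal (survival \<Omega> \<zeta> y n)) / (INF y\<in>K. ennreal (survival \<Omega> \<zeta> y n))) \<le> ennreal c3"
    unfolding survival_eq by (intro SUP_least SUP_divide_INF_le c3) simp
  have E4: "\<exists>n4. \<forall>n\<ge>n4. 0 < gw_prob \<Omega> \<zeta> x n K" if "x \<in> K" for x
  proof -
    have "eventually (\<lambda>n. 0 < gw_prob \<Omega> \<zeta> x n K) sequentially"
      using reach[OF subsetD[OF K(2) that] x0]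
    proof eventually_elim
      case (elim n)
      then show ?case using K(3) by (auto simp: gw_prob_eq set_pmf_iff intro!: measure_pmf_posI[of ?x0])
    qed
    then show ?thesis by (simp add: eventually_sequentially)
  qed
  have bdd: "bdd_above ((\<lambda>z. ?w z powr q) ` K)"
    using K(1) by (intro bdd_above_finite finite_imageI)
  have "condition_E \<Omega> \<zeta> (\<lambda>z. ?w z powr q) \<phi>2"
    unfolding condition_E_def
    apply (rule conjI, simp)
    apply (rule conjI, simp add: \<phi>2(2))
    apply (rule exI[of _ n1], rule exI[of _ \<theta>1], rule exI[of _ \<theta>2], rule exI[of _ c1],
        rule exI[of _ "C + 1"], rule exI[of _ c3], rule exI[of _ K], rule exI[of _ "return_pmf ?x0"])
    apply (intro conjI)
    subgoal by (rule c1(1))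
    subgoal by (rule th(2))
    subgoal by (rule th(4))
    subgoal by (rule c1(2))
    subgoal using C by simp
    subgoal by (rule c3(1))
    subgoal by (rule K(2))
    subgoal using K(3) by simp
    subgoal using E1 by blast
    subgoal by (rule th(3))
    subgoal using w1 by blast
    subgoal by (rule bdd)
    subgoal using \<phi>2(1,4) by blast
    subgoal using \<phi>2(3) by blast
    subgoal using E2 by blast
    subgoal using \<phi>2(5) by blast
    subgoal by (rule E3)
    subgoal using E4 by blast
    done
  then show ?thesis by blast
qed

section \<open>The quasi-stationary distribution and its domain of attraction\<close>

text \<open>One eigenvector \<open>b\<close> suffices to construct \<open>\<nu>\<close>, because the sizes weighted by any two of them are
  comparable.\<close>

theorem quasi_stationary_distribution:
  obtains \<nu> :: "'d state pmf" where "set_pmf \<nu> = living" "quasi_stationary \<Omega> \<zeta> \<nu>"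
    and "\<And>a q. a \<in> perron_weights M \<Longrightarrow> q \<le> q0 \<Longrightarrow> (\<integral>\<^sup>+z. ennreal (weighted_size a z powr q) \<partial>\<nu>) < \<infinity>"
    and "\<And>\<mu>. set_pmf \<mu> \<subseteq> living \<Longrightarrow> (\<integral>\<^sup>+z. ennreal (real (total z)) \<partial>\<mu>) < \<infinity> \<Longrightarrow> \<mu> \<in> attraction_domain \<Omega> \<zeta> \<nu>"
proof -
  obtain b where b: "b \<in> perron_weights M"
    using perron_weights_nonempty_pos[OF M_nonneg primitive] by blast
  obtain \<theta>' C where "eigenfunction_chain step living (weighted_size b) \<rho> q0 \<theta>' C (\<chi> i. 1)"
    using eigenfunction_chain[OF b q0] by blast
  then interpret eigenfunction_chain step living "weighted_size b" \<rho> q0 \<theta>' C "\<chi> i. 1" .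
  obtain \<nu> c r where \<nu>: "set_pmf \<nu> = living" and c: "0 < c"
    and fin: "(\<integral>\<^sup>+z. ennreal (weighted_size b z powr q0) \<partial>\<nu>) < \<infinity>"
    and inv: "\<And>n A. measure_pmf.expectation \<nu> (\<lambda>x. measure (kpow step n x) (A \<inter> living)) = \<rho> ^ n * measure \<nu> A"
    and r: "\<And>x. x \<in> living \<Longrightarrow> (\<lambda>n. r n x) \<longlonglongrightarrow> 0" "\<And>n x. x \<in> living \<Longrightarrow> 0 \<le> r n x" "\<And>n x. r n x \<le> 1"
    and approx: "\<And>n x A. x \<in> living \<Longrightarrow>
      \<bar>measure (kpow step n x) (A \<inter> living) / \<rho> ^ n - c * weighted_size b x * measure \<nu> A\<bar> \<le> weighted_size b x * r n x"
    apply (rule quasi_stationary_limit)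
    subgoal premises prems for \<nu> c r by (rule prems(1)[OF prems(2-9)])
    done
  have cond: "cond_law \<Omega> \<zeta> \<mu> n A = measure_pmf.expectation \<mu> (\<lambda>x. measure (kpow step n x) (A \<inter> living))
      / measure_pmf.expectation \<mu> (\<lambda>x. measure (kpow step n x) (UNIV \<inter> living))" for \<mu> n A
    by (simp add: cond_law_def gw_prob_alive_eq survival_eq)
  have "quasi_stationary \<Omega> \<zeta> \<nu>"
    unfolding quasi_stationary_def cond inv using \<nu> \<rho> by simp
  moreover have "(\<integral>\<^sup>+z. ennreal (weighted_size a z powr q) \<partial>\<nu>) < \<infinity>"
    if a: "a \<in> perron_weights M" and q: "q \<le> q0" for a q
  proof -
    let ?A = "\<Sum>i\<in>UNIV. a $ i"
    have A: "0 \<le> ?A" using a_ge_1[OF a] by (intro sum_nonneg) (auto intro: order_trans[of 0 1])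
    have le: "weighted_size a z powr q \<le> ?A powr q0 * weighted_size b z powr q0" if z: "z \<in> living" for z
    proof -
      have "weighted_size a z powr q \<le> weighted_size a z powr q0"
        using weighted_size_ge_1[OF a_ge_1[OF a] z] q by (intro powr_mono) auto
      also have "weighted_size a z \<le> ?A * weighted_size b z"
        using weighted_size_le_total[OF a_ge_1[OF a], of z]
          mult_left_mono[OF total_le_weighted_size[OF a_ge_1[OF b], of z] A] by (rule order_trans)
      then have "weighted_size a z powr q0 \<le> (?A * weighted_size b z) powr q0"
        using q0 w_nonneg[OF a] by (intro powr_mono2) auto
      also have "\<dots> = ?A powr q0 * weighted_size b z powr q0"
        using A h_nonneg by (simp add: powr_mult)
      finally show ?thesis by simp
    qed
    have "(\<integral>\<^sup>+z. ennreal (weighted_size a z powr q) \<partial>\<nu>)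
        \<le> (\<integral>\<^sup>+z. ennreal (?A powr q0) * ennreal (weighted_size b z powr q0) \<partial>\<nu>)"
      using le \<nu> by (intro nn_integral_mono_AE)
        (auto simp: AE_measure_pmf_iff ennreal_mult[symmetric] intro!: ennreal_leI)
    also have "\<dots> < \<infinity>" using fin by (simp add: nn_integral_cmult ennreal_mult_less_top)
    finally show ?thesis .
  qed
  moreover have "\<mu> \<in> attraction_domain \<Omega> \<zeta> \<nu>"
    if \<mu>: "set_pmf \<mu> \<subseteq> living" and int: "(\<integral>\<^sup>+z. ennreal (real (total z)) \<partial>\<mu>) < \<infinity>" for \<mu>
  proof -
    let ?A = "\<Sum>i\<in>UNIV. b $ i"
    have "integrable \<mu> (\<lambda>z. ?A * real (total z))"
      using int by (intro integrable_mult_right integrableI_nonneg) auto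
    then have "integrable \<mu> (weighted_size b)"
    proof (rule Bochner_Integration.integrable_bound)
      show "AE z in \<mu>. norm (weighted_size b z) \<le> norm (?A * real (total z))"
        using order_trans[OF weighted_size_le_total[OF a_ge_1[OF b]] abs_ge_self] h_nonneg
        by (intro AE_I2) (simp only: real_norm_def abs_of_nonneg)
    qed simp
    then have "(\<lambda>n. SUP A. \<bar>cond_law \<Omega> \<zeta> \<mu> n A - measure \<nu> A\<bar>) \<longlonglongrightarrow> 0"
      unfolding cond by (intro conditional_limit[OF c r approx \<mu>])
    then show ?thesis using \<mu> by (simp add: attraction_domain_def)
  qed
  ultimately show ?thesis using \<nu> by (intro that)
qed

lemma nn_integral_mono_living:
  assumes "set_pmf \<mu> \<subseteq> living" and "\<And>z. z \<in> living \<Longrightarrow> f z \<le> g z" "(\<integral>\<^sup>+z. ennreal (g z) \<partial>\<mu>) < \<infinity>"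
  shows "(\<integral>\<^sup>+z. ennreal (f z) \<partial>measure_pmf \<mu>) < \<infinity>"
proof -
  have "(\<integral>\<^sup>+z. ennreal (f z) \<partial>\<mu>) \<le> (\<integral>\<^sup>+z. ennreal (g z) \<partial>\<mu>)"
    using assms by (intro nn_integral_mono_AE) (auto simp: AE_measure_pmf_iff intro!: ennreal_leI)
  then show ?thesis using assms(3) by (rule le_less_trans)
qed

text \<open>The conditioned laws of a quasi-stationary distribution are constant in time, so they have only this
  distribution as a limit.\<close>

lemma attraction_domain_quasi_stationary:
  assumes "\<nu>' \<in> attraction_domain \<Omega> \<zeta> \<nu>" "quasi_stationary \<Omega> \<zeta> \<nu>'"
  shows "\<nu>' = \<nu>"
proof -
  let ?d = "\<lambda>A. \<bar>measure \<nu>' A - measure \<nu> A\<bar>"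
  have "(\<lambda>n. SUP A. ?d A) \<longlonglongrightarrow> 0"
    using assms by (simp add: attraction_domain_def quasi_stationary_def)
  then have 0: "(SUP A. ?d A) = 0" by (simp add: LIMSEQ_const_iff)
  have bdd: "bdd_above (range ?d)"
  proof (rule bdd_aboveI2)
    show "?d A \<le> 1" for A
      using measure_pmf.prob_le_1[of \<nu>' A] measure_pmf.prob_le_1[of \<nu> A] measure_nonneg[of \<nu>' A] measure_nonneg[of \<nu> A]
      by linarith
  qed
  have "?d {z} = 0" for z
    using cSUP_upper[OF UNIV_I bdd, of "{z}"] 0 by simp
  then show ?thesis by (intro pmf_eqI) (simp add: measure_pmf_single)
qed

end

theorem corollary8p3:
  fixes \<Omega> :: "'a measure" and \<zeta> :: "('a, 'd::finite) offspring" and q0 :: real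
  assumes "galton_watson \<Omega> \<zeta>"
    and "gw_irreducible \<Omega> \<zeta>" and "gw_aperiodic \<Omega> \<zeta>" and "gw_subcritical \<Omega> \<zeta>"
    and "q0 > 1"
    and "(\<integral>\<^sup>+ \<omega>. ennreal (real (total (gw \<zeta> (\<chi> i. 1) 1 \<omega>)) powr q0) \<partial>\<Omega>) < \<infinity>"
  shows "perron_weights (mean_matrix \<Omega> \<zeta>) \<noteq> {} \<and>
    (\<forall>a \<in> perron_weights (mean_matrix \<Omega> \<zeta>). \<forall>q \<in> {1<..q0}.
       \<exists>\<phi>2. condition_E \<Omega> \<zeta> (\<lambda>z. weighted_size a z powr q) \<phi>2) \<and>
    (\<exists>\<nu>.
       (\<forall>a \<in> perron_weights (mean_matrix \<Omega> \<zeta>). \<forall>q \<in> {1<..q0}. \<forall>\<phi>2.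
          condition_E \<Omega> \<zeta> (\<lambda>z. weighted_size a z powr q) \<phi>2
            \<longrightarrow> is_nu_QSD \<Omega> \<zeta> (\<lambda>z. weighted_size a z powr q) \<phi>2 \<nu>) \<and>
       (\<forall>\<mu> q. set_pmf \<mu> \<subseteq> living \<and> q > 1 \<and> (\<integral>\<^sup>+ z. ennreal (real (total z) powr q) \<partial>\<mu>) < \<infinity>
            \<longrightarrow> \<mu> \<in> attraction_domain \<Omega> \<zeta> \<nu>))"
proof -
  interpret galton_watson \<Omega> \<zeta> by (rule assms(1))
  interpret subcritical_galton_watson \<Omega> \<zeta> q0
    by unfold_locales (use assms in auto)
  let ?M = "mean_matrix \<Omega> \<zeta>"
  obtain \<nu> where \<nu>: "set_pmf \<nu> = living" "quasi_stationary \<Omega> \<zeta> \<nu>"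
    and fin: "\<And>a q. a \<in> perron_weights ?M \<Longrightarrow> q \<le> q0 \<Longrightarrow> (\<integral>\<^sup>+z. ennreal (weighted_size a z powr q) \<partial>\<nu>) < \<infinity>"
    and attr: "\<And>\<mu>. set_pmf \<mu> \<subseteq> living \<Longrightarrow> (\<integral>\<^sup>+z. ennreal (real (total z)) \<partial>\<mu>) < \<infinity> \<Longrightarrow> \<mu> \<in> attraction_domain \<Omega> \<zeta> \<nu>"
    apply (rule quasi_stationary_distribution)
    subgoal premises prems for \<nu> by (rule prems(1)[OF prems(2-5)])
    done
  have qsd: "is_nu_QSD \<Omega> \<zeta> (\<lambda>z. weighted_size a z powr q) \<phi>2 \<nu>"
    if a: "a \<in> perron_weights ?M" and q: "1 < q" "q \<le> q0"
      and E: "condition_E \<Omega> \<zeta> (\<lambda>z. weighted_size a z powr q) \<phi>2" for a q \<phi>2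
    unfolding is_nu_QSD_def
  proof (intro allI iffI)
    fix \<nu>'
    assume *: "quasi_stationary \<Omega> \<zeta> \<nu>' \<and> (\<integral>\<^sup>+ x. ennreal (weighted_size a x powr q) \<partial>\<nu>') < \<infinity>
      \<and> (\<integral>\<^sup>+ x. ennreal (\<phi>2 x) \<partial>\<nu>') > 0"
    then have living: "set_pmf \<nu>' \<subseteq> living" by (simp add: quasi_stationary_def)
    have "real (total z) \<le> weighted_size a z powr q" if z: "z \<in> living" for z
    proof -
      have "real (total z) \<le> weighted_size a z powr 1"
        using total_le_weighted_size[OF a_ge_1[OF a], of z] weighted_size_ge_1[OF a_ge_1[OF a] z] by simp
      also have "\<dots> \<le> weighted_size a z powr q"
        using weighted_size_ge_1[OF a_ge_1[OF a] z] q by (intro powr_mono) auto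
      finally show ?thesis .
    qed
    moreover have "(\<integral>\<^sup>+z. ennreal (weighted_size a z powr q) \<partial>\<nu>') < \<infinity>" using * by blast
    ultimately have "(\<integral>\<^sup>+z. ennreal (real (total z)) \<partial>\<nu>') < \<infinity>" by (rule nn_integral_mono_living[OF living])
    with living have "\<nu>' \<in> attraction_domain \<Omega> \<zeta> \<nu>" by (rule attr)
    then show "\<nu>' = \<nu>" using * by (intro attraction_domain_quasi_stationary) auto
  next
    fix \<nu>' assume [simp]: "\<nu>' = \<nu>"
    obtain K \<epsilon> and \<nu>0 :: "'d state pmf" where K: "K \<subseteq> living" "set_pmf \<nu>0 \<subseteq> K" and \<epsilon>: "0 < \<epsilon>" "\<forall>x\<in>K. \<epsilon> \<le> \<phi>2 x"
      using E unfolding condition_E_def by blast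
    obtain x where x: "x \<in> set_pmf \<nu>0" using set_pmf_not_empty[of \<nu>0] by blast
    then have "0 < \<phi>2 x" "x \<in> set_pmf \<nu>" using K \<epsilon> \<nu>(1) by (auto intro: less_le_trans)
    then have "\<not> (AE x in \<nu>. ennreal (\<phi>2 x) = 0)"
      by (auto simp: AE_measure_pmf_iff intro!: bexI[of _ x])
    then have "(\<integral>\<^sup>+ x. ennreal (\<phi>2 x) \<partial>\<nu>) \<noteq> 0" by (subst nn_integral_0_iff_AE) auto
    then show "quasi_stationary \<Omega> \<zeta> \<nu>' \<and> (\<integral>\<^sup>+ x. ennreal (weighted_size a x powr q) \<partial>\<nu>') < \<infinity>
      \<and> (\<integral>\<^sup>+ x. ennreal (\<phi>2 x) \<partial>\<nu>') > 0"
      using \<nu>(2) fin[OF a q(2)] by (simp add: zero_less_iff_neq_zero)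
  qed
  have domain: "\<mu> \<in> attraction_domain \<Omega> \<zeta> \<nu>"
    if \<mu>: "set_pmf \<mu> \<subseteq> living" "1 < q" "(\<integral>\<^sup>+ z. ennreal (real (total z) powr q) \<partial>\<mu>) < \<infinity>" for \<mu> q
  proof -
    have "real (total z) \<le> real (total z) powr q" if "z \<in> living" for z
      using powr_mono[of 1 q "real (total z)"] total_ge_1[OF that] \<mu>(2) by simp
    from nn_integral_mono_living[OF \<mu>(1) this \<mu>(3)] show ?thesis by (rule attr[OF \<mu>(1)])
  qed
  show ?thesis
  proof (intro conjI ballI exI[of _ \<nu>] allI impI)
    show "perron_weights ?M \<noteq> {}"
      by (rule perron_weights_nonempty_pos(1)[OF M_nonneg primitive])
  next
    fix a q assume "a \<in> perron_weights ?M" "q \<in> {1<..q0}"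
    then show "\<exists>\<phi>2. condition_E \<Omega> \<zeta> (\<lambda>z. weighted_size a z powr q) \<phi>2"
      by (intro condition_E_holds) auto
  next
    fix a q \<phi>2 assume "a \<in> perron_weights ?M" "q \<in> {1<..q0}"
      and "condition_E \<Omega> \<zeta> (\<lambda>z. weighted_size a z powr q) \<phi>2"
    then show "is_nu_QSD \<Omega> \<zeta> (\<lambda>z. weighted_size a z powr q) \<phi>2 \<nu>"
      by (intro qsd) auto
  next
    fix \<mu> :: "'d state pmf" and q :: real
    assume "set_pmf \<mu> \<subseteq> living \<and> 1 < q \<and> (\<integral>\<^sup>+ z. ennreal (real (total z) powr q) \<partial>\<mu>) < \<infinity>"
    then show "\<mu> \<in> attraction_domain \<Omega> \<zeta> \<nu>"
      by (intro domain[of \<mu> q]) auto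
  qed
qed

end
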